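(* Every normal almost bi-paracontact manifold $(M,\eta,\phi_1,\phi_2,\phi_3)$ carries four mutually transverse Legendre foliations whose leaves are totally geodesic (with respect to the canonical connection $\nabla^c$) and admit an affine structure.
   Context: Everything is smooth. A contact manifold $(M,\eta)$ is a $(2n+1)$-dimensional manifold with a $1$-form $\eta$ such that $\eta\wedge(d\eta)^n\neq 0$ everywhere; its Reeb vector field $\xi$ is determined by $\eta(\xi)=1$, $d\eta(\xi,\cdot)=0$; $\mathcal D=\ker\eta$. Normalization: $2d\eta(X,Y)=X(\eta(Y))-Y(\eta(X))-\eta([X,Y])$. A Legendre foliation is (the foliation defined by) an involutive rank $n$ subbundle of $\mathcal D$. Mutually transverse means that any two of the (tangent distributions of the) foliations are complementary in $\mathcal D$. An almost bi-paracontact structure on $(M,\eta)$ is a triplet $(\phi_1,\phi_2,\phi_3)$ of $(1,1)$-tensor fields with $\phi_1\phi_2=-\phi_2\phi_1$, $\phi_1^2=\phi_2^2=I-\eta\otimes\xi$, $\phi_3=\phi_1\phi_2$, and $\phi_3^2=-I+\eta\otimes\xi$. With $[\phi,\phi](X,Y)=\phi^2[X,Y]+[\phi X,\phi Y]-\phi[\phi X,Y]-\phi[X,\phi Y]$, put $N^{(1)}_{\phi_\alpha}=[\phi_\alpha,\phi_\alpha]-2d\eta\otimes\xi$ for $\alpha=1,2$ and $N^{(1)}_{\phi_3}=[\phi_3,\phi_3]+2d\eta\otimes\xi$. The structure is normal if $N^{(1)}_{\phi_\alpha}=0$ for $\alpha=1,2,3$. On a normal almost bi-paracontact manifold the canonical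 connection $\nabla^c$ is the unique linear connection with $\nabla^c\xi=0$, $\nabla^c\phi_\alpha=0$ for $\alpha=1,2,3$, and torsion $T^c=2d\eta\otimes\xi$. An affine structure on a manifold is a flat torsion-free linear connection (equivalently an atlas with affine transition maps). *)

theory Defs
  imports "HOL-Analysis.Analysis" "HOL-Combinatorics.Permutations"
begin

section \<open>Smooth manifolds\<close>

primrec Ck_on :: "nat \<Rightarrow> 'e::real_normed_vector set \<Rightarrow> ('e \<Rightarrow> 'b::real_normed_vector) \<Rightarrow> bool" where
  "Ck_on 0 S f \<longleftrightarrow> continuous_on S f"
| "Ck_on (Suc k) S f \<longleftrightarrow>
     (\<forall>x\<in>S. f differentiable (at x)) \<and> (\<forall>v. Ck_on k S (\<lambda>x. frechet_derivative f (at x) v))"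

text \<open>Smoothness on an open set of a finite-dimensional space.\<close>

definition smooth_on :: "'e::euclidean_space set \<Rightarrow> ('e \<Rightarrow> 'b::real_normed_vector) \<Rightarrow> bool" where
  "smooth_on S f \<longleftrightarrow> (\<forall>k. Ck_on k S f)"

text \<open>A chart is a pair of its domain and a coordinate map, whose values off the domain are
  irrelevant. The type \<^typ>\<open>'e\<close> is the model space.\<close>

type_synonym ('a, 'e) chart = "'a set \<times> ('a \<Rightarrow> 'e)"

record ('a, 'e) mfd =
  mtop :: "'a topology"
  charts :: "('a, 'e) chart set"

abbreviation chart_inv :: "('a, 'e) chart \<Rightarrow> 'e \<Rightarrow> 'a" where
  "chart_inv c \<equiv> inv_into (fst c) (snd c)"

abbreviation points :: "('a, 'e) mfd \<Rightarrow> 'a set" where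
  "points M \<equiv> topspace (mtop M)"

definition smooth_manifold :: "('a, 'e::euclidean_space) mfd \<Rightarrow> bool" where
  "smooth_manifold M \<longleftrightarrow>
     Hausdorff_space (mtop M) \<and> second_countable (mtop M) \<and>
     (\<Union>c\<in>charts M. fst c) = points M \<and>
     (\<forall>c\<in>charts M. openin (mtop M) (fst c) \<and> open (snd c ` fst c) \<and>
        homeomorphic_map (subtopology (mtop M) (fst c)) (top_of_set (snd c ` fst c)) (snd c)) \<and>
     (\<forall>c\<in>charts M. \<forall>d\<in>charts M. smooth_on (snd c ` (fst c \<inter> fst d)) (snd d \<circ> chart_inv c))"

definition smooth_map ::
    "('a, 'e::euclidean_space) mfd \<Rightarrow> ('b, 'f::euclidean_space) mfd \<Rightarrow> ('a \<Rightarrow> 'b) \<Rightarrow> bool" where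
  "smooth_map M N f \<longleftrightarrow> continuous_map (mtop M) (mtop N) f \<and>
     (\<forall>c\<in>charts M. \<forall>d\<in>charts N.
        smooth_on (snd c ` (fst c \<inter> f -` fst d)) (snd d \<circ> f \<circ> chart_inv c))"

definition smooth_fun :: "('a, 'e::euclidean_space) mfd \<Rightarrow> 'a set \<Rightarrow> ('a \<Rightarrow> real) \<Rightarrow> bool" where
  "smooth_fun M W f \<longleftrightarrow> (\<forall>c\<in>charts M. smooth_on (snd c ` (fst c \<inter> W)) (f \<circ> chart_inv c))"

section \<open>Tangent vectors and vector fields\<close>

text \<open>Every point \<open>p\<close> gets a preferred chart of the atlas. A tangent vector at \<open>p\<close> is represented by
  its coordinate vector in that chart, so each tangent space is a copy of the model space \<^typ>\<open>'e\<close>.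
  Since the preferred chart may jump from point to point, smoothness of a vector field is
  never smoothness of its raw values: it is expressed in a fixed chart, through \<open>vf_rep\<close>.\<close>

definition chart_at :: "('a, 'e) mfd \<Rightarrow> 'a \<Rightarrow> ('a, 'e) chart" where
  "chart_at M p = (SOME c. c \<in> charts M \<and> p \<in> fst c)"

definition coord_at :: "('a, 'e) mfd \<Rightarrow> 'a \<Rightarrow> 'e" where
  "coord_at M p = snd (chart_at M p) p"

definition mdiff ::
    "('a, 'e::euclidean_space) mfd \<Rightarrow> ('b, 'f::euclidean_space) mfd \<Rightarrow> ('a \<Rightarrow> 'b) \<Rightarrow> 'a \<Rightarrow> 'e \<Rightarrow> 'f" where
  "mdiff M N f p =
     frechet_derivative (snd (chart_at N (f p)) \<circ> f \<circ> chart_inv (chart_at M p)) (at (coord_at M p))"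

definition dfun :: "('a, 'e::euclidean_space) mfd \<Rightarrow> ('a \<Rightarrow> real) \<Rightarrow> 'a \<Rightarrow> 'e \<Rightarrow> real" where
  "dfun M f p = frechet_derivative (f \<circ> chart_inv (chart_at M p)) (at (coord_at M p))"

text \<open>Coordinates in the chart \<open>c\<close> of the tangent vector at \<open>p\<close> represented by \<open>v\<close>.\<close>

definition tcoord :: "('a, 'e::euclidean_space) mfd \<Rightarrow> ('a, 'e) chart \<Rightarrow> 'a \<Rightarrow> 'e \<Rightarrow> 'e" where
  "tcoord M c p = frechet_derivative (snd c \<circ> chart_inv (chart_at M p)) (at (coord_at M p))"

definition vf_rep :: "('a, 'e::euclidean_space) mfd \<Rightarrow> ('a, 'e) chart \<Rightarrow> ('a \<Rightarrow> 'e) \<Rightarrow> 'e \<Rightarrow> 'e" where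
  "vf_rep M c X z = tcoord M c (chart_inv c z) (X (chart_inv c z))"

definition vfield :: "('a, 'e::euclidean_space) mfd \<Rightarrow> 'a set \<Rightarrow> ('a \<Rightarrow> 'e) \<Rightarrow> bool" where
  "vfield M W X \<longleftrightarrow> (\<forall>c\<in>charts M. smooth_on (snd c ` (fst c \<inter> W)) (vf_rep M c X))"

text \<open>The coordinate formula \<open>[X,Y] = DY(X) - DX(Y)\<close>, evaluated at \<open>p\<close> in the preferred chart at \<open>p\<close>.\<close>

definition bracket :: "('a, 'e::euclidean_space) mfd \<Rightarrow> ('a \<Rightarrow> 'e) \<Rightarrow> ('a \<Rightarrow> 'e) \<Rightarrow> 'a \<Rightarrow> 'e" where
  "bracket M X Y p =
     frechet_derivative (vf_rep M (chart_at M p) Y) (at (coord_at M p)) (X p) -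
     frechet_derivative (vf_rep M (chart_at M p) X) (at (coord_at M p)) (Y p)"

text \<open>The local vector field with constant coefficients \<open>v\<close> in the preferred chart at \<open>p\<close>.\<close>

definition const_field :: "('a, 'e::euclidean_space) mfd \<Rightarrow> 'a \<Rightarrow> 'e \<Rightarrow> 'a \<Rightarrow> 'e" where
  "const_field M p v q =
     frechet_derivative (snd (chart_at M q) \<circ> chart_inv (chart_at M p)) (at (snd (chart_at M p) q)) v"

section \<open>Tensor fields and contact forms\<close>

definition one_form :: "('a, 'e::euclidean_space) mfd \<Rightarrow> ('a \<Rightarrow> 'e \<Rightarrow> real) \<Rightarrow> bool" where
  "one_form M \<eta> \<longleftrightarrow> (\<forall>p\<in>points M. linear (\<eta> p)) \<and>
     (\<forall>W X. openin (mtop M) W \<and> vfield M W X \<longrightarrow> smooth_fun M W (\<lambda>p. \<eta> p (X p)))"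

definition tensor11 :: "('a, 'e::euclidean_space) mfd \<Rightarrow> ('a \<Rightarrow> 'e \<Rightarrow> 'e) \<Rightarrow> bool" where
  "tensor11 M \<phi> \<longleftrightarrow> (\<forall>p\<in>points M. linear (\<phi> p)) \<and>
     (\<forall>W X. openin (mtop M) W \<and> vfield M W X \<longrightarrow> vfield M W (\<lambda>p. \<phi> p (X p)))"

text \<open>The function \<open>d\<eta>(X,Y)\<close>, normalised by \<open>2 d\<eta>(X,Y) = X(\<eta>(Y)) - Y(\<eta>(X)) - \<eta>([X,Y])\<close>.\<close>

definition dform ::
    "('a, 'e::euclidean_space) mfd \<Rightarrow> ('a \<Rightarrow> 'e \<Rightarrow> real) \<Rightarrow> ('a \<Rightarrow> 'e) \<Rightarrow> ('a \<Rightarrow> 'e) \<Rightarrow> 'a \<Rightarrow> real" where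
  "dform M \<eta> X Y p =
     (dfun M (\<lambda>q. \<eta> q (Y q)) p (X p) - dfun M (\<lambda>q. \<eta> q (X q)) p (Y p) - \<eta> p (bracket M X Y p)) / 2"

definition dform_at ::
    "('a, 'e::euclidean_space) mfd \<Rightarrow> ('a \<Rightarrow> 'e \<Rightarrow> real) \<Rightarrow> 'a \<Rightarrow> 'e \<Rightarrow> 'e \<Rightarrow> real" where
  "dform_at M \<eta> p v w = dform M \<eta> (const_field M p v) (const_field M p w) p"

text \<open>An alternating \<open>k\<close>-form on a vector space is a function of a sequence of vectors which only
  looks at the first \<open>k\<close> entries. The factor \<open>1/(k+l)!\<close> is the one that goes with the normalisation
  of \<open>d\<close> above.\<close>

definition wedge ::
    "nat \<Rightarrow> nat \<Rightarrow> ((nat \<Rightarrow> 'e) \<Rightarrow> real) \<Rightarrow> ((nat \<Rightarrow> 'e) \<Rightarrow> real) \<Rightarrow> (nat \<Rightarrow> 'e) \<Rightarrow> real" where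
  "wedge k l \<alpha> \<beta> v =
     (\<Sum>\<sigma> | \<sigma> permutes {..<k + l}. of_int (sign \<sigma>) * \<alpha> (\<lambda>i. v (\<sigma> i)) * \<beta> (\<lambda>i. v (\<sigma> (k + i)))) / fact (k + l)"

primrec wedge_power :: "((nat \<Rightarrow> 'e) \<Rightarrow> real) \<Rightarrow> nat \<Rightarrow> (nat \<Rightarrow> 'e) \<Rightarrow> real" where
  "wedge_power \<omega> 0 = (\<lambda>v. 1)"
| "wedge_power \<omega> (Suc n) = wedge 2 (2 * n) \<omega> (wedge_power \<omega> n)"

definition contact_manifold ::
    "('a, 'e::euclidean_space) mfd \<Rightarrow> nat \<Rightarrow> ('a \<Rightarrow> 'e \<Rightarrow> real) \<Rightarrow> bool" where
  "contact_manifold M n \<eta> \<longleftrightarrow> smooth_manifold M \<and> DIM('e) = 2 * n + 1 \<and> one_form M \<eta> \<and>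
     (\<forall>p\<in>points M. \<exists>v. wedge 1 (2 * n) (\<lambda>u. \<eta> p (u 0))
        (wedge_power (\<lambda>u. dform_at M \<eta> p (u 0) (u 1)) n) v \<noteq> 0)"

definition reeb_field ::
    "('a, 'e::euclidean_space) mfd \<Rightarrow> ('a \<Rightarrow> 'e \<Rightarrow> real) \<Rightarrow> ('a \<Rightarrow> 'e) \<Rightarrow> bool" where
  "reeb_field M \<eta> \<xi> \<longleftrightarrow> vfield M (points M) \<xi> \<and> (\<forall>p\<in>points M. \<eta> p (\<xi> p) = 1) \<and>
     (\<forall>W X. openin (mtop M) W \<and> vfield M W X \<longrightarrow> (\<forall>p\<in>W. dform M \<eta> \<xi> X p = 0))"

section \<open>Normal almost bi-paracontact structures\<close>

definition almost_bi_paracontact ::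
    "('a, 'e::euclidean_space) mfd \<Rightarrow> ('a \<Rightarrow> 'e \<Rightarrow> real) \<Rightarrow> ('a \<Rightarrow> 'e) \<Rightarrow>
     ('a \<Rightarrow> 'e \<Rightarrow> 'e) \<Rightarrow> ('a \<Rightarrow> 'e \<Rightarrow> 'e) \<Rightarrow> ('a \<Rightarrow> 'e \<Rightarrow> 'e) \<Rightarrow> bool" where
  "almost_bi_paracontact M \<eta> \<xi> \<phi>1 \<phi>2 \<phi>3 \<longleftrightarrow>
     tensor11 M \<phi>1 \<and> tensor11 M \<phi>2 \<and> tensor11 M \<phi>3 \<and>
     (\<forall>p\<in>points M. \<forall>v.
        \<phi>1 p (\<phi>2 p v) = - \<phi>2 p (\<phi>1 p v) \<and>
        \<phi>1 p (\<phi>1 p v) = v - \<eta> p v *\<^sub>R \<xi> p \<and>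
        \<phi>2 p (\<phi>2 p v) = v - \<eta> p v *\<^sub>R \<xi> p \<and>
        \<phi>3 p v = \<phi>1 p (\<phi>2 p v) \<and>
        \<phi>3 p (\<phi>3 p v) = - v + \<eta> p v *\<^sub>R \<xi> p)"

definition nijenhuis ::
    "('a, 'e::euclidean_space) mfd \<Rightarrow> ('a \<Rightarrow> 'e \<Rightarrow> 'e) \<Rightarrow> ('a \<Rightarrow> 'e) \<Rightarrow> ('a \<Rightarrow> 'e) \<Rightarrow> 'a \<Rightarrow> 'e" where
  "nijenhuis M \<phi> X Y p =
     \<phi> p (\<phi> p (bracket M X Y p)) + bracket M (\<lambda>q. \<phi> q (X q)) (\<lambda>q. \<phi> q (Y q)) p
     - \<phi> p (bracket M (\<lambda>q. \<phi> q (X q)) Y p) - \<phi> p (bracket M X (\<lambda>q. \<phi> q (Y q)) p)"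

definition normal_bi_paracontact ::
    "('a, 'e::euclidean_space) mfd \<Rightarrow> ('a \<Rightarrow> 'e \<Rightarrow> real) \<Rightarrow> ('a \<Rightarrow> 'e) \<Rightarrow>
     ('a \<Rightarrow> 'e \<Rightarrow> 'e) \<Rightarrow> ('a \<Rightarrow> 'e \<Rightarrow> 'e) \<Rightarrow> ('a \<Rightarrow> 'e \<Rightarrow> 'e) \<Rightarrow> bool" where
  "normal_bi_paracontact M \<eta> \<xi> \<phi>1 \<phi>2 \<phi>3 \<longleftrightarrow>
     almost_bi_paracontact M \<eta> \<xi> \<phi>1 \<phi>2 \<phi>3 \<and>
     (\<forall>W X Y. openin (mtop M) W \<and> vfield M W X \<and> vfield M W Y \<longrightarrow> (\<forall>p\<in>W.
        nijenhuis M \<phi>1 X Y p - (2 * dform M \<eta> X Y p) *\<^sub>R \<xi> p = 0 \<and>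
        nijenhuis M \<phi>2 X Y p - (2 * dform M \<eta> X Y p) *\<^sub>R \<xi> p = 0 \<and>
        nijenhuis M \<phi>3 X Y p + (2 * dform M \<eta> X Y p) *\<^sub>R \<xi> p = 0))"

section \<open>Linear connections\<close>

text \<open>\<open>nab Y p v\<close> is the covariant derivative at \<open>p\<close> of \<open>Y\<close>, a vector field near \<open>p\<close>, in the
  direction \<open>v\<close>. The last clause fixes the value in the meaningless case that \<open>Y\<close> is not a smooth
  vector field near \<open>p\<close>, so that equal connections are equal functions.\<close>

definition linear_connection ::
    "('a, 'e::euclidean_space) mfd \<Rightarrow> (('a \<Rightarrow> 'e) \<Rightarrow> 'a \<Rightarrow> 'e \<Rightarrow> 'e) \<Rightarrow> bool" where
  "linear_connection M nab \<longleftrightarrow>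
     (\<forall>W Y. openin (mtop M) W \<and> vfield M W Y \<longrightarrow>
        (\<forall>p\<in>W. linear (nab Y p)) \<and>
        (\<forall>X. vfield M W X \<longrightarrow> vfield M W (\<lambda>p. nab Y p (X p))) \<and>
        (\<forall>Z. vfield M W Z \<longrightarrow> (\<forall>p\<in>W. \<forall>v. nab (\<lambda>q. Y q + Z q) p v = nab Y p v + nab Z p v)) \<and>
        (\<forall>f. smooth_fun M W f \<longrightarrow>
           (\<forall>p\<in>W. \<forall>v. nab (\<lambda>q. f q *\<^sub>R Y q) p v = dfun M f p v *\<^sub>R Y p + f p *\<^sub>R nab Y p v)) \<and>
        (\<forall>Z. (\<forall>q\<in>W. Z q = Y q) \<longrightarrow> (\<forall>p\<in>W. nab Z p = nab Y p))) \<and>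
     (\<forall>Y p. \<not> (\<exists>W. openin (mtop M) W \<and> p \<in> W \<and> vfield M W Y) \<longrightarrow> nab Y p = (\<lambda>v. 0))"

definition torsion ::
    "('a, 'e::euclidean_space) mfd \<Rightarrow> (('a \<Rightarrow> 'e) \<Rightarrow> 'a \<Rightarrow> 'e \<Rightarrow> 'e) \<Rightarrow>
     ('a \<Rightarrow> 'e) \<Rightarrow> ('a \<Rightarrow> 'e) \<Rightarrow> 'a \<Rightarrow> 'e" where
  "torsion M nab X Y p = nab Y p (X p) - nab X p (Y p) - bracket M X Y p"

definition curvature ::
    "('a, 'e::euclidean_space) mfd \<Rightarrow> (('a \<Rightarrow> 'e) \<Rightarrow> 'a \<Rightarrow> 'e \<Rightarrow> 'e) \<Rightarrow>
     ('a \<Rightarrow> 'e) \<Rightarrow> ('a \<Rightarrow> 'e) \<Rightarrow> ('a \<Rightarrow> 'e) \<Rightarrow> 'a \<Rightarrow> 'e" where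
  "curvature M nab X Y Z p =
     nab (\<lambda>q. nab Z q (Y q)) p (X p) - nab (\<lambda>q. nab Z q (X q)) p (Y p) - nab Z p (bracket M X Y p)"

definition affine_structure ::
    "('a, 'e::euclidean_space) mfd \<Rightarrow> (('a \<Rightarrow> 'e) \<Rightarrow> 'a \<Rightarrow> 'e \<Rightarrow> 'e) \<Rightarrow> bool" where
  "affine_structure M nab \<longleftrightarrow> linear_connection M nab \<and>
     (\<forall>W X Y. openin (mtop M) W \<and> vfield M W X \<and> vfield M W Y \<longrightarrow>
        (\<forall>p\<in>W. torsion M nab X Y p = 0)) \<and>
     (\<forall>W X Y Z. openin (mtop M) W \<and> vfield M W X \<and> vfield M W Y \<and> vfield M W Z \<longrightarrow>
        (\<forall>p\<in>W. curvature M nab X Y Z p = 0))"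

definition parallel11 ::
    "('a, 'e::euclidean_space) mfd \<Rightarrow> (('a \<Rightarrow> 'e) \<Rightarrow> 'a \<Rightarrow> 'e \<Rightarrow> 'e) \<Rightarrow> ('a \<Rightarrow> 'e \<Rightarrow> 'e) \<Rightarrow> bool" where
  "parallel11 M nab \<phi> \<longleftrightarrow>
     (\<forall>W Y. openin (mtop M) W \<and> vfield M W Y \<longrightarrow>
        (\<forall>p\<in>W. \<forall>v. nab (\<lambda>q. \<phi> q (Y q)) p v - \<phi> p (nab Y p v) = 0))"

definition canonical_connection ::
    "('a, 'e::euclidean_space) mfd \<Rightarrow> ('a \<Rightarrow> 'e \<Rightarrow> real) \<Rightarrow> ('a \<Rightarrow> 'e) \<Rightarrow>
     ('a \<Rightarrow> 'e \<Rightarrow> 'e) \<Rightarrow> ('a \<Rightarrow> 'e \<Rightarrow> 'e) \<Rightarrow> ('a \<Rightarrow> 'e \<Rightarrow> 'e) \<Rightarrow> ('a \<Rightarrow> 'e) \<Rightarrow> 'a \<Rightarrow> 'e \<Rightarrow> 'e" where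
  "canonical_connection M \<eta> \<xi> \<phi>1 \<phi>2 \<phi>3 = (THE nab.
     linear_connection M nab \<and>
     (\<forall>p\<in>points M. \<forall>v. nab \<xi> p v = 0) \<and>
     parallel11 M nab \<phi>1 \<and> parallel11 M nab \<phi>2 \<and> parallel11 M nab \<phi>3 \<and>
     (\<forall>W X Y. openin (mtop M) W \<and> vfield M W X \<and> vfield M W Y \<longrightarrow>
        (\<forall>p\<in>W. torsion M nab X Y p = (2 * dform M \<eta> X Y p) *\<^sub>R \<xi> p)))"

section \<open>Legendre foliations and their leaves\<close>

definition subbundle :: "('a, 'e::euclidean_space) mfd \<Rightarrow> nat \<Rightarrow> ('a \<Rightarrow> 'e set) \<Rightarrow> bool" where
  "subbundle M k F \<longleftrightarrow> (\<forall>p\<in>points M. \<exists>W E. openin (mtop M) W \<and> p \<in> W \<and>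
     (\<forall>i<k. vfield M W (E i)) \<and>
     (\<forall>q\<in>W. F q = span ((\<lambda>i::nat. E i q) ` {..<k}) \<and> dim (F q) = k))"

definition involutive :: "('a, 'e::euclidean_space) mfd \<Rightarrow> ('a \<Rightarrow> 'e set) \<Rightarrow> bool" where
  "involutive M F \<longleftrightarrow> (\<forall>W X Y. openin (mtop M) W \<and> vfield M W X \<and> vfield M W Y \<and>
     (\<forall>q\<in>W. X q \<in> F q \<and> Y q \<in> F q) \<longrightarrow> (\<forall>q\<in>W. bracket M X Y q \<in> F q))"

definition contact_distribution :: "('a \<Rightarrow> 'e \<Rightarrow> real) \<Rightarrow> 'a \<Rightarrow> 'e set" where
  "contact_distribution \<eta> p = {v. \<eta> p v = 0}"

definition legendre_foliation ::
    "('a, 'e::euclidean_space) mfd \<Rightarrow> nat \<Rightarrow> ('a \<Rightarrow> 'e \<Rightarrow> real) \<Rightarrow> ('a \<Rightarrow> 'e set) \<Rightarrow> bool" where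
  "legendre_foliation M n \<eta> F \<longleftrightarrow> subbundle M n F \<and> involutive M F \<and>
     (\<forall>p\<in>points M. F p \<subseteq> contact_distribution \<eta> p)"

definition transverse ::
    "('a, 'e::euclidean_space) mfd \<Rightarrow> ('a \<Rightarrow> 'e \<Rightarrow> real) \<Rightarrow> ('a \<Rightarrow> 'e set) \<Rightarrow> ('a \<Rightarrow> 'e set) \<Rightarrow> bool" where
  "transverse M \<eta> F G \<longleftrightarrow> (\<forall>p\<in>points M. F p \<inter> G p = {0} \<and>
     {v + w | v w. v \<in> F p \<and> w \<in> G p} = contact_distribution \<eta> p)"

text \<open>An immersed submanifold \<open>L\<close> of \<open>M\<close> is a manifold on a subset of the points of \<open>M\<close>, with its
  own (in general finer) topology and its own model space, whose inclusion is an immersion.\<close>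

definition immersed_submanifold ::
    "('a, 'e::euclidean_space) mfd \<Rightarrow> ('a, 'l::euclidean_space) mfd \<Rightarrow> bool" where
  "immersed_submanifold M L \<longleftrightarrow> smooth_manifold L \<and> points L \<subseteq> points M \<and>
     smooth_map L M (\<lambda>x. x) \<and> (\<forall>p\<in>points L. inj (mdiff L M (\<lambda>x. x) p))"

text \<open>The tangent space of \<open>L\<close> at \<open>p\<close> as a subspace of that of \<open>M\<close>.\<close>

definition tangent_space ::
    "('a, 'e::euclidean_space) mfd \<Rightarrow> ('a, 'l::euclidean_space) mfd \<Rightarrow> 'a \<Rightarrow> 'e set" where
  "tangent_space M L p = range (mdiff L M (\<lambda>x. x) p)"

definition integral_manifold ::
    "('a, 'e::euclidean_space) mfd \<Rightarrow> ('a \<Rightarrow> 'e set) \<Rightarrow> ('a, 'l::euclidean_space) mfd \<Rightarrow> bool" where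
  "integral_manifold M F L \<longleftrightarrow> immersed_submanifold M L \<and> points L \<noteq> {} \<and>
     connected_space (mtop L) \<and> (\<forall>p\<in>points L. tangent_space M L p = F p)"

definition leaf ::
    "('a, 'e::euclidean_space) mfd \<Rightarrow> ('a \<Rightarrow> 'e set) \<Rightarrow> ('a, 'l::euclidean_space) mfd \<Rightarrow> bool" where
  "leaf M F L \<longleftrightarrow> integral_manifold M F L \<and>
     (\<forall>L' :: ('a, 'l) mfd. integral_manifold M F L' \<and> points L \<subseteq> points L' \<longrightarrow> points L' = points L)"

text \<open>Covariant derivatives of fields tangent to \<open>L\<close> along \<open>L\<close> are tangent to \<open>L\<close>. The set \<open>P\<close> is open
  in the topology of \<open>L\<close> and not only in the subspace topology: a field defined near a point of \<open>L\<close> is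
  required to be tangent to \<open>L\<close> on one sheet of \<open>L\<close> only, not on all those that accumulate there.\<close>

definition totally_geodesic ::
    "('a, 'e::euclidean_space) mfd \<Rightarrow> (('a \<Rightarrow> 'e) \<Rightarrow> 'a \<Rightarrow> 'e \<Rightarrow> 'e) \<Rightarrow> ('a, 'l::euclidean_space) mfd \<Rightarrow> bool" where
  "totally_geodesic M nab L \<longleftrightarrow>
     (\<forall>W P X Y. openin (mtop M) W \<and> openin (mtop L) P \<and> P \<subseteq> W \<and> vfield M W X \<and> vfield M W Y \<and>
        (\<forall>q\<in>P. X q \<in> tangent_space M L q \<and> Y q \<in> tangent_space M L q) \<longrightarrow>
        (\<forall>q\<in>P. nab Y q (X q) \<in> tangent_space M L q))"

end

theory Submission
  imports Defs
begin

text \<open>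
  The four foliations are the eigendistributions of \<open>\<phi>\<^sub>1\<close> and of \<open>\<phi>\<^sub>2\<close> for the eigenvalues \<open>1\<close> and
  \<open>-1\<close>. Each of the pairs \<open>(\<phi>\<^sub>1, \<phi>\<^sub>2)\<close>, \<open>(-\<phi>\<^sub>1, \<phi>\<^sub>2)\<close>, \<open>(\<phi>\<^sub>2, \<phi>\<^sub>1)\<close>, \<open>(-\<phi>\<^sub>2, \<phi>\<^sub>1)\<close> consists of two
  anticommuting normal structure tensors, and they all have the same canonical connection. So it is
  enough to study the \<open>+1\<close> eigendistribution of the first member of a pair \<open>(f, g)\<close>; this is the
  setting of the locale \<open>normal_pair\<close>.

  For two sections of an eigendistribution of \<open>f\<close> the normality condition collapses to
  the statement that their bracket is again a section (\<open>eigen_bracket\<close>). Since \<open>g\<close> anticommutes with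
  \<open>f\<close>, it exchanges the two eigendistributions of \<open>f\<close>, so both have half the dimension of the contact
  distribution (\<open>dim_eigen\<close>). A common eigenvector of \<open>\<phi>\<^sub>1\<close> and \<open>\<phi>\<^sub>2\<close> with nonzero
  eigenvalues cannot exist by anticommutation, and two subspaces of half dimension that meet trivially are complementary.

  The canonical connection is given by a definite description, so existence and uniqueness have to
  be proved. The difference of two candidates is symmetric and commutes with \<open>f\<close> and \<open>g\<close> in each
  argument, and anticommutation forces it to vanish (\<open>canonical_unique\<close>). For existence let \<open>P\<close>, \<open>Q\<close>
  be the projections to the two eigendistributions of \<open>f\<close>. The Bott connections \<open>Q [P X, Q Y]\<close> and
  \<open>P [Q X, P Y]\<close> prescribe half of the connection, conjugation by \<open>g\<close> the other half, and the Reeb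
  direction is forced (\<open>cov\<close>). That this has the right torsion is the normality of \<open>f\<close> and \<open>g\<close>
  (\<open>cov_torsion\<close>).

  A connection that preserves \<open>f\<close> differentiates sections of the eigendistribution to such
  sections, in directions tangent to a leaf even if the section is only given along the leaf; hence
  leaves are totally geodesic. On sections of the eigendistribution the connection is
  \<open>\<nabla>\<^sub>X Y = g Q [X, g Y]\<close>, a Bott connection transported by \<open>g\<close>, whose curvature vanishes by the Jacobi
  identity (\<open>curvature_on_eigen\<close>), and the torsion vanishes because \<open>d\<eta>\<close> vanishes on a Legendre
  distribution. The induced connection on a leaf is therefore flat and torsion-free. A leaf is
  an immersed submanifold with its own charts and topology, so to define that connection a field
  of the leaf is extended locally to \<open>M\<close>, by means of a smooth left inverse of the inclusion
  (\<open>immersion_smooth_left_inverse\<close>); the result does not depend on the extension, because a covariant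
  derivative in a tangent direction depends on the values along the leaf only
  (\<open>connection_zero_along\<close>), and brackets of extensions extend brackets (\<open>bracket_push\<close>).
\<close>

section \<open>Derivatives\<close>

abbreviation fd :: "('e::real_normed_vector \<Rightarrow> 'b::real_normed_vector) \<Rightarrow> 'e \<Rightarrow> 'e \<Rightarrow> 'b" where
  "fd f x \<equiv> frechet_derivative f (at x)"

lemma fd_eqI: "(f has_derivative f') (at x) \<Longrightarrow> fd f x = f'"
  by (rule frechet_derivative_at[symmetric])

lemma has_derivative_fd: "f differentiable (at x) \<Longrightarrow> (f has_derivative fd f x) (at x)"
  by (simp add: frechet_derivative_works)

lemma fd_cong_open:
  assumes "open S" "x \<in> S" "\<And>y. y \<in> S \<Longrightarrow> f y = g y"
  shows "fd f x = fd g x"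
proof -
  have "(f has_derivative D) (at x) \<longleftrightarrow> (g has_derivative D) (at x)" for D
    using has_derivative_transform_within_open[of f D x UNIV S g]
      has_derivative_transform_within_open[of g D x UNIV S f] assms by auto
  then show ?thesis by (simp add: frechet_derivative_def)
qed

lemma differentiable_cong_open:
  assumes "open S" "x \<in> S" "\<And>y. y \<in> S \<Longrightarrow> f y = g y" "f differentiable (at x)"
  shows "g differentiable (at x)"
  using assms has_derivative_transform_within_open[of f _ x UNIV S g]
  by (auto simp: differentiable_def)

lemma fd_chain:
  assumes "f differentiable (at (g x))" "g differentiable (at x)"
  shows "fd (\<lambda>x. f (g x)) x v = fd f (g x) (fd g x v)"
proof -
  have "((\<lambda>x. f (g x)) has_derivative (\<lambda>v. fd f (g x) (fd g x v))) (at x)"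
    using diff_chain_at[OF has_derivative_fd[OF assms(2)] has_derivative_fd[OF assms(1)]]
    by (simp add: o_def)
  then show ?thesis by (simp add: fd_eqI)
qed

lemma fd_bilinear:
  assumes "bounded_bilinear h" "f differentiable (at x)" "g differentiable (at x)"
  shows "fd (\<lambda>x. h (f x) (g x)) x v = h (f x) (fd g x v) + h (fd f x v) (g x)"
    "(\<lambda>x. h (f x) (g x)) differentiable (at x)"
proof -
  have "((\<lambda>x. h (f x) (g x)) has_derivative (\<lambda>v. h (f x) (fd g x v) + h (fd f x v) (g x))) (at x)"
    using bounded_bilinear.FDERIV[OF assms(1) has_derivative_fd[OF assms(2)] has_derivative_fd[OF assms(3)]] .
  then show "fd (\<lambda>x. h (f x) (g x)) x v = h (f x) (fd g x v) + h (fd f x v) (g x)"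
    "(\<lambda>x. h (f x) (g x)) differentiable (at x)" by (auto simp: fd_eqI differentiable_def)
qed

lemma fd_add:
  assumes "f differentiable (at x)" "g differentiable (at x)"
  shows "fd (\<lambda>x. f x + g x) x v = fd f x v + fd g x v"
  by (simp add: fd_eqI[OF has_derivative_add[OF has_derivative_fd[OF assms(1)] has_derivative_fd[OF assms(2)]]])

lemma fd_diff:
  assumes "f differentiable (at x)" "g differentiable (at x)"
  shows "fd (\<lambda>x. f x - g x) x v = fd f x v - fd g x v"
  by (simp add: fd_eqI[OF has_derivative_diff[OF has_derivative_fd[OF assms(1)] has_derivative_fd[OF assms(2)]]])

lemma fd_bounded_linear:
  assumes "bounded_linear h" "f differentiable (at x)"
  shows "fd (\<lambda>x. h (f x)) x v = h (fd f x v)" "(\<lambda>x. h (f x)) differentiable (at x)"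
proof -
  note D = bounded_linear.has_derivative[OF assms(1) has_derivative_fd[OF assms(2)]]
  show "fd (\<lambda>x. h (f x)) x v = h (fd f x v)" by (simp add: fd_eqI[OF D])
  show "(\<lambda>x. h (f x)) differentiable (at x)" using D unfolding differentiable_def by blast
qed

lemma fd_expand:
  fixes f :: "'e::euclidean_space \<Rightarrow> 'b::real_normed_vector"
  assumes "f differentiable (at x)"
  shows "fd f x v = (\<Sum>b\<in>Basis. (v \<bullet> b) *\<^sub>R fd f x b)"
proof -
  interpret linear "fd f x" using linear_frechet_derivative[OF assms] .
  show ?thesis
    by (subst euclidean_representation[of v, symmetric]) (simp add: sum scale)
qed

section \<open>Functions of class \<open>C\<^sup>k\<close>\<close>

lemma Ck_on_subset: "Ck_on k S f \<Longrightarrow> T \<subseteq> S \<Longrightarrow> Ck_on k T f"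
  by (induction k arbitrary: f) (auto intro: continuous_on_subset)

lemma Ck_on_cong:
  assumes "open S" "\<And>x. x \<in> S \<Longrightarrow> f x = g x" "Ck_on k S f"
  shows "Ck_on k S g"
  using assms(2,3)
proof (induction k arbitrary: f g)
  case 0
  then show ?case by (simp cong: continuous_on_cong)
next
  case (Suc k)
  have "fd f x = fd g x" if "x \<in> S" for x
    using fd_cong_open[OF assms(1) that Suc.prems(1)] .
  then have "Ck_on k S (\<lambda>x. fd g x v)" for v
    using Suc.IH[of "\<lambda>x. fd f x v" "\<lambda>x. fd g x v"] Suc.prems(2) by simp
  moreover have "g differentiable (at x)" if "x \<in> S" for x
    using differentiable_cong_open[OF assms(1) that Suc.prems(1)] Suc.prems(2) that by simp
  ultimately show ?case by simp
qed

lemma Ck_on_Suc_imp: "Ck_on (Suc k) S f \<Longrightarrow> Ck_on k S f"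
proof (induction k arbitrary: f)
  case 0
  then show ?case
    by (auto intro!: continuous_at_imp_continuous_on differentiable_imp_continuous_within)
next
  case (Suc k)
  then show ?case by (subst Ck_on.simps) (auto simp del: Ck_on.simps(1) simp: Ck_on.simps(2))
qed

lemma Ck_on_local:
  assumes "\<And>x. x \<in> S \<Longrightarrow> \<exists>U. open U \<and> x \<in> U \<and> Ck_on k U f"
  shows "Ck_on k S f"
  using assms
proof (induction k arbitrary: f)
  case 0
  then show ?case
    by (auto simp: continuous_on_eq_continuous_at intro!: continuous_at_imp_continuous_on)
      (metis continuous_on_eq_continuous_at)
next
  case (Suc k)
  have "Ck_on k S (\<lambda>x. fd f x v)" for v
    by (rule Suc.IH) (use Suc.prems in \<open>simp, metis\<close>)
  then show ?case using Suc.prems by auto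
qed

lemma Ck_on_const: "Ck_on k S (\<lambda>x. c)"
  by (induction k arbitrary: c) auto

lemma Ck_on_bounded_linear:
  assumes "bounded_linear h" "open S" "Ck_on k S f"
  shows "Ck_on k S (\<lambda>x. h (f x))"
  using assms(3)
proof (induction k arbitrary: f)
  case 0
  then show ?case using bounded_linear.continuous_on[OF assms(1)] by simp
next
  case (Suc k)
  have "Ck_on k S (\<lambda>x. fd (\<lambda>x. h (f x)) x v)" for v
    by (rule Ck_on_cong[OF assms(2) _ Suc.IH[of "\<lambda>x. fd f x v"]])
      (use Suc.prems in \<open>auto simp: fd_bounded_linear[OF assms(1)]\<close>)
  moreover have "(\<lambda>x. h (f x)) differentiable (at x)" if "x \<in> S" for x
    using Suc.prems that by (intro fd_bounded_linear(2)[OF assms(1)]) auto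
  ultimately show ?case by simp
qed

lemma Ck_on_add:
  assumes "open S" "Ck_on k S f" "Ck_on k S g"
  shows "Ck_on k S (\<lambda>x. f x + g x)"
  using assms(2,3)
proof (induction k arbitrary: f g)
  case 0
  then show ?case by (simp add: continuous_on_add)
next
  case (Suc k)
  have "Ck_on k S (\<lambda>x. fd (\<lambda>x. f x + g x) x v)" for v
    by (rule Ck_on_cong[OF assms(1) _ Suc.IH[of "\<lambda>x. fd f x v" "\<lambda>x. fd g x v"]])
      (use Suc.prems in \<open>auto simp: fd_add\<close>)
  then show ?case using Suc.prems by (auto intro: differentiable_add)
qed

lemma Ck_on_bilinear:
  assumes "bounded_bilinear h" "open S" "Ck_on k S f" "Ck_on k S g"
  shows "Ck_on k S (\<lambda>x. h (f x) (g x))"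
  using assms(3,4)
proof (induction k arbitrary: f g)
  case 0
  then show ?case using bounded_bilinear.continuous_on[OF assms(1)] by simp
next
  case (Suc k)
  have "Ck_on k S (\<lambda>x. fd (\<lambda>x. h (f x) (g x)) x v)" for v
  proof (rule Ck_on_cong[OF assms(2)])
    show "Ck_on k S (\<lambda>x. h (f x) (fd g x v) + h (fd f x v) (g x))"
      using Suc.prems
      by (intro Ck_on_add[OF assms(2)] Suc.IH) (auto dest: Ck_on_Suc_imp simp del: Ck_on.simps(2), auto)
  qed (use Suc.prems in \<open>auto simp: fd_bilinear[OF assms(1)]\<close>)
  moreover have "(\<lambda>x. h (f x) (g x)) differentiable (at x)" if "x \<in> S" for x
    using Suc.prems that by (intro fd_bilinear(2)[OF assms(1)]) auto
  ultimately show ?case by simp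
qed

lemma Ck_on_sum:
  assumes "open S" "\<And>i. i \<in> I \<Longrightarrow> Ck_on k S (f i)"
  shows "Ck_on k S (\<lambda>x. \<Sum>i\<in>I. f i x)"
  using assms(2)
  by (induction I rule: infinite_finite_induct) (auto simp: Ck_on_const intro: Ck_on_add[OF assms(1)])

lemma Ck_on_compose:
  fixes g :: "'a::real_normed_vector \<Rightarrow> 'e::euclidean_space" and f :: "'e \<Rightarrow> 'b::real_normed_vector"
  assumes "open S" "open T" "g ` S \<subseteq> T" "Ck_on k T f" "Ck_on k S g"
  shows "Ck_on k S (\<lambda>x. f (g x))"
  using assms(4,5)
proof (induction k arbitrary: f)
  case 0
  then show ?case
    using continuous_on_compose[of S g f] assms(3) by (auto intro: continuous_on_subset simp: o_def)
next
  case (Suc k)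
  have gk: "Ck_on k S g" using Suc.prems(2) by (rule Ck_on_Suc_imp)
  have "Ck_on k S (\<lambda>x. fd (\<lambda>x. f (g x)) x v)" for v
  proof (rule Ck_on_cong[OF assms(1)])
    show "Ck_on k S (\<lambda>x. \<Sum>b\<in>Basis. (fd g x v \<bullet> b) *\<^sub>R fd f (g x) b)"
      using Suc.prems
      by (intro Ck_on_sum[OF assms(1)] Ck_on_bilinear[OF bounded_bilinear_scaleR assms(1)] Suc.IH gk
          Ck_on_bounded_linear[OF bounded_linear_inner_left assms(1)]) auto
  next
    fix x assume x: "x \<in> S"
    then have 1: "f differentiable (at (g x))" "g differentiable (at x)"
      using Suc.prems assms(3) by auto
    show "(\<Sum>b\<in>Basis. (fd g x v \<bullet> b) *\<^sub>R fd f (g x) b) = fd (\<lambda>x. f (g x)) x v"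
      by (simp add: fd_chain[OF 1] fd_expand[OF 1(1), symmetric])
  qed
  moreover have "(\<lambda>x. f (g x)) differentiable (at x)" if "x \<in> S" for x
    using differentiable_chain_at[of g x f] Suc.prems assms(3) that by (auto simp: o_def)
  ultimately show ?case by simp
qed

section \<open>Smooth functions\<close>

lemma smooth_onD: "smooth_on S f \<Longrightarrow> x \<in> S \<Longrightarrow> f differentiable (at x)"
  unfolding smooth_on_def by (metis Ck_on.simps(2))

lemma smooth_on_continuous: "smooth_on S f \<Longrightarrow> continuous_on S f"
  unfolding smooth_on_def by (metis Ck_on.simps(1))

lemma smooth_on_subset: "smooth_on S f \<Longrightarrow> T \<subseteq> S \<Longrightarrow> smooth_on T f"
  unfolding smooth_on_def using Ck_on_subset by blast

lemma smooth_on_cong: "open S \<Longrightarrow> (\<And>x. x \<in> S \<Longrightarrow> f x = g x) \<Longrightarrow> smooth_on S f \<Longrightarrow> smooth_on S g"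
  unfolding smooth_on_def using Ck_on_cong by blast

lemma smooth_on_local:
  assumes "\<And>x. x \<in> S \<Longrightarrow> \<exists>U. open U \<and> x \<in> U \<and> smooth_on U f"
  shows "smooth_on S f"
  unfolding smooth_on_def using assms Ck_on_local unfolding smooth_on_def by metis

lemma smooth_on_const: "smooth_on S (\<lambda>x. c)"
  by (simp add: smooth_on_def Ck_on_const)

lemma smooth_on_bounded_linear:
  "bounded_linear h \<Longrightarrow> open S \<Longrightarrow> smooth_on S f \<Longrightarrow> smooth_on S (\<lambda>x. h (f x))"
  by (simp add: smooth_on_def Ck_on_bounded_linear)

lemma smooth_on_id: "smooth_on S (\<lambda>x. x)"
  unfolding smooth_on_def
proof
  fix k show "Ck_on k S (\<lambda>x. x)"
    by (cases k) (auto simp: Ck_on_const)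
qed

lemma smooth_on_add: "open S \<Longrightarrow> smooth_on S f \<Longrightarrow> smooth_on S g \<Longrightarrow> smooth_on S (\<lambda>x. f x + g x)"
  by (simp add: smooth_on_def Ck_on_add)

lemma smooth_on_bilinear:
  "bounded_bilinear h \<Longrightarrow> open S \<Longrightarrow> smooth_on S f \<Longrightarrow> smooth_on S g \<Longrightarrow> smooth_on S (\<lambda>x. h (f x) (g x))"
  by (simp add: smooth_on_def Ck_on_bilinear)

lemmas smooth_on_scaleR = smooth_on_bilinear[OF bounded_bilinear_scaleR]

lemma smooth_on_diff: "open S \<Longrightarrow> smooth_on S f \<Longrightarrow> smooth_on S g \<Longrightarrow> smooth_on S (\<lambda>x. f x - g x)"
  using smooth_on_add[of S f "\<lambda>x. - g x"] smooth_on_bounded_linear[OF bounded_linear_minus[OF bounded_linear_ident], of S g]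
  by simp

lemma smooth_on_sum:
  "open S \<Longrightarrow> (\<And>i. i \<in> I \<Longrightarrow> smooth_on S (f i)) \<Longrightarrow> smooth_on S (\<lambda>x. \<Sum>i\<in>I. f i x)"
  by (simp add: smooth_on_def Ck_on_sum)

lemma smooth_on_compose:
  "open S \<Longrightarrow> open T \<Longrightarrow> g ` S \<subseteq> T \<Longrightarrow> smooth_on T f \<Longrightarrow> smooth_on S g \<Longrightarrow> smooth_on S (\<lambda>x. f (g x))"
  by (simp add: smooth_on_def Ck_on_compose)

lemma smooth_on_fd: "smooth_on S f \<Longrightarrow> smooth_on S (\<lambda>x. fd f x v)"
  unfolding smooth_on_def by (metis Ck_on.simps(2))

lemma smooth_on_fd_field:
  assumes "open S" "smooth_on S f" "smooth_on S u"
  shows "smooth_on S (\<lambda>x. fd f x (u x))"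
proof (rule smooth_on_cong[OF assms(1)])
  show "smooth_on S (\<lambda>x. \<Sum>b\<in>Basis. (u x \<bullet> b) *\<^sub>R fd f x b)"
    by (intro smooth_on_sum smooth_on_scaleR smooth_on_bounded_linear[OF bounded_linear_inner_left]
        smooth_on_fd assms)
qed (use fd_expand smooth_onD[OF assms(2)] in metis)

text \<open>The second difference quotient of \<open>f\<close> along \<open>v\<close> and \<open>w\<close> is symmetric in \<open>v\<close> and \<open>w\<close>, and by the
  mean value theorem, used once in each variable, it is a value of either iterated derivative.\<close>

lemma second_difference_mvt:
  fixes f :: "'e::euclidean_space \<Rightarrow> real"
  assumes "0 < h"
    and seg: "\<And>s t. 0 \<le> s \<Longrightarrow> s \<le> h \<Longrightarrow> 0 \<le> t \<Longrightarrow> t \<le> h \<Longrightarrow> x + s *\<^sub>R v + t *\<^sub>R w \<in> S"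
    and C2: "Ck_on 2 S f"
  obtains s t where "0 < s" "s < h" "0 < t" "t < h"
    "f (x + h *\<^sub>R v + h *\<^sub>R w) - f (x + h *\<^sub>R v) - f (x + h *\<^sub>R w) + f x
      = h * h * fd (\<lambda>y. fd f y v) (x + s *\<^sub>R v + t *\<^sub>R w) w"
proof -
  have d1: "\<And>y. y \<in> S \<Longrightarrow> f differentiable (at y)"
    and d2: "\<And>y. y \<in> S \<Longrightarrow> (\<lambda>y. fd f y v) differentiable (at y)"
    using C2 by (auto simp: numeral_2_eq_2)
  have der: "((\<lambda>s. g (y + s *\<^sub>R u)) has_derivative (\<lambda>r. r * fd g (y + s *\<^sub>R u) u)) (at s)"
    if "g differentiable (at (y + s *\<^sub>R u))" for g :: "'e \<Rightarrow> real" and y u s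
  proof -
    have "((\<lambda>s. y + s *\<^sub>R u) has_derivative (\<lambda>r. r *\<^sub>R u)) (at s)"
      by (auto intro!: derivative_eq_intros)
    from diff_chain_at[OF this has_derivative_fd[OF that]] linear_frechet_derivative[OF that]
    show ?thesis by (simp add: o_def linear_cmul)
  qed
  let ?a = "\<lambda>s. f ((x + h *\<^sub>R w) + s *\<^sub>R v) - f (x + s *\<^sub>R v)"
  obtain s where s0: "0 < s" "s < h"
    "?a h - ?a 0 = (\<lambda>r. r * fd f ((x + h *\<^sub>R w) + s *\<^sub>R v) v - r * fd f (x + s *\<^sub>R v) v) (h - 0)"
  proof (rule mvt[OF \<open>0 < h\<close>])
    have in1: "x + h *\<^sub>R w + s *\<^sub>R v \<in> S" "x + s *\<^sub>R v \<in> S" if "0 \<le> s" "s \<le> h" for s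
      using seg[of s h] seg[of s 0] that assms(1) by (auto simp: algebra_simps)
    have D: "(?a has_derivative (\<lambda>r. r * fd f ((x + h *\<^sub>R w) + s *\<^sub>R v) v - r * fd f (x + s *\<^sub>R v) v)) (at s)"
      if "0 \<le> s" "s \<le> h" for s
      using in1[OF that] by (intro has_derivative_diff der d1)
    show "continuous_on {0..h} ?a"
      using D has_derivative_continuous by (force intro!: continuous_at_imp_continuous_on)
    show "(?a has_derivative (\<lambda>r. r * fd f ((x + h *\<^sub>R w) + s *\<^sub>R v) v - r * fd f (x + s *\<^sub>R v) v)) (at s)"
      if "0 < s" "s < h" for s using D that by simp
  qed
  then have s: "0 < s" "s < h"
    "?a h - ?a 0 = h * (fd f ((x + h *\<^sub>R w) + s *\<^sub>R v) v - fd f (x + s *\<^sub>R v) v)"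
    by (simp_all add: algebra_simps)
  let ?b = "\<lambda>t. fd f ((x + s *\<^sub>R v) + t *\<^sub>R w) v"
  obtain t where t0: "0 < t" "t < h"
    "?b h - ?b 0 = (\<lambda>r. r * fd (\<lambda>y. fd f y v) ((x + s *\<^sub>R v) + t *\<^sub>R w) w) (h - 0)"
  proof (rule mvt[OF \<open>0 < h\<close>])
    have D: "(?b has_derivative (\<lambda>r. r * fd (\<lambda>y. fd f y v) ((x + s *\<^sub>R v) + t *\<^sub>R w) w)) (at t)"
      if "0 \<le> t" "t \<le> h" for t
      using seg[of s t] that s by (intro der d2) auto
    show "continuous_on {0..h} ?b"
      using D has_derivative_continuous by (force intro!: continuous_at_imp_continuous_on)
    show "(?b has_derivative (\<lambda>r. r * fd (\<lambda>y. fd f y v) ((x + s *\<^sub>R v) + t *\<^sub>R w) w)) (at t)"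
      if "0 < t" "t < h" for t using D that by simp
  qed
  then have t: "0 < t" "t < h"
    "?b h - ?b 0 = h * fd (\<lambda>y. fd f y v) ((x + s *\<^sub>R v) + t *\<^sub>R w) w" by simp_all
  have "f (x + h *\<^sub>R v + h *\<^sub>R w) - f (x + h *\<^sub>R v) - f (x + h *\<^sub>R w) + f x = ?a h - ?a 0"
    by (simp add: algebra_simps)
  also have "\<dots> = h * (?b h - ?b 0)" unfolding s(3) by (simp add: algebra_simps)
  finally show ?thesis using that[OF s(1,2) t(1,2)] t(3) by (simp add: algebra_simps)
qed

lemma fd_fd_symmetric_real:
  fixes f :: "'e::euclidean_space \<Rightarrow> real"
  assumes "open S" "x \<in> S" "Ck_on 2 S f"
  shows "fd (\<lambda>y. fd f y v) x w = fd (\<lambda>y. fd f y w) x v"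
proof -
  let ?p = "\<lambda>y. fd (\<lambda>y. fd f y v) y w" and ?q = "\<lambda>y. fd (\<lambda>y. fd f y w) y v"
  have cont: "continuous_on S ?p" "continuous_on S ?q"
    using assms(3) by (auto simp: numeral_2_eq_2)
  have "\<bar>?p x - ?q x\<bar> < 2 * e" if "e > 0" for e
  proof -
    obtain d1 where d1: "d1 > 0" "\<And>y. y \<in> S \<Longrightarrow> dist y x < d1 \<Longrightarrow> dist (?p y) (?p x) < e"
      using cont(1) assms(2) \<open>e > 0\<close> unfolding continuous_on_iff by blast
    obtain d2 where d2: "d2 > 0" "\<And>y. y \<in> S \<Longrightarrow> dist y x < d2 \<Longrightarrow> dist (?q y) (?q x) < e"
      using cont(2) assms(2) \<open>e > 0\<close> unfolding continuous_on_iff by blast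
    obtain d3 where d3: "d3 > 0" "ball x d3 \<subseteq> S" using assms open_contains_ball by blast
    define d where "d = min d1 (min d2 d3)"
    have d: "d > 0" "d \<le> d1" "d \<le> d2" "d \<le> d3" using d1 d2 d3 by (auto simp: d_def)
    \<comment> \<open>Small enough for the parallelogram with sides \<open>h v\<close>, \<open>h w\<close> at \<open>x\<close> to lie in the ball of radius \<open>d\<close>.\<close>
    define h where "h = d / (2 * (norm v + norm w + 1))"
    have np: "norm v + norm w + 1 > 0" by (simp add: add_nonneg_pos)
    have h: "h > 0" using d(1) np by (simp add: h_def)
    have near: "dist (x + s *\<^sub>R v + t *\<^sub>R w) x < d" if "0 \<le> s" "s \<le> h" "0 \<le> t" "t \<le> h" for s t
    proof -
      have "dist (x + s *\<^sub>R v + t *\<^sub>R w) x = norm (s *\<^sub>R v + t *\<^sub>R w)" by (simp add: dist_norm)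
      also have "\<dots> \<le> s * norm v + t * norm w"
        using norm_triangle_ineq[of "s *\<^sub>R v" "t *\<^sub>R w"] that by simp
      also have "\<dots> \<le> h * norm v + h * norm w"
        using that by (intro add_mono mult_right_mono) auto
      also have "\<dots> < h * (2 * (norm v + norm w + 1))"
        using h by (simp add: algebra_simps add_nonneg_pos)
      also have "\<dots> = d" using np by (simp add: h_def)
      finally show ?thesis .
    qed
    then have seg: "x + s *\<^sub>R v + t *\<^sub>R w \<in> S" if "0 \<le> s" "s \<le> h" "0 \<le> t" "t \<le> h" for s t
      using that d3(2) d(4) by (force simp: dist_commute)
    obtain s t where st: "0 < s" "s < h" "0 < t" "t < h"
      "f (x + h *\<^sub>R v + h *\<^sub>R w) - f (x + h *\<^sub>R v) - f (x + h *\<^sub>R w) + f x = h * h * ?p (x + s *\<^sub>R v + t *\<^sub>R w)"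
      using second_difference_mvt[OF h, of x v w S f] seg assms(3) by blast
    have seg': "x + s *\<^sub>R w + t *\<^sub>R v \<in> S" if "0 \<le> s" "s \<le> h" "0 \<le> t" "t \<le> h" for s t
      using seg[of t s] that by (simp add: algebra_simps)
    obtain s' t' where st': "0 < s'" "s' < h" "0 < t'" "t' < h"
      "f (x + h *\<^sub>R w + h *\<^sub>R v) - f (x + h *\<^sub>R w) - f (x + h *\<^sub>R v) + f x = h * h * ?q (x + s' *\<^sub>R w + t' *\<^sub>R v)"
      using second_difference_mvt[OF h, of x w v S f] seg' assms(3) by blast
    have "h * h * ?p (x + s *\<^sub>R v + t *\<^sub>R w) = h * h * ?q (x + s' *\<^sub>R w + t' *\<^sub>R v)"
      using st(5) st'(5) by (simp add: algebra_simps)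
    then have eq: "?p (x + s *\<^sub>R v + t *\<^sub>R w) = ?q (x + t' *\<^sub>R v + s' *\<^sub>R w)"
      using h by (simp add: algebra_simps)
    have "dist (?p (x + s *\<^sub>R v + t *\<^sub>R w)) (?p x) < e"
      using near[of s t] seg[of s t] st d by (intro d1(2)) auto
    moreover have "dist (?q (x + t' *\<^sub>R v + s' *\<^sub>R w)) (?q x) < e"
      using near[of t' s'] seg[of t' s'] st' d by (intro d2(2)) auto
    ultimately show ?thesis using eq by (simp add: dist_real_def)
  qed
  from this[of "\<bar>?p x - ?q x\<bar> / 4"] show ?thesis by argo
qed

lemma fd_fd_symmetric:
  fixes f :: "'e::euclidean_space \<Rightarrow> 'b::euclidean_space"
  assumes "open S" "x \<in> S" "smooth_on S f"
  shows "fd (\<lambda>y. fd f y v) x w = fd (\<lambda>y. fd f y w) x v"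
proof (rule euclidean_eqI)
  fix b :: 'b
  have bl: "bounded_linear (\<lambda>y. y \<bullet> b)" by (rule bounded_linear_inner_left)
  have *: "fd (\<lambda>y. fd f y v) x w \<bullet> b = fd (\<lambda>y. fd (\<lambda>y. f y \<bullet> b) y v) x w" for v w
  proof -
    have "fd (\<lambda>y. fd f y v) x w \<bullet> b = fd (\<lambda>y. fd f y v \<bullet> b) x w"
      using fd_bounded_linear[OF bl smooth_onD[OF smooth_on_fd[OF assms(3)] assms(2)]] by simp
    also have "\<dots> = fd (\<lambda>y. fd (\<lambda>y. f y \<bullet> b) y v) x w"
      by (rule fun_cong[OF fd_cong_open[OF assms(1,2)]])
        (use fd_bounded_linear[OF bl smooth_onD[OF assms(3)]] in simp)
    finally show ?thesis .
  qed
  have "Ck_on 2 S (\<lambda>y. f y \<bullet> b)"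
    using smooth_on_bounded_linear[OF bl assms(1,3)] by (simp add: smooth_on_def)
  then show "fd (\<lambda>y. fd f y v) x w \<bullet> b = fd (\<lambda>y. fd f y w) x v \<bullet> b"
    using fd_fd_symmetric_real[OF assms(1,2)] * by simp
qed

section \<open>Smooth local inverses\<close>

text \<open>At \<open>x0\<close> the lower bound comes from compactness of the unit sphere of \<open>V\<close>; nearby, the change of
  \<open>A x\<close> is controlled by its values on the finitely many basis vectors. The bound makes solutions of
  linear equations continuous, and keeps a local frame independent near a point.\<close>

lemma linear_inj_bounded_below_near:
  fixes A :: "'e::topological_space \<Rightarrow> 'l::euclidean_space \<Rightarrow> 'b::euclidean_space"
  assumes lin: "\<And>x. x \<in> S \<Longrightarrow> linear (A x)" and S: "open S" "x0 \<in> S"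
    and cont: "\<And>b. continuous_on S (\<lambda>x. A x b)"
    and V: "subspace V" "\<And>w. w \<in> V \<Longrightarrow> A x0 w = 0 \<Longrightarrow> w = 0"
  shows "\<exists>c U. c > 0 \<and> open U \<and> x0 \<in> U \<and> U \<subseteq> S \<and> (\<forall>x\<in>U. \<forall>w\<in>V. c * norm w \<le> norm (A x w))"
proof -
  have "\<exists>e>0. \<forall>w\<in>V. e * norm w \<le> norm (A x0 w)"
  proof (rule injective_imp_isometric[OF closed_subspace[OF V(1)] V(1)])
    show "bounded_linear (A x0)" using lin[OF S(2)] linear_conv_bounded_linear by blast
  qed (use V in auto)
  then obtain e where e: "e > 0" "\<And>w. w \<in> V \<Longrightarrow> e * norm w \<le> norm (A x0 w)" by blast
  let ?d = "\<lambda>x. \<Sum>b\<in>Basis. norm (A x b - A x0 b)"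
  have "continuous_on S ?d" by (intro continuous_intros cont)
  then have "open (S \<inter> ?d -` {..<e / 2})" using S(1) by (rule continuous_open_preimage) simp
  moreover have "S \<inter> ?d -` {..<e / 2} = {x \<in> S. ?d x < e / 2}" by auto
  ultimately have "open {x \<in> S. ?d x < e / 2}" by simp
  define U where "U = {x \<in> S. ?d x < e / 2}"
  have bd: "e / 2 * norm w \<le> norm (A x w)" if "x \<in> U" "w \<in> V" for x w
  proof -
    have x: "x \<in> S" "?d x < e / 2" using that by (auto simp: U_def)
    have ex: "A x w - A x0 w = (\<Sum>b\<in>Basis. (w \<bullet> b) *\<^sub>R (A x b - A x0 b))"
    proof -
      interpret a: linear "A x" using lin[OF x(1)] .
      interpret b: linear "A x0" using lin[OF S(2)] .
      have "A x w = (\<Sum>b\<in>Basis. (w \<bullet> b) *\<^sub>R A x b)" "A x0 w = (\<Sum>b\<in>Basis. (w \<bullet> b) *\<^sub>R A x0 b)"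
        by (subst euclidean_representation[of w, symmetric], simp only: a.sum a.scale b.sum b.scale)+
      then show ?thesis by (simp add: sum_subtractf scaleR_diff_right)
    qed
    have "norm (A x w - A x0 w) \<le> (\<Sum>b\<in>Basis. norm w * norm (A x b - A x0 b))"
      unfolding ex by (intro sum_norm_le) (auto intro!: mult_right_mono simp: Basis_le_norm)
    also have "\<dots> = norm w * ?d x" by (simp add: sum_distrib_left)
    also have "\<dots> \<le> norm w * (e / 2)" using x(2) by (intro mult_left_mono) auto
    finally have "norm (A x w - A x0 w) \<le> norm w * (e / 2)" .
    moreover have "norm (A x0 w) \<le> norm (A x w) + norm (A x w - A x0 w)"
      using norm_triangle_ineq4[of "A x w" "A x w - A x0 w"] by simp
    ultimately show ?thesis using e(2)[OF that(2)] by (simp add: field_simps)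
  qed
  show ?thesis
    by (rule exI[of _ "e / 2"], rule exI[of _ U]) (use e S bd \<open>open {x \<in> S. ?d x < e / 2}\<close> in \<open>auto simp: U_def\<close>)
qed

text \<open>For the candidate derivative \<open>L\<close> at \<open>x0\<close>, the vector \<open>A x (u x - u x0 - L (x - x0))\<close> can be
  written without \<open>u x\<close>, since \<open>A x (u x) = v x\<close>; in that form it is visibly of order \<open>o (x - x0)\<close>, and
  the lower bound for \<open>A x\<close> passes this on to its argument.\<close>

lemma linear_solution_has_derivative:
  fixes A :: "'e::euclidean_space \<Rightarrow> 'l::euclidean_space \<Rightarrow> 'l"
  assumes lin: "\<And>x. x \<in> S \<Longrightarrow> linear (A x)" and inj: "\<And>x. x \<in> S \<Longrightarrow> inj (A x)"
    and S: "open S" "x0 \<in> S" and sol: "\<And>x. x \<in> S \<Longrightarrow> A x (u x) = v x"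
    and dA: "\<And>b. (\<lambda>x. A x b) differentiable (at x0)" and cA: "\<And>b. continuous_on S (\<lambda>x. A x b)"
    and dv: "v differentiable (at x0)"
  shows "(u has_derivative (\<lambda>w. inv (A x0) (fd v x0 w - fd (\<lambda>x. A x (u x0)) x0 w))) (at x0)"
proof -
  have inj0: "w = 0" if "A x0 w = 0" for w
    using injD[OF inj[OF S(2)], of w 0] linear_0[OF lin[OF S(2)]] that by simp
  have "\<exists>c U. c > 0 \<and> open U \<and> x0 \<in> U \<and> U \<subseteq> S \<and> (\<forall>x\<in>U. \<forall>w\<in>UNIV. c * norm w \<le> norm (A x w))"
    by (rule linear_inj_bounded_below_near) (use lin S cA inj0 in auto)
  then obtain c U where c: "c > 0" "open U" "x0 \<in> U" "U \<subseteq> S" "\<And>x w. x \<in> U \<Longrightarrow> w \<in> UNIV \<Longrightarrow> c * norm w \<le> norm (A x w)"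
    by blast
  have "bij (A x0)" using lin inj S(2) by (simp add: bij_def linear_injective_imp_surjective)
  then have Ainv: "A x0 (inv (A x0) y) = y" for y by (simp add: bij_is_surj surj_f_inv_f)
  interpret A0: linear "A x0" using lin S(2) by blast
  have linv: "linear (inv (A x0))"
    using inj_linear_imp_inv_linear[OF A0.linear_axioms inj[OF S(2)]] .
  define DA where "DA = fd (\<lambda>x. A x (u x0)) x0"
  define L where "L w = inv (A x0) (fd v x0 w - DA w)" for w
  have hDA: "((\<lambda>x. A x (u x0)) has_derivative DA) (at x0)" unfolding DA_def by (rule has_derivative_fd[OF dA])
  have hv: "(v has_derivative fd v x0) (at x0)" by (rule has_derivative_fd[OF dv])
  have linL: "linear L"
  proof -
    have "linear (\<lambda>w. fd v x0 w - DA w)"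
      by (intro linear_compose_sub) (use hDA hv in \<open>auto simp: has_derivative_def bounded_linear.linear\<close>)
    from linear_compose[OF this linv] show ?thesis by (simp add: L_def[abs_def] o_def)
  qed
  then have blL: "bounded_linear L" using linear_conv_bounded_linear by blast
  \<comment> \<open>The difference \<open>A x (L h) - A x0 (L h)\<close> for \<open>h = x - x0\<close> is a product of two factors that vanish at \<open>x0\<close>.\<close>
  have hmix: "((\<lambda>x. \<Sum>b\<in>Basis. (L (x - x0) \<bullet> b) *\<^sub>R (A x b - A x0 b)) has_derivative (\<lambda>w. 0)) (at x0)"
  proof -
    have "((\<lambda>x. (L (x - x0) \<bullet> b) *\<^sub>R (A x b - A x0 b)) has_derivative
        (\<lambda>w. (L (x0 - x0) \<bullet> b) *\<^sub>R (fd (\<lambda>x. A x b) x0 w - 0) + (L (w - 0) \<bullet> b) *\<^sub>R (A x0 b - A x0 b))) (at x0)" for b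
      by (intro has_derivative_scaleR has_derivative_inner_left has_derivative_diff has_derivative_const
          bounded_linear.has_derivative[OF blL] has_derivative_ident has_derivative_fd dA)
    then show ?thesis using linear_0[OF linL]
      by (intro has_derivative_eq_rhs[OF has_derivative_sum]) auto
  qed
  let ?R = "\<lambda>x. v x - A x (u x0) - A x0 (L (x - x0)) - (\<Sum>b\<in>Basis. (L (x - x0) \<bullet> b) *\<^sub>R (A x b - A x0 b))"
  have hR: "(?R has_derivative (\<lambda>w. fd v x0 w - DA w - A x0 (L (w - 0)) - 0)) (at x0)"
    by (intro has_derivative_diff hv hDA hmix bounded_linear.has_derivative[OF blL] has_derivative_ident has_derivative_const
        bounded_linear.has_derivative[OF linear_conv_bounded_linear[THEN iffD1, OF A0.linear_axioms]])
  have zero: "(\<lambda>w. fd v x0 w - DA w - A x0 (L (w - 0)) - 0) = (\<lambda>w. 0)"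
    by (auto simp: L_def Ainv)
  have R0: "?R x0 = 0" using sol[OF S(2)] linear_0[OF linL] A0.zero by simp
  have lim: "((\<lambda>y. norm (?R y) / norm (y - x0)) \<longlongrightarrow> 0) (at x0)"
    using hR unfolding zero has_derivative_iff_norm R0 by simp
  have RA: "?R x = A x (u x - u x0 - L (x - x0))" if "x \<in> S" for x
  proof -
    interpret a: linear "A x" using lin[OF that] .
    have e1: "A x w = (\<Sum>b\<in>Basis. (w \<bullet> b) *\<^sub>R A x b)" for w
      by (subst euclidean_representation[of w, symmetric], simp only: a.sum a.scale)
    have e2: "A x0 w = (\<Sum>b\<in>Basis. (w \<bullet> b) *\<^sub>R A x0 b)" for w
      by (subst euclidean_representation[of w, symmetric], simp only: A0.sum A0.scale)
    have "A x0 (L (x - x0)) + (\<Sum>b\<in>Basis. (L (x - x0) \<bullet> b) *\<^sub>R (A x b - A x0 b)) = A x (L (x - x0))"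
      unfolding e1[of "L (x - x0)"] e2[of "L (x - x0)"] by (simp add: sum.distrib[symmetric] algebra_simps)
    then have "?R x = A x (u x) - A x (u x0) - A x (L (x - x0))" using sol[OF that] by (simp add: algebra_simps)
    then show ?thesis by (simp add: a.diff)
  qed
  have bnd: "norm (u x - u x0 - L (x - x0)) / norm (x - x0) \<le> (norm (?R x) / norm (x - x0)) / c" if "x \<in> U" for x
  proof -
    have "c * norm (u x - u x0 - L (x - x0)) \<le> norm (?R x)"
      using c(5)[OF that UNIV_I, of "u x - u x0 - L (x - x0)"] RA[of x] that c(4) by auto
    then have "norm (u x - u x0 - L (x - x0)) \<le> norm (?R x) / c"
      using c(1) by (simp add: pos_le_divide_eq mult.commute)
    then have "norm (u x - u x0 - L (x - x0)) / norm (x - x0) \<le> norm (?R x) / c / norm (x - x0)"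
      by (rule divide_right_mono) simp
    then show ?thesis by (simp add: divide_divide_eq_left mult.commute)
  qed
  have "((\<lambda>y. norm (u y - u x0 - L (y - x0)) / norm (y - x0)) \<longlongrightarrow> 0) (at x0)"
  proof (rule tendsto_sandwich[OF _ _ tendsto_const])
    show "\<forall>\<^sub>F x in at x0. norm (u x - u x0 - L (x - x0)) / norm (x - x0) \<le> (norm (?R x) / norm (x - x0)) / c"
      using eventually_at_topological c(2,3) bnd by blast
    show "((\<lambda>x. (norm (?R x) / norm (x - x0)) / c) \<longlongrightarrow> 0) (at x0)"
      using tendsto_divide[OF lim tendsto_const[of c]] c(1) by simp
  qed simp
  then have "(u has_derivative L) (at x0)"
    unfolding has_derivative_iff_norm using blL by simp
  then show ?thesis by (simp add: L_def[abs_def] DA_def)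
qed

lemma linear_solution_continuous:
  fixes A :: "'e::euclidean_space \<Rightarrow> 'l::euclidean_space \<Rightarrow> 'l"
  assumes lin: "\<And>x. x \<in> S \<Longrightarrow> linear (A x)" and inj: "\<And>x. x \<in> S \<Longrightarrow> inj (A x)"
    and S: "open S" "x0 \<in> S" and sol: "\<And>x. x \<in> S \<Longrightarrow> A x (u x) = v x"
    and cA: "\<And>b. continuous_on S (\<lambda>x. A x b)" and cv: "continuous_on S v"
  shows "isCont u x0"
proof -
  have inj0: "w = 0" if "A x0 w = 0" for w
    using injD[OF inj[OF S(2)], of w 0] linear_0[OF lin[OF S(2)]] that by simp
  have "\<exists>c U. c > 0 \<and> open U \<and> x0 \<in> U \<and> U \<subseteq> S \<and> (\<forall>x\<in>U. \<forall>w\<in>UNIV. c * norm w \<le> norm (A x w))"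
    by (rule linear_inj_bounded_below_near) (use lin S cA inj0 in auto)
  then obtain c U where c: "c > 0" "open U" "x0 \<in> U" "U \<subseteq> S" "\<And>x w. x \<in> U \<Longrightarrow> w \<in> UNIV \<Longrightarrow> c * norm w \<le> norm (A x w)"
    by blast
  have bnd: "norm (u x - u x0) \<le> norm (v x - A x (u x0)) / c" if "x \<in> U" for x
  proof -
    have "x \<in> S" using that c(4) by blast
    then have "A x (u x - u x0) = v x - A x (u x0)" using linear_diff[OF lin] sol by simp
    then have "c * norm (u x - u x0) \<le> norm (v x - A x (u x0))"
      using c(5)[OF that UNIV_I, of "u x - u x0"] by simp
    then show ?thesis using c(1) by (simp add: pos_le_divide_eq mult.commute)
  qed
  have "isCont v x0" "isCont (\<lambda>x. A x (u x0)) x0"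
    using cv cA S by (auto simp: continuous_on_eq_continuous_at)
  then have "isCont (\<lambda>x. norm (v x - A x (u x0)) / c) x0" using c(1) by (intro continuous_intros) auto
  then have "((\<lambda>x. norm (v x - A x (u x0)) / c) \<longlongrightarrow> norm (v x0 - A x0 (u x0)) / c) (at x0)"
    by (simp add: isCont_def)
  then have lim: "((\<lambda>x. norm (v x - A x (u x0)) / c) \<longlongrightarrow> 0) (at x0)" using sol[OF S(2)] by simp
  have "((\<lambda>x. norm (u x - u x0)) \<longlongrightarrow> 0) (at x0)"
  proof (rule tendsto_sandwich[OF _ _ tendsto_const lim])
    show "\<forall>\<^sub>F x in at x0. norm (u x - u x0) \<le> norm (v x - A x (u x0)) / c"
      using eventually_at_topological c(2,3) bnd by blast
  qed simp
  then show ?thesis unfolding isCont_def by (simp add: LIM_zero_iff tendsto_norm_zero_iff)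
qed

text \<open>The derivative of a solution solves an equation with the same coefficients,
  \<open>A (Du w) = Dv w - (DA w) u\<close>, whose right-hand side is as regular as \<open>u\<close> is already known to be.\<close>

lemma Ck_on_linear_solution:
  fixes A :: "'e::euclidean_space \<Rightarrow> 'l::euclidean_space \<Rightarrow> 'l"
  assumes lin: "\<And>x. x \<in> S \<Longrightarrow> linear (A x)" and inj: "\<And>x. x \<in> S \<Longrightarrow> inj (A x)" and S: "open S"
    and A: "\<And>b. smooth_on S (\<lambda>x. A x b)"
    and "\<And>x. x \<in> S \<Longrightarrow> A x (u x) = v x" "Ck_on k S v"
  shows "Ck_on k S u"
  using assms(5,6)
proof (induction k arbitrary: u v)
  case 0
  have "isCont u x" if "x \<in> S" for x
  proof (rule linear_solution_continuous)
    show "continuous_on S (\<lambda>x. A x b)" for b by (rule smooth_on_continuous[OF A])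
    show "continuous_on S v" using 0(2) by simp
  qed (fact lin inj S that 0(1))+
  then show ?case by (simp add: continuous_at_imp_continuous_on)
next
  case (Suc k)
  have dv: "v differentiable (at x)" if "x \<in> S" for x using Suc.prems(2) that by simp
  have D: "(u has_derivative (\<lambda>w. inv (A x) (fd v x w - fd (\<lambda>y. A y (u x)) x w))) (at x)" if "x \<in> S" for x
  proof (rule linear_solution_has_derivative)
    show "continuous_on S (\<lambda>x. A x b)" for b by (rule smooth_on_continuous[OF A])
    show "(\<lambda>x. A x b) differentiable (at x)" for b by (rule smooth_onD[OF A that])
    show "v differentiable (at x)" by (rule dv[OF that])
  qed (fact lin inj S that Suc.prems(1))+
  have uk: "Ck_on k S u" using Suc.IH[OF Suc.prems(1)] Ck_on_Suc_imp[OF Suc.prems(2)] by blast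
  have "Ck_on k S (\<lambda>x. fd u x w)" for w
  proof (rule Suc.IH)
    show "Ck_on k S (\<lambda>x. fd v x w - (\<Sum>b\<in>Basis. (u x \<bullet> b) *\<^sub>R fd (\<lambda>y. A y b) x w))"
    proof -
      have "Ck_on k S (\<lambda>x. fd v x w + - (\<Sum>b\<in>Basis. (u x \<bullet> b) *\<^sub>R fd (\<lambda>y. A y b) x w))"
        using Suc.prems(2) uk smooth_on_fd[OF A] unfolding smooth_on_def
        by (intro Ck_on_add[OF S] Ck_on_bounded_linear[OF bounded_linear_minus[OF bounded_linear_ident] S]
           Ck_on_sum[OF S] Ck_on_bilinear[OF bounded_bilinear_scaleR S] Ck_on_bounded_linear[OF bounded_linear_inner_left S]) auto
      then show ?thesis by simp
    qed
  next
    fix x assume x: "x \<in> S"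
    have dAx: "(\<lambda>y. A y b) differentiable (at x)" for b using smooth_onD[OF A x] .
    have bij: "bij (A x)" using lin inj x by (simp add: bij_def linear_injective_imp_surjective)
    have "fd (\<lambda>y. A y (u x)) x w = fd (\<lambda>y. \<Sum>b\<in>Basis. (u x \<bullet> b) *\<^sub>R A y b) x w"
    proof (rule fun_cong[OF fd_cong_open[OF S x]])
      fix y assume "y \<in> S"
      then interpret a: linear "A y" using lin by blast
      show "A y (u x) = (\<Sum>b\<in>Basis. (u x \<bullet> b) *\<^sub>R A y b)"
        by (subst euclidean_representation[of "u x", symmetric], simp only: a.sum a.scale)
    qed
    also have "\<dots> = (\<Sum>b\<in>Basis. (u x \<bullet> b) *\<^sub>R fd (\<lambda>y. A y b) x w)"
      by (rule fun_cong[OF fd_eqI]) (intro has_derivative_sum has_derivative_scaleR_right has_derivative_fd dAx)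
    finally show "A x (fd u x w) = fd v x w - (\<Sum>b\<in>Basis. (u x \<bullet> b) *\<^sub>R fd (\<lambda>y. A y b) x w)"
      unfolding fd_eqI[OF D[OF x]] by (simp add: bij bij_is_surj surj_f_inv_f)
  qed
  moreover have "u differentiable (at x)" if "x \<in> S" for x
    using D[OF that] unfolding differentiable_def by blast
  ultimately show ?case by simp
qed

text \<open>Composing an immersion \<open>j\<close> with a linear left inverse \<open>B\<close> of its derivative at \<open>x0\<close> gives a map
  between spaces of equal dimension, to which the inverse function theorem applies; the local
  inverse, precomposed with \<open>B\<close>, is a left inverse of \<open>j\<close> near \<open>x0\<close>.\<close>

lemma immersion_smooth_left_inverse:
  fixes j :: "'l::euclidean_space \<Rightarrow> 'e::euclidean_space"
  assumes U: "open U" "x0 \<in> U" and j: "smooth_on U j" and inj: "inj (fd j x0)"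
  obtains U' V r where "open U'" "x0 \<in> U'" "U' \<subseteq> U" "open V" "smooth_on V r"
    "j ` U' \<subseteq> V" "r ` V \<subseteq> U'" "\<And>x. x \<in> U' \<Longrightarrow> r (j x) = x"
proof -
  have dj: "j differentiable (at x)" if "x \<in> U" for x using smooth_onD[OF j that] .
  obtain B where B: "linear B" "B \<circ> fd j x0 = id"
    using linear_injective_left_inverse[OF linear_frechet_derivative[OF dj[OF U(2)]] inj] by blast
  have blB: "bounded_linear B" using B(1) linear_conv_bounded_linear by blast
  define f where "f x = B (j x)" for x
  have f: "smooth_on U f" unfolding f_def[abs_def] by (rule smooth_on_bounded_linear[OF blB U(1) j])
  have df: "f differentiable (at x)" if "x \<in> U" for x using smooth_onD[OF f that] .
  have ap: "blinfun_apply (Blinfun (fd f x)) = fd f x" if "x \<in> U" for x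
    using has_derivative_fd[OF df[OF that]] by (simp add: bounded_linear_Blinfun_apply has_derivative_def)
  have der: "(f has_derivative blinfun_apply (Blinfun (fd f x))) (at x)" if "x \<in> U" for x
    using ap[OF that] has_derivative_fd[OF df[OF that]] by simp
  have cont: "continuous_on U (\<lambda>x. Blinfun (fd f x))"
  proof (rule continuous_on_blinfun_componentwise)
    fix i :: 'l
    show "continuous_on U (\<lambda>x. blinfun_apply (Blinfun (fd f x)) i)"
      using smooth_on_continuous[OF smooth_on_fd[OF f]] ap by (simp cong: continuous_on_cong)
  qed
  have inv: "id_blinfun o\<^sub>L Blinfun (fd f x0) = id_blinfun"
  proof (rule blinfun_eqI)
    fix i
    have "fd f x0 i = B (fd j x0 i)" unfolding f_def[abs_def] by (rule fd_bounded_linear[OF blB dj[OF U(2)]])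
    then show "blinfun_apply (id_blinfun o\<^sub>L Blinfun (fd f x0)) i = blinfun_apply id_blinfun i"
      using B(2) ap[OF U(2)] by (simp add: o_def fun_eq_iff)
  qed
  obtain U' V g g' where g: "open U'" "U' \<subseteq> U" "x0 \<in> U'" "open V" "f x0 \<in> V" "homeomorphism U' V f g"
    "\<And>y. y \<in> V \<Longrightarrow> (g has_derivative g' y) (at y)"
    "\<And>y. y \<in> V \<Longrightarrow> g' y = inv (blinfun_apply (Blinfun (fd f (g y))))"
    "\<And>y. y \<in> V \<Longrightarrow> bij (blinfun_apply (Blinfun (fd f (g y))))"
    by (rule inverse_function_theorem[OF U(1) der cont U(2) inv]) blast+
  have gV: "g ` V = U'" "f ` U' = V" "\<And>x. x \<in> U' \<Longrightarrow> g (f x) = x"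
    using g(6) by (auto simp: homeomorphism_def)
  have gU: "g y \<in> U" if "y \<in> V" for y using gV(1) g(2) that by blast
  have dg: "fd g y w = inv (fd f (g y)) w" "bij (fd f (g y))" if "y \<in> V" for y w
    using fd_eqI[OF g(7)] g(8,9) ap[OF gU] that by auto
  have "Ck_on k V g" for k
  proof (induction k)
    case 0
    show ?case using g(7) by (auto intro!: continuous_at_imp_continuous_on dest: has_derivative_continuous)
  next
    case (Suc k)
    have "Ck_on k V (\<lambda>y. fd g y w)" for w
    proof (rule Ck_on_cong[OF g(4)])
      have bij: "bij (fd f x)" if "x \<in> U'" for x using that gV(1) dg(2) by auto
      have "Ck_on k U' (\<lambda>x. inv (fd f x) w)"
      proof (rule Ck_on_linear_solution)
        show "linear (fd f x)" "inj (fd f x)" "fd f x (inv (fd f x) w) = w" if "x \<in> U'" for x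
          using linear_frechet_derivative[OF df] bij[OF that] g(2) that
          by (auto simp: bij_is_inj bij_is_surj surj_f_inv_f)
        show "smooth_on U' (\<lambda>x. fd f x b)" for b
          using smooth_on_subset[OF smooth_on_fd[OF f] g(2)] .
      qed (auto simp: g(1) Ck_on_const)
      then show "Ck_on k V (\<lambda>y. inv (fd f (g y)) w)"
        using Ck_on_compose[OF g(4,1) _ _ Suc.IH, of "\<lambda>x. inv (fd f x) w"] gV(1) by blast
    qed (simp add: dg)
    then show ?case using g(7) by (auto simp: differentiable_def)
  qed
  then have "smooth_on V g" by (simp add: smooth_on_def)
  have oB: "open (B -` V)" by (rule open_vimage[OF g(4) linear_continuous_on[OF blB]])
  show ?thesis
  proof (rule that[of U' "B -` V" "\<lambda>z. g (B z)"])
    show "smooth_on (B -` V) (\<lambda>z. g (B z))"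
      by (rule smooth_on_compose[OF oB g(4) _ \<open>smooth_on V g\<close>])
        (auto intro: smooth_on_bounded_linear[OF blB oB smooth_on_id])
    show "j ` U' \<subseteq> B -` V" using gV(2) by (auto simp: f_def)
    show "g (B (j x)) = x" if "x \<in> U'" for x using gV(3)[OF that] by (simp add: f_def)
  qed (use g oB gV in auto)
qed

section \<open>Charts and coordinate changes\<close>

locale smooth_mfd =
  fixes M :: "('a, 'e::euclidean_space) mfd"
  assumes mfd: "smooth_manifold M"
begin

lemma chart_image_open: "c \<in> charts M \<Longrightarrow> openin (mtop M) W \<Longrightarrow> open (snd c ` (fst c \<inter> W))"
  and chart_inj: "c \<in> charts M \<Longrightarrow> inj_on (snd c) (fst c)"
  and chart_dom: "c \<in> charts M \<Longrightarrow> openin (mtop M) (fst c)"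
  and chart_vimage_open: "c \<in> charts M \<Longrightarrow> open V \<Longrightarrow> openin (mtop M) {q \<in> fst c. snd c q \<in> V}"
proof -
  assume c: "c \<in> charts M"
  then have h: "openin (mtop M) (fst c)" "open (snd c ` fst c)"
    "homeomorphic_map (subtopology (mtop M) (fst c)) (top_of_set (snd c ` fst c)) (snd c)"
    using mfd unfolding smooth_manifold_def by blast+
  show "openin (mtop M) (fst c)" by (rule h)
  have sub: "fst c \<subseteq> points M" using h(1) openin_subset by blast
  show "inj_on (snd c) (fst c)" using homeomorphic_imp_injective_map[OF h(3)] sub by (simp add: Int_absorb1)
  show "open (snd c ` (fst c \<inter> W))" if W: "openin (mtop M) W"
  proof -
    have "openin (subtopology (mtop M) (fst c)) (fst c \<inter> W)"
      using W by (metis openin_subtopology_Int inf_commute)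
    then have "openin (top_of_set (snd c ` fst c)) (snd c ` (fst c \<inter> W))"
      using homeomorphic_imp_open_map[OF h(3)] by (simp add: open_map_def)
    then show ?thesis using h(2) openin_open_trans by blast
  qed
  show "openin (mtop M) {q \<in> fst c. snd c q \<in> V}" if "open V"
  proof -
    have cm: "continuous_map (subtopology (mtop M) (fst c)) euclidean (snd c)"
      using homeomorphic_imp_continuous_map[OF h(3)] continuous_map_into_fulltopology by blast
    have "openin (subtopology (mtop M) (fst c)) {q \<in> topspace (subtopology (mtop M) (fst c)). snd c q \<in> V}"
      by (rule openin_continuous_map_preimage[OF cm]) (use that in simp)
    then have "openin (subtopology (mtop M) (fst c)) {q \<in> fst c. snd c q \<in> V}"
      using sub by (simp add: Int_absorb1)
    then show ?thesis using h(1) openin_trans_full by blast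
  qed
qed

lemma chart_at: "p \<in> points M \<Longrightarrow> chart_at M p \<in> charts M \<and> p \<in> fst (chart_at M p)"
proof -
  assume "p \<in> points M"
  then obtain c where "c \<in> charts M" "p \<in> fst c" using mfd unfolding smooth_manifold_def by blast
  then show ?thesis unfolding chart_at_def by (metis (mono_tags, lifting) someI)
qed

lemma dom_points: "c \<in> charts M \<Longrightarrow> q \<in> fst c \<Longrightarrow> q \<in> points M"
  using chart_dom openin_subset by blast

lemma chart_inv [simp]: "c \<in> charts M \<Longrightarrow> q \<in> fst c \<Longrightarrow> chart_inv c (snd c q) = q"
  using chart_inj by simp

end

text \<open>The identity of a manifold and the inclusion of an immersed submanifold are treated together:
  the former yields the behaviour of coordinate expressions under a change of chart.\<close>

locale smooth_incl = L: smooth_mfd L + M: smooth_mfd M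
  for L :: "('a, 'l::euclidean_space) mfd" and M :: "('a, 'e::euclidean_space) mfd" +
  assumes sub: "points L \<subseteq> points M"
    and smooth: "smooth_map L M (\<lambda>x. x)"
begin

lemma open_restrict: "openin (mtop M) W \<Longrightarrow> openin (mtop L) (points L \<inter> W)"
  using smooth openin_continuous_map_preimage[of "mtop L" "mtop M" "\<lambda>x. x" W]
  by (simp add: smooth_map_def Int_def)

lemma open_inter:
  assumes "openin (mtop L) P" "openin (mtop M) W" shows "openin (mtop L) (P \<inter> W)"
proof -
  have "P \<inter> W = P \<inter> (points L \<inter> W)" using openin_subset[OF assms(1)] by blast
  then show ?thesis using openin_Int[OF assms(1) open_restrict[OF assms(2)]] by simp
qed

lemma overlap_open:
  assumes "d \<in> charts L" "c \<in> charts M"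
  shows "open (snd d ` (fst d \<inter> fst c))"
proof -
  have "fst d \<inter> fst c = fst d \<inter> (points L \<inter> fst c)" using L.dom_points[OF assms(1)] by blast
  then show ?thesis using L.chart_image_open[OF assms(1) open_restrict[OF M.chart_dom[OF assms(2)]]] by simp
qed

abbreviation tr :: "('a, 'l) chart \<Rightarrow> ('a, 'e) chart \<Rightarrow> 'l \<Rightarrow> 'e" where
  "tr d c \<equiv> snd c \<circ> chart_inv d"

lemma smooth_tr:
  assumes "d \<in> charts L" "c \<in> charts M"
  shows "smooth_on (snd d ` (fst d \<inter> fst c)) (tr d c)"
  using smooth assms by (auto simp: smooth_map_def o_def vimage_def)

lemma diff_tr:
  assumes "d \<in> charts L" "c \<in> charts M" "q \<in> fst d" "q \<in> fst c"
  shows "tr d c differentiable (at (snd d q))"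
  using smooth_onD[OF smooth_tr[OF assms(1,2)]] assms(3,4) by blast

end

lemma smooth_incl_self: "smooth_manifold M \<Longrightarrow> smooth_incl M M"
  unfolding smooth_incl_def smooth_incl_axioms_def smooth_mfd_def
  by (simp add: smooth_map_def o_def smooth_manifold_def vimage_def)

text \<open>The chain rule for three charts around a point of \<open>K \<subseteq> L \<subseteq> M\<close>. With two or three of the
  manifolds equal it gives every transformation rule for tangent vectors used below.\<close>

lemma fd_tr_comp:
  assumes KL: "smooth_incl K L" and LM: "smooth_incl L M" and KM: "smooth_incl K M"
    and c: "c \<in> charts K" "d \<in> charts L" "e \<in> charts M" and q: "q \<in> fst c" "q \<in> fst d" "q \<in> fst e"
  shows "fd (snd e \<circ> chart_inv d) (snd d q) (fd (snd d \<circ> chart_inv c) (snd c q) v)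
    = fd (snd e \<circ> chart_inv c) (snd c q) v"
proof -
  interpret KL: smooth_incl K L by fact
  interpret LM: smooth_incl L M by fact
  interpret KM: smooth_incl K M by fact
  let ?S = "snd c ` (fst c \<inter> (points K \<inter> fst d \<inter> (points K \<inter> fst e)))"
  have qK: "q \<in> points K" using KL.L.dom_points c q by blast
  have o: "open ?S"
    by (intro KL.L.chart_image_open c openin_Int KL.open_restrict KM.open_restrict KL.M.chart_dom LM.M.chart_dom)
  have "fd (snd e \<circ> chart_inv d) (snd d q) (fd (snd d \<circ> chart_inv c) (snd c q) v)
     = fd (\<lambda>z. (snd e \<circ> chart_inv d) ((snd d \<circ> chart_inv c) z)) (snd c q) v"
    using KL.diff_tr[OF c(1,2) q(1,2)] LM.diff_tr[OF c(2,3) q(2,3)] KL.L.chart_inv[OF c(1) q(1)]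
    by (subst fd_chain) auto
  also have "\<dots> = fd (snd e \<circ> chart_inv c) (snd c q) v"
    by (rule fun_cong[OF fd_cong_open[OF o]])
      (use q qK c KL.L.chart_inv KL.M.chart_inv in \<open>auto simp: KL.L.chart_inv[OF c(1)] KL.M.chart_inv[OF c(2)]\<close>)
  finally show ?thesis .
qed

context smooth_mfd
begin

sublocale self: smooth_incl M M by (rule smooth_incl_self[OF mfd])

lemma tcoord_linear:
  assumes "c \<in> charts M" "q \<in> fst c" shows "linear (tcoord M c q)"
  unfolding tcoord_def coord_at_def
  using self.diff_tr chart_at[OF dom_points[OF assms]] assms by (intro linear_frechet_derivative) auto

lemma tr_self:
  assumes "c \<in> charts M" "q \<in> fst c" shows "fd (snd c \<circ> chart_inv c) (snd c q) v = v"
proof -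
  have "open (snd c ` (fst c \<inter> fst c))" using self.overlap_open assms by blast
  then have "fd (snd c \<circ> chart_inv c) (snd c q) = fd (\<lambda>x. x) (snd c q)"
    using assms by (intro fd_cong_open[of "snd c ` fst c"]) auto
  then show ?thesis by simp
qed

lemma fd_tr_tcoord:
  assumes "c \<in> charts M" "q \<in> fst c" "d \<in> charts M" "q \<in> fst d"
  shows "fd (snd d \<circ> chart_inv c) (snd c q) (tcoord M c q v) = tcoord M d q v"
  unfolding tcoord_def coord_at_def
  using fd_tr_comp[OF smooth_incl_self smooth_incl_self smooth_incl_self, OF mfd mfd mfd] chart_at[OF dom_points[OF assms(1,2)]] assms by blast

lemma tcoord_at: "p \<in> points M \<Longrightarrow> tcoord M (chart_at M p) p v = v"
  unfolding tcoord_def coord_at_def using tr_self chart_at by blast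

lemma tcoord_inj:
  assumes "c \<in> charts M" "q \<in> fst c" "tcoord M c q v = tcoord M c q w" shows "v = w"
  using fd_tr_tcoord[OF assms(1,2), of "chart_at M q"] chart_at[OF dom_points[OF assms(1,2)]]
    tcoord_at[OF dom_points[OF assms(1,2)]] assms(3) by metis

text \<open>The vector field with coordinate expression \<open>y\<close> in the chart \<open>c\<close>; for constant \<open>y\<close> and the
  preferred chart this is \<^const>\<open>const_field\<close>.\<close>

definition chart_field :: "('a, 'e) chart \<Rightarrow> ('e \<Rightarrow> 'e) \<Rightarrow> 'a \<Rightarrow> 'e" where
  "chart_field c y q = fd (snd (chart_at M q) \<circ> chart_inv c) (snd c q) (y (snd c q))"

lemma const_field_eq: "const_field M p v = chart_field (chart_at M p) (\<lambda>_. v)"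
  by (auto simp: const_field_def chart_field_def)

lemma tcoord_chart_field:
  assumes "c \<in> charts M" "q \<in> fst c" "d \<in> charts M" "q \<in> fst d"
  shows "tcoord M d q (chart_field c y q) = fd (snd d \<circ> chart_inv c) (snd c q) (y (snd c q))"
  unfolding tcoord_def coord_at_def chart_field_def
  using fd_tr_comp[OF smooth_incl_self smooth_incl_self smooth_incl_self, OF mfd mfd mfd] chart_at[OF dom_points[OF assms(1,2)]] assms by blast

lemma vf_rep_at: "c \<in> charts M \<Longrightarrow> q \<in> fst c \<Longrightarrow> vf_rep M c X (snd c q) = tcoord M c q (X q)"
  by (simp add: vf_rep_def)

lemma vf_rep_chart_field:
  assumes "c \<in> charts M" "q \<in> fst c" shows "vf_rep M c (chart_field c y) (snd c q) = y (snd c q)"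
  using assms by (simp add: vf_rep_at tcoord_chart_field tr_self)

lemma const_field_at: "p \<in> points M \<Longrightarrow> const_field M p v p = v"
  unfolding const_field_def using tr_self chart_at by blast

lemma vfieldD:
  assumes "vfield M W X" "c \<in> charts M" shows "smooth_on (snd c ` (fst c \<inter> W)) (vf_rep M c X)"
  using assms by (simp add: vfield_def)

lemma vfield_subset: "vfield M W X \<Longrightarrow> W' \<subseteq> W \<Longrightarrow> vfield M W' X"
  unfolding vfield_def by (blast intro: smooth_on_subset)

lemma vfield_local:
  assumes "\<And>p. p \<in> W \<Longrightarrow> \<exists>W'. openin (mtop M) W' \<and> p \<in> W' \<and> vfield M W' X"
  shows "vfield M W X"
  unfolding vfield_def
proof (intro ballI smooth_on_local)
  fix c z assume c: "c \<in> charts M" and "z \<in> snd c ` (fst c \<inter> W)"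
  then obtain q where q: "q \<in> fst c" "q \<in> W" "z = snd c q" by auto
  then obtain W' where "openin (mtop M) W'" "q \<in> W'" "vfield M W' X" using assms by blast
  then show "\<exists>U. open U \<and> z \<in> U \<and> smooth_on U (vf_rep M c X)"
    using q chart_image_open[OF c] vfieldD[OF _ c] by blast
qed

lemma vf_rep_cong:
  assumes "c \<in> charts M" "\<And>q. q \<in> W \<Longrightarrow> X q = Y q" "z \<in> snd c ` (fst c \<inter> W)"
  shows "vf_rep M c X z = vf_rep M c Y z"
  using assms by (auto simp: vf_rep_at)

lemma vfield_cong:
  assumes "openin (mtop M) W" "\<And>q. q \<in> W \<Longrightarrow> X q = Y q" "vfield M W X" shows "vfield M W Y"
  unfolding vfield_def
proof
  fix c assume c: "c \<in> charts M"
  show "smooth_on (snd c ` (fst c \<inter> W)) (vf_rep M c Y)"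
    by (rule smooth_on_cong[OF chart_image_open[OF c assms(1)] vf_rep_cong[OF c assms(2)] vfieldD[OF assms(3) c]])
qed

text \<open>One chart suffices, since the representation in any other chart is the image of the given one
  under the derivative of the coordinate change.\<close>

lemma vfield_in_chart:
  assumes W: "openin (mtop M) W" and c: "c \<in> charts M" "W \<subseteq> fst c"
    and X: "smooth_on (snd c ` W) (vf_rep M c X)"
  shows "vfield M W X"
  unfolding vfield_def
proof
  fix d assume d: "d \<in> charts M"
  let ?S = "snd d ` (fst d \<inter> W)"
  have oS: "open ?S" using chart_image_open[OF d W] .
  have tdc: "smooth_on ?S (self.tr d c)"
    by (rule smooth_on_subset[OF self.smooth_tr[OF d c(1)]]) (intro image_mono Int_mono order_refl c(2))
  have tcd: "smooth_on (snd c ` (fst c \<inter> (fst d \<inter> W))) (self.tr c d)"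
    by (rule smooth_on_subset[OF self.smooth_tr[OF c(1) d]]) (intro image_mono, blast)
  have ocd: "open (snd c ` (fst c \<inter> (fst d \<inter> W)))"
    using chart_image_open[OF c(1)] openin_Int[OF chart_dom[OF d] W] by blast
  show "smooth_on ?S (vf_rep M d X)"
  proof (rule smooth_on_cong[OF oS])
    have s: "smooth_on (snd c ` (fst c \<inter> (fst d \<inter> W))) (\<lambda>z. fd (self.tr c d) z (vf_rep M c X z))"
      by (intro smooth_on_fd_field ocd tcd smooth_on_subset[OF X] image_mono) blast
    have "self.tr d c ` ?S \<subseteq> snd c ` (fst c \<inter> (fst d \<inter> W))"
    proof (intro image_subsetI)
      fix z assume "z \<in> ?S"
      then obtain q where "q \<in> fst d" "q \<in> W" "z = snd d q" by blast
      then show "self.tr d c z \<in> snd c ` (fst c \<inter> (fst d \<inter> W))" using c(2) d by auto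
    qed
    from smooth_on_compose[OF oS ocd this s tdc]
    show "smooth_on ?S (\<lambda>z. fd (self.tr c d) (self.tr d c z) (vf_rep M c X (self.tr d c z)))" .
  next
    fix z assume "z \<in> ?S"
    then obtain q where q: "q \<in> fst d" "q \<in> W" "z = snd d q" "q \<in> fst c" using c by auto
    then show "fd (self.tr c d) (self.tr d c z) (vf_rep M c X (self.tr d c z)) = vf_rep M d X z"
      using c(1) d fd_tr_tcoord[OF c(1) q(4) d q(1)] by (simp add: vf_rep_at)
  qed
qed

lemma vfield_chart_field:
  assumes c: "c \<in> charts M" and W: "openin (mtop M) W" "W \<subseteq> fst c" and y: "smooth_on (snd c ` W) y"
  shows "vfield M W (chart_field c y)"
proof (rule vfield_in_chart[OF W(1) c W(2)])
  have "open (snd c ` W)" using chart_image_open[OF c W(1)] W(2) by (simp add: Int_absorb1)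
  then show "smooth_on (snd c ` W) (vf_rep M c (chart_field c y))"
    by (rule smooth_on_cong[OF _ _ y]) (use vf_rep_chart_field[OF c] W(2) in auto)
qed

lemma vfield_const_field: "p \<in> points M \<Longrightarrow> vfield M (fst (chart_at M p)) (const_field M p v)"
  unfolding const_field_eq by (rule vfield_chart_field[OF _ _ _ smooth_on_const]) (simp_all add: chart_at chart_dom)

end

section \<open>Functions and derivations\<close>

context smooth_mfd
begin

lemma smooth_fun_subset: "smooth_fun M W f \<Longrightarrow> W' \<subseteq> W \<Longrightarrow> smooth_fun M W' f"
  unfolding smooth_fun_def by (blast intro: smooth_on_subset)

lemma smooth_fun_diff:
  assumes "smooth_fun M W f" "c \<in> charts M" "q \<in> fst c" "q \<in> W"
  shows "(f \<circ> chart_inv c) differentiable (at (snd c q))"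
proof (rule smooth_onD)
  show "smooth_on (snd c ` (fst c \<inter> W)) (f \<circ> chart_inv c)" using assms(1,2) by (simp add: smooth_fun_def)
qed (use assms(3,4) in blast)

lemma smooth_fun_const: "smooth_fun M W (\<lambda>q. c)"
  by (auto simp: smooth_fun_def o_def smooth_on_const)

lemma smooth_fun_cong:
  assumes "openin (mtop M) W" "\<And>q. q \<in> W \<Longrightarrow> f q = g q" "smooth_fun M W f" shows "smooth_fun M W g"
  unfolding smooth_fun_def
proof
  fix c assume c: "c \<in> charts M"
  show "smooth_on (snd c ` (fst c \<inter> W)) (g \<circ> chart_inv c)"
    by (rule smooth_on_cong[OF chart_image_open[OF c assms(1)], of "f \<circ> chart_inv c"])
      (use assms c in \<open>auto simp: smooth_fun_def\<close>)
qed

lemma smooth_fun_in_chart: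
  assumes W: "openin (mtop M) W" and c: "c \<in> charts M" "W \<subseteq> fst c"
    and h: "smooth_on (snd c ` W) h"
  shows "smooth_fun M W (\<lambda>q. h (snd c q))"
  unfolding smooth_fun_def
proof
  fix d assume d: "d \<in> charts M"
  let ?S = "snd d ` (fst d \<inter> W)"
  have o: "open ?S" using chart_image_open[OF d W] .
  have oc: "open (snd c ` W)" using chart_image_open[OF c(1) W] c(2) by (simp add: Int_absorb1)
  have im: "self.tr d c ` ?S \<subseteq> snd c ` W"
  proof (rule image_subsetI)
    fix z assume "z \<in> ?S"
    then obtain q where "q \<in> fst d" "q \<in> W" "z = snd d q" by blast
    then show "self.tr d c z \<in> snd c ` W" using d by auto
  qed
  have tr: "smooth_on ?S (self.tr d c)"
    by (rule smooth_on_subset[OF self.smooth_tr[OF d c(1)]]) (use c(2) in blast)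
  have "smooth_on ?S (\<lambda>z. h (self.tr d c z))" by (rule smooth_on_compose[OF o oc im h tr])
  then show "smooth_on ?S ((\<lambda>q. h (snd c q)) \<circ> chart_inv d)" by (simp add: o_def)
qed

end

text \<open>Pushforward of tangent vectors of a submanifold: in charts, it is composition with the derivative of
  the coordinate expression of the inclusion.\<close>

context smooth_incl
begin

abbreviation push :: "'a \<Rightarrow> 'l \<Rightarrow> 'e" where "push \<equiv> mdiff L M (\<lambda>x. x)"

lemma push_eq: "push q = fd (tr (chart_at L q) (chart_at M q)) (coord_at L q)"
  by (simp add: mdiff_def o_def)

lemma incl: "smooth_incl L M" by (rule smooth_incl_axioms)

lemma fd_tr_push:
  assumes q: "d \<in> charts L" "q \<in> fst d" "c \<in> charts M" "q \<in> fst c"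
  shows "fd (tr d c) (snd d q) (tcoord L d q u) = tcoord M c q (push q u)"
proof -
  note s = smooth_incl_self[OF L.mfd] smooth_incl_self[OF M.mfd]
  have qL: "q \<in> points L" and qM: "q \<in> points M" using L.dom_points M.dom_points q by blast+
  note a = L.chart_at[OF qL] M.chart_at[OF qM]
  have "fd (tr d c) (snd d q) (tcoord L d q u) = fd (tr (chart_at L q) c) (snd (chart_at L q) q) u"
    unfolding tcoord_def coord_at_def using fd_tr_comp[OF s(1) incl incl] a q by blast
  also have "\<dots> = tcoord M c q (push q u)"
    unfolding tcoord_def coord_at_def push_eq using fd_tr_comp[OF incl s(2) incl] a q by metis
  finally show ?thesis .
qed

lemma push_linear: "q \<in> points L \<Longrightarrow> linear (push q)"
  unfolding push_eq coord_at_def using sub L.chart_at M.chart_at diff_tr by (intro linear_frechet_derivative) blast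

lemma dfun_push:
  assumes f: "openin (mtop M) W" "smooth_fun M W f" and P: "openin (mtop L) P" "P \<subseteq> W"
    and g: "\<And>q. q \<in> P \<Longrightarrow> g q = f q" and p: "p \<in> P"
  shows "dfun L g p u = dfun M f p (push p u)"
proof -
  let ?d = "chart_at L p" and ?c = "chart_at M p"
  have pp: "p \<in> points L" "p \<in> points M" using p P openin_subset sub by blast+
  note a = L.chart_at[OF pp(1)] M.chart_at[OF pp(2)]
  have o: "open (snd ?d ` (fst ?d \<inter> (P \<inter> fst ?c)))"
    using L.chart_image_open open_inter[OF P(1) M.chart_dom] a by blast
  have "dfun L g p u = fd (\<lambda>z. (f \<circ> chart_inv ?c) (tr ?d ?c z)) (coord_at L p) u"
    unfolding dfun_def coord_at_def
    by (rule fun_cong[OF fd_cong_open[OF o]]) (use a p g in \<open>auto simp: L.chart_inv M.chart_inv\<close>)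
  also have "\<dots> = fd (f \<circ> chart_inv ?c) (tr ?d ?c (coord_at L p)) (push p u)"
    unfolding push_eq
  proof (rule fd_chain)
    show "(f \<circ> chart_inv ?c) differentiable (at (tr ?d ?c (coord_at L p)))"
      using M.smooth_fun_diff[OF f(2)] a p P(2) by (simp add: coord_at_def L.chart_inv subset_iff)
    show "tr ?d ?c differentiable (at (coord_at L p))"
      unfolding coord_at_def using a by (intro diff_tr) auto
  qed
  also have "\<dots> = dfun M f p (push p u)" using a by (simp add: dfun_def coord_at_def L.chart_inv)
  finally show ?thesis .
qed

end

section \<open>The Lie bracket\<close>

context smooth_mfd
begin

lemma tcoord_add: "c \<in> charts M \<Longrightarrow> q \<in> fst c \<Longrightarrow> tcoord M c q (v + w) = tcoord M c q v + tcoord M c q w"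
  and tcoord_scaleR: "c \<in> charts M \<Longrightarrow> q \<in> fst c \<Longrightarrow> tcoord M c q (r *\<^sub>R v) = r *\<^sub>R tcoord M c q v"
  by (simp_all add: tcoord_linear linear_add linear_cmul)

lemma vfield_add:
  assumes W: "openin (mtop M) W" and X: "vfield M W X" and Y: "vfield M W Y"
  shows "vfield M W (\<lambda>q. X q + Y q)"
  unfolding vfield_def
proof
  fix c assume c: "c \<in> charts M"
  show "smooth_on (snd c ` (fst c \<inter> W)) (vf_rep M c (\<lambda>q. X q + Y q))"
    by (rule smooth_on_cong[OF chart_image_open[OF c W]
          _ smooth_on_add[OF chart_image_open[OF c W] vfieldD[OF X c] vfieldD[OF Y c]]])
      (auto simp: vf_rep_at[OF c] tcoord_add[OF c])
qed

lemma vfield_scaleR: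
  assumes W: "openin (mtop M) W" and f: "smooth_fun M W f" and X: "vfield M W X"
  shows "vfield M W (\<lambda>q. f q *\<^sub>R X q)"
  unfolding vfield_def
proof
  fix c assume c: "c \<in> charts M"
  have f': "smooth_on (snd c ` (fst c \<inter> W)) (f \<circ> chart_inv c)" using f c by (simp add: smooth_fun_def)
  show "smooth_on (snd c ` (fst c \<inter> W)) (vf_rep M c (\<lambda>q. f q *\<^sub>R X q))"
    by (rule smooth_on_cong[OF chart_image_open[OF c W]
          _ smooth_on_scaleR[OF chart_image_open[OF c W] f' vfieldD[OF X c]]])
      (auto simp: vf_rep_at[OF c] tcoord_scaleR[OF c] chart_inv[OF c])
qed

lemmas vfield_cmul = vfield_scaleR[OF _ smooth_fun_const]

lemma vfield_diff:
  assumes W: "openin (mtop M) W" and X: "vfield M W X" and Y: "vfield M W Y"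
  shows "vfield M W (\<lambda>q. X q - Y q)"
  using vfield_add[OF W X vfield_cmul[OF W Y, of "-1"]] by simp

lemma vfield_sum:
  assumes W: "openin (mtop M) W" and X: "\<And>i. i \<in> I \<Longrightarrow> vfield M W (X i)"
    and ne: "finite I" "I \<noteq> {}"
  shows "vfield M W (\<lambda>q. \<Sum>i\<in>I. X i q)"
  using ne X by (induction I rule: finite_ne_induct) (auto intro: vfield_add[OF W])

lemma vf_rep_diff:
  assumes X: "vfield M W X" and c: "c \<in> charts M" "p \<in> fst c" "p \<in> W"
  shows "vf_rep M c X differentiable (at (snd c p))"
  using smooth_onD[OF vfieldD[OF X c(1)]] c by blast

text \<open>The coordinate formula for the bracket in an arbitrary chart. The bracket itself uses the
  preferred chart at each point, which says nothing about its smoothness until the formula is known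
  not to depend on the chart.\<close>

definition chart_bracket :: "('a, 'e) chart \<Rightarrow> ('a \<Rightarrow> 'e) \<Rightarrow> ('a \<Rightarrow> 'e) \<Rightarrow> 'a \<Rightarrow> 'e" where
  "chart_bracket c X Y p =
     fd (vf_rep M c Y) (snd c p) (vf_rep M c X (snd c p)) -
     fd (vf_rep M c X) (snd c p) (vf_rep M c Y (snd c p))"

lemma bracket_chart_at:
  assumes "p \<in> points M" shows "bracket M X Y p = chart_bracket (chart_at M p) X Y p"
proof -
  have "vf_rep M (chart_at M p) Z (snd (chart_at M p) p) = Z p" for Z
    using assms by (simp add: vf_rep_at chart_at tcoord_at)
  then show ?thesis by (simp add: chart_bracket_def bracket_def coord_at_def)
qed

end

text \<open>Product rule for \<open>Dg(z) u(z)\<close>, with the symmetry of \<open>D\<^sup>2g\<close> used to keep the operator argument fixed.\<close>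

lemma fd_of_fd_apply:
  fixes g :: "'l::euclidean_space \<Rightarrow> 'e::euclidean_space"
  assumes S: "open S" "x \<in> S" and g: "smooth_on S g" and u: "u differentiable (at x)"
  shows "fd (\<lambda>z. fd g z (u z)) x v = fd (\<lambda>z. fd g z (u x)) x v + fd g x (fd u x v)"
    and "(\<lambda>z. fd g z (u z)) differentiable (at x)"
proof -
  have dg: "g differentiable (at x)" using smooth_onD[OF g S(2)] .
  have dd: "(\<lambda>z. fd g z b) differentiable (at x)" for b using smooth_onD[OF smooth_on_fd[OF g] S(2)] .
  let ?s = "\<lambda>z. \<Sum>b\<in>Basis. (u z \<bullet> b) *\<^sub>R fd g z b"
  have H: "(?s has_derivative (\<lambda>v. \<Sum>b\<in>Basis. (u x \<bullet> b) *\<^sub>R fd (\<lambda>z. fd g z b) x v + (fd u x v \<bullet> b) *\<^sub>R fd g x b)) (at x)"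
    by (intro has_derivative_sum has_derivative_scaleR has_derivative_inner_left has_derivative_fd u dd)
  have eq: "?s z = fd g z (u z)" if "z \<in> S" for z
    using fd_expand[OF smooth_onD[OF g that], of "u z"] by simp
  have "?s differentiable (at x)" using H unfolding differentiable_def by blast
  from differentiable_cong_open[OF S eq this]
  show "(\<lambda>z. fd g z (u z)) differentiable (at x)" .
  have "fd (\<lambda>z. fd g z (u z)) x v = fd ?s x v"
    using fd_cong_open[OF S eq] by simp
  also have "\<dots> = (\<Sum>b\<in>Basis. (u x \<bullet> b) *\<^sub>R fd (\<lambda>z. fd g z b) x v) + fd g x (fd u x v)"
    unfolding fd_eqI[OF H] sum.distrib using fd_expand[OF dg, of "fd u x v"] by simp
  also have "(\<Sum>b\<in>Basis. (u x \<bullet> b) *\<^sub>R fd (\<lambda>z. fd g z b) x v) = fd (\<lambda>z. fd g z v) x (u x)"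
    using fd_expand[OF dd, of v "u x"] fd_fd_symmetric[OF S g] by simp
  also have "\<dots> = fd (\<lambda>z. fd g z (u x)) x v" using fd_fd_symmetric[OF S g] .
  finally show "fd (\<lambda>z. fd g z (u z)) x v = fd (\<lambda>z. fd g z (u x)) x v + fd g x (fd u x v)" .
qed

text \<open>If \<open>Xh\<close>, \<open>Yh\<close> extend the \<open>j\<close>-images of \<open>X\<close>, \<open>Y\<close>, differentiating \<open>Yh \<circ> j = Dj Y\<close> along \<open>X\<close> gives
  \<open>DYh Xh = D\<^sup>2j (X, Y) + Dj (DY X)\<close>, and the second derivative of \<open>j\<close> cancels in the bracket.\<close>

lemma bracket_related_euclidean:
  fixes j :: "'l::euclidean_space \<Rightarrow> 'e::euclidean_space"
  assumes U: "open U" "x \<in> U" and j: "smooth_on U j"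
    and d: "X differentiable (at x)" "Y differentiable (at x)"
      "Xh differentiable (at (j x))" "Yh differentiable (at (j x))"
    and rX: "\<And>z. z \<in> U \<Longrightarrow> Xh (j z) = fd j z (X z)" and rY: "\<And>z. z \<in> U \<Longrightarrow> Yh (j z) = fd j z (Y z)"
  shows "fd j x (fd Y x (X x) - fd X x (Y x)) = fd Yh (j x) (Xh (j x)) - fd Xh (j x) (Yh (j x))"
proof -
  have dj: "j differentiable (at x)" using smooth_onD[OF j U(2)] .
  have linj: "linear (fd j x)" using linear_frechet_derivative[OF dj] .
  have key: "fd Zh (j x) (fd j x w) = fd (\<lambda>z. fd j z (Z x)) x w + fd j x (fd Z x w)"
    if dZ: "Z differentiable (at x)" and dZh: "Zh differentiable (at (j x))"
      and rZ: "\<And>z. z \<in> U \<Longrightarrow> Zh (j z) = fd j z (Z z)" for Z Zh w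
  proof -
    have "fd Zh (j x) (fd j x w) = fd (\<lambda>z. Zh (j z)) x w" using fd_chain[OF dZh dj] by simp
    also have "\<dots> = fd (\<lambda>z. fd j z (Z z)) x w" using fd_cong_open[OF U rZ] by simp
    finally show ?thesis using fd_of_fd_apply(1)[OF U j dZ] by simp
  qed
  show ?thesis
    using key[OF d(2,4) rY, of "X x"] key[OF d(1,3) rX, of "Y x"] rX[OF U(2)] rY[OF U(2)]
      fd_fd_symmetric[OF U j, of "X x" "Y x"] linear_diff[OF linj] by simp
qed

context smooth_incl
begin

lemma chart_bracket_push:
  assumes P: "openin (mtop L) P" "P \<subseteq> W" and W: "openin (mtop M) W"
    and X: "vfield L P X" "vfield M W Xh" "\<And>q. q \<in> P \<Longrightarrow> Xh q = push q (X q)"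
    and Y: "vfield L P Y" "vfield M W Yh" "\<And>q. q \<in> P \<Longrightarrow> Yh q = push q (Y q)"
    and d: "d \<in> charts L" "q \<in> fst d" and c: "c \<in> charts M" "q \<in> fst c" and q: "q \<in> P"
  shows "fd (tr d c) (snd d q) (L.chart_bracket d X Y q) = M.chart_bracket c Xh Yh q"
proof -
  let ?U = "snd d ` (fst d \<inter> (P \<inter> fst c))"
  have o: "open ?U" using L.chart_image_open[OF d(1) open_inter[OF P(1) M.chart_dom[OF c(1)]]] .
  have qU: "snd d q \<in> ?U" using d q c by blast
  have j: "smooth_on ?U (tr d c)" by (rule smooth_on_subset[OF smooth_tr[OF d(1) c(1)]]) auto
  have trq: "tr d c (snd d q) = snd c q" using d by simp
  have rel: "vf_rep M c Zh (tr d c z) = fd (tr d c) z (vf_rep L d Z z)"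
    if Z: "\<And>q. q \<in> P \<Longrightarrow> Zh q = push q (Z q)" and z: "z \<in> ?U" for Z Zh z
  proof -
    obtain q' where q': "q' \<in> fst d" "q' \<in> P" "q' \<in> fst c" "z = snd d q'" using z by blast
    then show ?thesis using fd_tr_push[OF d(1) q'(1) c(1) q'(3)] Z[OF q'(2)] c(1) d(1)
      by (simp add: L.vf_rep_at M.vf_rep_at)
  qed
  have qW: "q \<in> W" using q P by blast
  show ?thesis
    using bracket_related_euclidean[OF o qU j, of "vf_rep L d X" "vf_rep L d Y" "vf_rep M c Xh" "vf_rep M c Yh"]
      L.vf_rep_diff[OF X(1) d q] L.vf_rep_diff[OF Y(1) d q] M.vf_rep_diff[OF X(2) c qW] M.vf_rep_diff[OF Y(2) c qW]
      rel[OF X(3)] rel[OF Y(3)] trq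
    by (simp only: L.chart_bracket_def M.chart_bracket_def)
qed

lemma bracket_push:
  assumes P: "openin (mtop L) P" "P \<subseteq> W" and W: "openin (mtop M) W"
    and X: "vfield L P X" "vfield M W Xh" "\<And>q. q \<in> P \<Longrightarrow> Xh q = push q (X q)"
    and Y: "vfield L P Y" "vfield M W Yh" "\<And>q. q \<in> P \<Longrightarrow> Yh q = push q (Y q)"
    and q: "q \<in> P"
  shows "push q (bracket L X Y q) = bracket M Xh Yh q"
proof -
  have pp: "q \<in> points L" "q \<in> points M" using q P openin_subset sub by blast+
  note a = L.chart_at[OF pp(1)] M.chart_at[OF pp(2)]
  have "push q (bracket L X Y q) = fd (tr (chart_at L q) (chart_at M q)) (snd (chart_at L q) q) (bracket L X Y q)"
    by (simp add: push_eq coord_at_def)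
  also have "\<dots> = bracket M Xh Yh q"
    unfolding L.bracket_chart_at[OF pp(1)] M.bracket_chart_at[OF pp(2)]
    using a by (intro chart_bracket_push[OF P W X Y _ _ _ _ q]) auto
  finally show ?thesis .
qed

end

context smooth_mfd
begin

lemma push_self: "q \<in> points M \<Longrightarrow> self.push q v = v"
  using self.fd_tr_push[where d = "chart_at M q" and q = q and c = "chart_at M q" and u = v] chart_at[of q]
  by (simp add: tcoord_at tr_self)

text \<open>The inclusion of \<open>M\<close> in itself relates every field to itself, so the compatibility of brackets
  with inclusions contains their independence of the chart.\<close>

lemma bracket_in_chart:
  assumes W: "openin (mtop M) W" "vfield M W X" "vfield M W Y" and c: "c \<in> charts M" "q \<in> fst c" and q: "q \<in> W"
  shows "tcoord M c q (bracket M X Y q) = chart_bracket c X Y q"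
proof -
  have pp: "q' \<in> points M" if "q' \<in> W" for q' using that W(1) openin_subset by blast
  note a = chart_at[OF pp[OF q]]
  show ?thesis
    unfolding bracket_chart_at[OF pp[OF q]] tcoord_def coord_at_def
    using a c q pp push_self
    by (intro self.chart_bracket_push[OF W(1) order_refl W(1) W(2) W(2) _ W(3) W(3)]) auto
qed

lemma vfield_bracket:
  assumes W: "openin (mtop M) W" "vfield M W X" "vfield M W Y"
  shows "vfield M W (bracket M X Y)"
  unfolding vfield_def
proof
  fix c assume c: "c \<in> charts M"
  let ?S = "snd c ` (fst c \<inter> W)"
  note o = chart_image_open[OF c W(1)]
  show "smooth_on ?S (vf_rep M c (bracket M X Y))"
  proof (rule smooth_on_cong[OF o])
    show "smooth_on ?S (\<lambda>z. fd (vf_rep M c Y) z (vf_rep M c X z) - fd (vf_rep M c X) z (vf_rep M c Y z))"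
      by (intro smooth_on_diff smooth_on_fd_field o vfieldD[OF _ c] W)
    show "fd (vf_rep M c Y) z (vf_rep M c X z) - fd (vf_rep M c X) z (vf_rep M c Y z) = vf_rep M c (bracket M X Y) z"
      if "z \<in> ?S" for z
      using that bracket_in_chart[OF W c] by (auto simp: vf_rep_at[OF c] chart_bracket_def)
  qed
qed

lemma fd_vf_rep_cong:
  assumes "openin (mtop M) W" "\<And>q. q \<in> W \<Longrightarrow> X q = X' q" "c \<in> charts M" "p \<in> fst c" "p \<in> W"
  shows "fd (vf_rep M c X) (snd c p) = fd (vf_rep M c X') (snd c p)"
  by (rule fd_cong_open[OF chart_image_open[OF assms(3,1)] _ vf_rep_cong[OF assms(3,2)]]) (use assms in auto)

lemma bracket_cong:
  assumes "openin (mtop M) W" "p \<in> W" "\<And>q. q \<in> W \<Longrightarrow> X q = X' q" "\<And>q. q \<in> W \<Longrightarrow> Y q = Y' q"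
  shows "bracket M X Y p = bracket M X' Y' p"
proof -
  have p: "p \<in> points M" using assms(1,2) openin_subset by blast
  note a = chart_at[OF p]
  show ?thesis
    using fd_vf_rep_cong[OF assms(1,3), where c = "chart_at M p" and p = p]
      fd_vf_rep_cong[OF assms(1,4), where c = "chart_at M p" and p = p]
      a assms by (simp add: bracket_def coord_at_def)
qed

lemma bracket_antisym: "bracket M X Y p = - bracket M Y X p"
  by (simp add: bracket_def)

lemma fd_vf_rep_add:
  assumes "vfield M W X" "vfield M W Y" "openin (mtop M) W" "c \<in> charts M" "p \<in> fst c" "p \<in> W"
  shows "fd (vf_rep M c (\<lambda>q. X q + Y q)) (snd c p) v = fd (vf_rep M c X) (snd c p) v + fd (vf_rep M c Y) (snd c p) v"
proof -
  have "fd (vf_rep M c (\<lambda>q. X q + Y q)) (snd c p) = fd (\<lambda>z. vf_rep M c X z + vf_rep M c Y z) (snd c p)"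
    by (rule fd_cong_open[OF chart_image_open[OF assms(4,3)]])
      (use assms in \<open>auto simp: vf_rep_at[OF assms(4)] tcoord_add[OF assms(4)]\<close>)
  then show ?thesis using assms by (simp add: fd_add vf_rep_diff)
qed

lemma fd_vf_rep_scaleR:
  assumes "vfield M W X" "smooth_fun M W f" "openin (mtop M) W" "c \<in> charts M" "p \<in> fst c" "p \<in> W"
  shows "fd (vf_rep M c (\<lambda>q. f q *\<^sub>R X q)) (snd c p) v
    = f p *\<^sub>R fd (vf_rep M c X) (snd c p) v + fd (f \<circ> chart_inv c) (snd c p) v *\<^sub>R vf_rep M c X (snd c p)"
proof -
  have "fd (vf_rep M c (\<lambda>q. f q *\<^sub>R X q)) (snd c p) = fd (\<lambda>z. (f \<circ> chart_inv c) z *\<^sub>R vf_rep M c X z) (snd c p)"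
    by (rule fd_cong_open[OF chart_image_open[OF assms(4,3)]])
      (use assms in \<open>auto simp: vf_rep_at[OF assms(4)] tcoord_scaleR[OF assms(4)] chart_inv[OF assms(4)]\<close>)
  then have "fd (vf_rep M c (\<lambda>q. f q *\<^sub>R X q)) (snd c p) v
    = (f \<circ> chart_inv c) (snd c p) *\<^sub>R fd (vf_rep M c X) (snd c p) v
      + fd (f \<circ> chart_inv c) (snd c p) v *\<^sub>R vf_rep M c X (snd c p)"
    using fd_bilinear(1)[OF bounded_bilinear_scaleR smooth_fun_diff[OF assms(2,4,5,6)] vf_rep_diff[OF assms(1,4,5,6)]]
    by simp
  then show ?thesis using assms by simp
qed

lemma linear_fd_vf_rep:
  assumes "vfield M W X" "c \<in> charts M" "p \<in> fst c" "p \<in> W"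
  shows "linear (fd (vf_rep M c X) (snd c p))"
  using linear_frechet_derivative[OF vf_rep_diff[OF assms]] .

lemma bracket_add_left:
  assumes W: "openin (mtop M) W" "p \<in> W" and X: "vfield M W X" "vfield M W X'" "vfield M W Y"
  shows "bracket M (\<lambda>q. X q + X' q) Y p = bracket M X Y p + bracket M X' Y p"
proof -
  have p: "p \<in> points M" using W openin_subset by blast
  note a = chart_at[OF p]
  show ?thesis
    using fd_vf_rep_add[OF X(1,2) W(1)] linear_add[OF linear_fd_vf_rep[OF X(3)]] a W
    by (simp add: bracket_def coord_at_def)
qed

lemma bracket_scaleR_left:
  assumes W: "openin (mtop M) W" "p \<in> W" and X: "vfield M W X" "vfield M W Y" and f: "smooth_fun M W f"
  shows "bracket M (\<lambda>q. f q *\<^sub>R X q) Y p = f p *\<^sub>R bracket M X Y p - dfun M f p (Y p) *\<^sub>R X p"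
proof -
  have p: "p \<in> points M" using W openin_subset by blast
  note a = chart_at[OF p]
  show ?thesis
    using fd_vf_rep_scaleR[OF X(1) f W(1)] linear_cmul[OF linear_fd_vf_rep[OF X(2)]] a W p
    by (simp add: bracket_def coord_at_def dfun_def vf_rep_at tcoord_at algebra_simps)
qed

lemma bracket_add_right:
  assumes W: "openin (mtop M) W" "p \<in> W" and X: "vfield M W X" "vfield M W X'" "vfield M W Y"
  shows "bracket M Y (\<lambda>q. X q + X' q) p = bracket M Y X p + bracket M Y X' p"
  using bracket_add_left[OF assms] bracket_antisym[of Y] by simp

lemma bracket_scaleR_right:
  assumes W: "openin (mtop M) W" "p \<in> W" and X: "vfield M W X" "vfield M W Y" and f: "smooth_fun M W f"
  shows "bracket M Y (\<lambda>q. f q *\<^sub>R X q) p = f p *\<^sub>R bracket M Y X p + dfun M f p (Y p) *\<^sub>R X p"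
  using bracket_scaleR_left[OF assms] bracket_antisym[of Y] by simp

lemma dfun_const: "dfun M (\<lambda>q. c) p v = 0"
  by (simp add: dfun_def o_def)

lemma dfun_linear:
  assumes "smooth_fun M W f" "p \<in> W" "p \<in> points M" shows "linear (dfun M f p)"
  unfolding dfun_def coord_at_def
  using smooth_fun_diff[OF assms(1)] chart_at[OF assms(3)] assms(2) by (intro linear_frechet_derivative) blast

lemma bracket_cmul_left:
  assumes W: "openin (mtop M) W" "p \<in> W" and X: "vfield M W X" "vfield M W Y"
  shows "bracket M (\<lambda>q. r *\<^sub>R X q) Y p = r *\<^sub>R bracket M X Y p"
  using bracket_scaleR_left[OF assms smooth_fun_const, of r] by (simp add: dfun_const)

lemma bracket_cmul_right:
  assumes W: "openin (mtop M) W" "p \<in> W" and X: "vfield M W X" "vfield M W Y"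
  shows "bracket M Y (\<lambda>q. r *\<^sub>R X q) p = r *\<^sub>R bracket M Y X p"
  using bracket_scaleR_right[OF assms smooth_fun_const, of r] by (simp add: dfun_const)

lemma bracket_diff_left:
  assumes W: "openin (mtop M) W" "p \<in> W" and X: "vfield M W X" "vfield M W X'" "vfield M W Y"
  shows "bracket M (\<lambda>q. X q - X' q) Y p = bracket M X Y p - bracket M X' Y p"
  using bracket_add_left[OF W X(1) vfield_cmul[OF W(1) X(2), of "-1"] X(3)]
    bracket_cmul_left[OF W X(2,3), of "-1"] by simp

lemma bracket_diff_right:
  assumes W: "openin (mtop M) W" "p \<in> W" and X: "vfield M W X" "vfield M W X'" "vfield M W Y"
  shows "bracket M Y (\<lambda>q. X q - X' q) p = bracket M Y X p - bracket M Y X' p"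
  using bracket_diff_left[OF assms] bracket_antisym[of Y] by simp

lemma dfun_cong:
  assumes "openin (mtop M) W" "p \<in> W" "\<And>q. q \<in> W \<Longrightarrow> f q = g q"
  shows "dfun M f p = dfun M g p"
proof -
  have p: "p \<in> points M" using assms(1,2) openin_subset by blast
  note a = chart_at[OF p]
  show ?thesis unfolding dfun_def coord_at_def
    by (rule fd_cong_open[OF chart_image_open[OF conjunct1[OF a] assms(1)]]) (use a assms in auto)
qed

lemma dfun_mult:
  assumes "smooth_fun M W f" "smooth_fun M W g" "p \<in> W" "p \<in> points M"
  shows "dfun M (\<lambda>q. f q * g q) p v = dfun M f p v * g p + f p * dfun M g p v"
  using fd_bilinear(1)[OF bounded_bilinear_mult smooth_fun_diff[OF assms(1)] smooth_fun_diff[OF assms(2)], of "chart_at M p" p]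
    chart_at[OF assms(4)] assms(3) by (simp add: dfun_def coord_at_def o_def)

lemma dfun_add:
  assumes "smooth_fun M W f" "smooth_fun M W g" "p \<in> W" "p \<in> points M"
  shows "dfun M (\<lambda>q. f q + g q) p v = dfun M f p v + dfun M g p v"
  using fd_add[OF smooth_fun_diff[OF assms(1)] smooth_fun_diff[OF assms(2)], of "chart_at M p" p]
    chart_at[OF assms(4)] assms(3) by (simp add: dfun_def coord_at_def o_def)

lemma dfun_in_chart:
  assumes W: "openin (mtop M) W" and f: "smooth_fun M W f" and c: "c \<in> charts M" "q \<in> fst c" "q \<in> W"
  shows "dfun M f q v = fd (f \<circ> chart_inv c) (snd c q) (tcoord M c q v)"
proof -
  have p: "q \<in> points M" using c dom_points by blast
  note a = chart_at[OF p]
  let ?d = "chart_at M q"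
  have o: "open (snd ?d ` (fst ?d \<inter> fst c))" using self.overlap_open a c by blast
  have "fd (f \<circ> chart_inv ?d) (snd ?d q) v = fd (\<lambda>z. (f \<circ> chart_inv c) (self.tr ?d c z)) (snd ?d q) v"
    by (rule fun_cong[OF fd_cong_open[OF o]]) (use a c in auto)
  also have "\<dots> = fd (f \<circ> chart_inv c) (self.tr ?d c (snd ?d q)) (fd (self.tr ?d c) (snd ?d q) v)"
  proof (rule fd_chain)
    show "(f \<circ> chart_inv c) differentiable (at (self.tr ?d c (snd ?d q)))"
      using smooth_fun_diff[OF f c] a by simp
    show "self.tr ?d c differentiable (at (snd ?d q))" using self.diff_tr a c by blast
  qed
  finally show ?thesis using a by (simp add: dfun_def coord_at_def tcoord_def)
qed

lemma smooth_fun_dfun: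
  assumes W: "openin (mtop M) W" and f: "smooth_fun M W f" and X: "vfield M W X"
  shows "smooth_fun M W (\<lambda>q. dfun M f q (X q))"
  unfolding smooth_fun_def
proof
  fix c assume c: "c \<in> charts M"
  note o = chart_image_open[OF c W]
  have f': "smooth_on (snd c ` (fst c \<inter> W)) (f \<circ> chart_inv c)" using f c by (simp add: smooth_fun_def)
  show "smooth_on (snd c ` (fst c \<inter> W)) ((\<lambda>q. dfun M f q (X q)) \<circ> chart_inv c)"
    by (rule smooth_on_cong[OF o _ smooth_on_fd_field[OF o f' vfieldD[OF X c]]])
      (use dfun_in_chart[OF W f c] c in \<open>auto simp: vf_rep_at\<close>)
qed

lemma fd_vf_rep_bracket:
  assumes W: "openin (mtop M) W" "vfield M W X" "vfield M W Y" and c: "c \<in> charts M" "p \<in> fst c" "p \<in> W"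
  shows "fd (vf_rep M c (bracket M X Y)) (snd c p) v =
     fd (\<lambda>z. fd (vf_rep M c Y) z (vf_rep M c X (snd c p))) (snd c p) v + fd (vf_rep M c Y) (snd c p) (fd (vf_rep M c X) (snd c p) v)
   - (fd (\<lambda>z. fd (vf_rep M c X) z (vf_rep M c Y (snd c p))) (snd c p) v + fd (vf_rep M c X) (snd c p) (fd (vf_rep M c Y) (snd c p) v))"
proof -
  let ?S = "snd c ` (fst c \<inter> W)" and ?x = "snd c p"
  note o = chart_image_open[OF c(1) W(1)]
  have x: "?x \<in> ?S" using c by blast
  note sX = vfieldD[OF W(2) c(1)] and sY = vfieldD[OF W(3) c(1)]
  have "fd (vf_rep M c (bracket M X Y)) ?x v
    = fd (\<lambda>z. fd (vf_rep M c Y) z (vf_rep M c X z) - fd (vf_rep M c X) z (vf_rep M c Y z)) ?x v"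
    by (rule fun_cong[OF fd_cong_open[OF o x]])
      (use bracket_in_chart[OF W c(1)] in \<open>auto simp: vf_rep_at[OF c(1)] chart_bracket_def\<close>)
  also have "\<dots> = fd (\<lambda>z. fd (vf_rep M c Y) z (vf_rep M c X z)) ?x v - fd (\<lambda>z. fd (vf_rep M c X) z (vf_rep M c Y z)) ?x v"
    by (rule fd_diff[OF fd_of_fd_apply(2)[OF o x sY smooth_onD[OF sX x]] fd_of_fd_apply(2)[OF o x sX smooth_onD[OF sY x]]])
  finally show ?thesis
    unfolding fd_of_fd_apply(1)[OF o x sY smooth_onD[OF sX x]] fd_of_fd_apply(1)[OF o x sX smooth_onD[OF sY x]] .
qed

text \<open>In a chart all terms cancel except second derivatives, which cancel by their symmetry.\<close>

lemma bracket_jacobi: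
  assumes W: "openin (mtop M) W" "p \<in> W" and X: "vfield M W X" "vfield M W Y" "vfield M W Z"
  shows "bracket M X (bracket M Y Z) p = bracket M (bracket M X Y) Z p + bracket M Y (bracket M X Z) p"
proof -
  have p: "p \<in> points M" using W openin_subset by blast
  note a = chart_at[OF p]
  let ?c = "chart_at M p"
  let ?x = "snd ?c p"
  have cc: "?c \<in> charts M" "p \<in> fst ?c" using a by auto
  have r: "vf_rep M ?c V ?x = V p" for V using p a by (simp add: vf_rep_at tcoord_at)
  have sym: "fd (\<lambda>z. fd (vf_rep M ?c V) z u) ?x v = fd (\<lambda>z. fd (vf_rep M ?c V) z v) ?x u"
    if "vfield M W V" for V u v
    using fd_fd_symmetric[OF chart_image_open[OF cc(1) W(1)] _ vfieldD[OF that cc(1)]] W(2) a by blast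
  have br: "bracket M V V' p = fd (vf_rep M ?c V') ?x (V p) - fd (vf_rep M ?c V) ?x (V' p)" for V V'
    by (simp add: bracket_def coord_at_def)
  note dbr = fd_vf_rep_bracket[OF W(1) _ _ cc W(2), unfolded r]
  note lin = linear_diff[OF linear_fd_vf_rep[OF _ cc W(2)]]
  show ?thesis
    unfolding br[of X "bracket M Y Z"] br[of "bracket M X Y" Z] br[of Y "bracket M X Z"]
      dbr[OF X(1,2)] dbr[OF X(2,3)] dbr[OF X(1,3)] br[of Y Z] br[of X Y] br[of X Z]
      lin[OF X(1)] lin[OF X(2)] lin[OF X(3)]
    using sym[OF X(1), of "Y p" "Z p"] sym[OF X(2), of "X p" "Z p"] sym[OF X(3), of "X p" "Y p"]
    by (simp add: algebra_simps)
qed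

lemma open_points: "openin (mtop M) (points M)"
  by simp

lemma open_in_points: "openin (mtop M) W \<Longrightarrow> p \<in> W \<Longrightarrow> p \<in> points M"
  using openin_subset by blast

lemma chart_nbhd:
  assumes "openin (mtop M) W" "p \<in> W"
  shows "openin (mtop M) (W \<inter> fst (chart_at M p))" "p \<in> W \<inter> fst (chart_at M p)"
  using assms chart_at[OF open_in_points[OF assms]] chart_dom by blast+

lemma two_dform:
  "2 * dform M \<eta> X Y p = dfun M (\<lambda>q. \<eta> q (Y q)) p (X p) - dfun M (\<lambda>q. \<eta> q (X q)) p (Y p) - \<eta> p (bracket M X Y p)"
  by (simp add: dform_def)

lemma dfun_zero_on:
  assumes "openin (mtop M) W" "p \<in> W" "\<And>q. q \<in> W \<Longrightarrow> f q = c"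
  shows "dfun M f p v = 0"
  using dfun_cong[OF assms] by (simp add: dfun_const)

lemma bracket_zero_left:
  assumes "openin (mtop M) W" "p \<in> W" "\<And>q. q \<in> W \<Longrightarrow> X q = 0" "vfield M W Y"
  shows "bracket M X Y p = 0"
proof -
  have "bracket M X Y p = bracket M (\<lambda>q. 0 *\<^sub>R Y q) Y p"
    by (rule bracket_cong[OF assms(1,2)]) (simp_all add: assms(3))
  then show ?thesis using bracket_cmul_left[OF assms(1,2,4,4), of 0] by simp
qed

end

section \<open>One normal structure tensor\<close>

text \<open>What \<open>\<phi>\<^sub>1\<close> and \<open>\<phi>\<^sub>2\<close> satisfy separately. The conditions are invariant under \<open>f \<mapsto> -f\<close>, so a
  statement about the \<open>+1\<close> eigendistribution also holds for the other one.\<close>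

locale normal_structure = smooth_mfd M
  for M :: "('a, 'e::euclidean_space) mfd" +
  fixes \<eta> :: "'a \<Rightarrow> 'e \<Rightarrow> real" and \<xi> :: "'a \<Rightarrow> 'e" and f :: "'a \<Rightarrow> 'e \<Rightarrow> 'e"
  assumes eta: "one_form M \<eta>" and xi: "vfield M (points M) \<xi>"
    and eta_xi: "\<And>p. p \<in> points M \<Longrightarrow> \<eta> p (\<xi> p) = 1"
    and reeb: "\<And>W X p. openin (mtop M) W \<Longrightarrow> vfield M W X \<Longrightarrow> p \<in> W \<Longrightarrow> dform M \<eta> \<xi> X p = 0"
    and f: "tensor11 M f"
    and ff: "\<And>p v. p \<in> points M \<Longrightarrow> f p (f p v) = v - \<eta> p v *\<^sub>R \<xi> p"
    and normal: "\<And>W X Y p. openin (mtop M) W \<Longrightarrow> vfield M W X \<Longrightarrow> vfield M W Y \<Longrightarrow> p \<in> W \<Longrightarrow>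
        nijenhuis M f X Y p = (2 * dform M \<eta> X Y p) *\<^sub>R \<xi> p"
begin

lemma lin_f: "p \<in> points M \<Longrightarrow> linear (f p)"
  using f by (simp add: tensor11_def)

lemma lin_eta: "p \<in> points M \<Longrightarrow> linear (\<eta> p)"
  using eta by (simp add: one_form_def)

lemma f_simps:
  assumes "p \<in> points M"
  shows "f p (v + w) = f p v + f p w" "f p (v - w) = f p v - f p w" "f p (r *\<^sub>R v) = r *\<^sub>R f p v"
    "f p (- v) = - f p v" "f p 0 = 0"
  using lin_f[OF assms] by (simp_all add: linear_add linear_diff linear_cmul linear_neg linear_0)

lemma eta_simps:
  assumes "p \<in> points M"
  shows "\<eta> p (v + w) = \<eta> p v + \<eta> p w" "\<eta> p (v - w) = \<eta> p v - \<eta> p w" "\<eta> p (r *\<^sub>R v) = r * \<eta> p v"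
    "\<eta> p (- v) = - \<eta> p v" "\<eta> p 0 = 0"
  using lin_eta[OF assms] by (simp_all add: linear_add linear_diff linear_cmul linear_neg linear_0)

lemma f_kernel:
  assumes "p \<in> points M" "f p w = 0" shows "w = \<eta> p w *\<^sub>R \<xi> p"
  using ff[OF assms(1), of w] assms f_simps(5) by simp

lemma f_xi: assumes p: "p \<in> points M" shows "f p (\<xi> p) = 0"
proof -
  have 0: "f p (f p (\<xi> p)) = 0" using ff[OF p] eta_xi[OF p] by simp
  then have 1: "f p (\<xi> p) = \<eta> p (f p (\<xi> p)) *\<^sub>R \<xi> p" using f_kernel[OF p] by simp
  then have "f p (f p (\<xi> p)) = \<eta> p (f p (\<xi> p)) *\<^sub>R f p (\<xi> p)" using f_simps(3)[OF p] by metis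
  then have "\<eta> p (f p (\<xi> p)) = 0 \<or> f p (\<xi> p) = 0" using 0 by simp
  then show ?thesis using 1 by auto
qed

lemma eta_f: assumes p: "p \<in> points M" shows "\<eta> p (f p v) = 0"
proof -
  have "f p (f p (f p v)) = f p v" using ff[OF p, of v] by (simp add: f_simps[OF p] f_xi[OF p])
  then have "\<eta> p (f p v) *\<^sub>R \<xi> p = 0" using ff[OF p, of "f p v"] by simp
  moreover have "\<xi> p \<noteq> 0" using eta_xi[OF p] eta_simps(5)[OF p] by auto
  ultimately show ?thesis by simp
qed

lemma vfield_xi: "openin (mtop M) W \<Longrightarrow> vfield M W \<xi>"
  using vfield_subset[OF xi] openin_subset by blast

lemma vfield_f: "openin (mtop M) W \<Longrightarrow> vfield M W X \<Longrightarrow> vfield M W (\<lambda>q. f q (X q))"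
  using f by (simp add: tensor11_def)

lemma smooth_eta: "openin (mtop M) W \<Longrightarrow> vfield M W X \<Longrightarrow> smooth_fun M W (\<lambda>q. \<eta> q (X q))"
  using eta by (simp add: one_form_def)

lemma eta_bracket_xi:
  assumes "openin (mtop M) W" "vfield M W X" "p \<in> W"
  shows "\<eta> p (bracket M \<xi> X p) = dfun M (\<lambda>q. \<eta> q (X q)) p (\<xi> p)"
  using reeb[OF assms] two_dform[of \<eta> \<xi> X p] dfun_zero_on[OF assms(1,3), of "\<lambda>q. \<eta> q (\<xi> q)" 1]
    eta_xi open_in_points[OF assms(1)] by simp

text \<open>Normality for the arguments \<open>\<xi>\<close> and \<open>X\<close> reads \<open>f (f [\<xi>,X] - [\<xi>,f X]) = 0\<close>, as \<open>f \<xi> = 0\<close>. The kernel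
  of \<open>f\<close> is spanned by \<open>\<xi>\<close>, and \<open>\<eta>\<close> vanishes on both terms because \<open>d\<eta> (\<xi>, \<cdot>) = 0\<close>.\<close>

lemma xi_bracket_f:
  assumes W: "openin (mtop M) W" "vfield M W X" "p \<in> W"
  shows "bracket M \<xi> (\<lambda>q. f q (X q)) p = f p (bracket M \<xi> X p)"
proof -
  have p: "p \<in> points M" using open_in_points W by blast
  have fxi: "f q (\<xi> q) = 0" if "q \<in> W" for q using f_xi open_in_points[OF W(1) that] by blast
  note vX = vfield_f[OF W(1,2)]
  have "nijenhuis M f \<xi> X p = 0" using normal[OF W(1) vfield_xi[OF W(1)] W(2,3)] reeb[OF W] by simp
  then have "f p (f p (bracket M \<xi> X p) - bracket M \<xi> (\<lambda>q. f q (X q)) p) = 0"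
    using bracket_zero_left[OF W(1,3) fxi vX] bracket_zero_left[OF W(1,3) fxi W(2)] f_simps[OF p]
    by (simp add: nijenhuis_def)
  from f_kernel[OF p this]
  have "f p (bracket M \<xi> X p) - bracket M \<xi> (\<lambda>q. f q (X q)) p = - \<eta> p (bracket M \<xi> (\<lambda>q. f q (X q)) p) *\<^sub>R \<xi> p"
    by (simp add: eta_simps[OF p] eta_f[OF p])
  also have "\<eta> p (bracket M \<xi> (\<lambda>q. f q (X q)) p) = 0"
    using eta_bracket_xi[OF W(1) vX W(3)] dfun_zero_on[OF W(1,3), of "\<lambda>q. \<eta> q (f q (X q))" 0] eta_f open_in_points[OF W(1)]
    by simp
  finally show ?thesis by simp
qed

text \<open>For sections \<open>X\<close>, \<open>Y\<close> of an eigendistribution with eigenvalue \<open>s\<close> and \<open>B = [X,Y]\<close>, one has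
  \<open>2 d\<eta> (X,Y) = - \<eta>(B)\<close>, and the normality equation becomes \<open>2 B - 2 s f B = 0\<close>.\<close>

lemma eigen_bracket:
  assumes W: "openin (mtop M) W" "vfield M W X" "vfield M W Y" "p \<in> W" and s: "s * s = 1"
    and eX: "\<And>q. q \<in> W \<Longrightarrow> f q (X q) = s *\<^sub>R X q" and eY: "\<And>q. q \<in> W \<Longrightarrow> f q (Y q) = s *\<^sub>R Y q"
  shows "f p (bracket M X Y p) = s *\<^sub>R bracket M X Y p"
proof -
  have p: "p \<in> points M" using open_in_points W by blast
  let ?B = "bracket M X Y p"
  have e0: "\<eta> q (Z q) = 0" if "q \<in> W" "f q (Z q) = s *\<^sub>R Z q" for q and Z :: "'a \<Rightarrow> 'e"
    using eta_f[OF open_in_points[OF W(1) that(1)], of "Z q"] that s eta_simps(3)[OF open_in_points[OF W(1) that(1)]] by auto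
  have dX: "dfun M (\<lambda>q. \<eta> q (X q)) p v = 0" for v by (rule dfun_zero_on[OF W(1,4)]) (use e0 eX in auto)
  have dY: "dfun M (\<lambda>q. \<eta> q (Y q)) p v = 0" for v by (rule dfun_zero_on[OF W(1,4)]) (use e0 eY in auto)
  have d: "2 * dform M \<eta> X Y p = - \<eta> p ?B" using dX dY by (simp add: two_dform)
  have b1: "bracket M (\<lambda>q. f q (X q)) (\<lambda>q. f q (Y q)) p = ?B"
  proof -
    have "bracket M (\<lambda>q. f q (X q)) (\<lambda>q. f q (Y q)) p = bracket M (\<lambda>q. s *\<^sub>R X q) (\<lambda>q. s *\<^sub>R Y q) p"
      by (rule bracket_cong[OF W(1,4)]) (use eX eY in auto)
    then show ?thesis
      using bracket_cmul_left[OF W(1,4,2) vfield_cmul[OF W(1,3)], of s s] bracket_cmul_right[OF W(1,4,3,2), of s] s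
      by simp
  qed
  have b2: "bracket M (\<lambda>q. f q (X q)) Y p = s *\<^sub>R ?B"
  proof -
    have "bracket M (\<lambda>q. f q (X q)) Y p = bracket M (\<lambda>q. s *\<^sub>R X q) Y p"
      by (rule bracket_cong[OF W(1,4)]) (simp_all add: eX)
    then show ?thesis using bracket_cmul_left[OF W(1,4,2,3)] by simp
  qed
  have b3: "bracket M X (\<lambda>q. f q (Y q)) p = s *\<^sub>R ?B"
  proof -
    have "bracket M X (\<lambda>q. f q (Y q)) p = bracket M X (\<lambda>q. s *\<^sub>R Y q) p"
      by (rule bracket_cong[OF W(1,4)]) (simp_all add: eY)
    then show ?thesis using bracket_cmul_right[OF W(1,4,3,2)] by simp
  qed
  have "nijenhuis M f X Y p = (- \<eta> p ?B) *\<^sub>R \<xi> p" using normal[OF W] d by simp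
  then have "(?B - s *\<^sub>R f p ?B) + (?B - s *\<^sub>R f p ?B) = 0"
    unfolding nijenhuis_def b1 b2 b3 ff[OF p] f_simps(3)[OF p] by (simp add: algebra_simps)
  then have "2 *\<^sub>R (?B - s *\<^sub>R f p ?B) = 0" by (simp only: scaleR_2)
  then have "?B = s *\<^sub>R f p ?B" by simp
  then show ?thesis using s by (metis scaleR_scaleR scaleR_one)
qed

end

lemma normal_structure_minus:
  assumes "normal_structure M \<eta> \<xi> f" shows "normal_structure M \<eta> \<xi> (\<lambda>p v. - f p v)"
proof -
  interpret normal_structure M \<eta> \<xi> f by fact
  show ?thesis
  proof
    show "one_form M \<eta>" "vfield M (points M) \<xi>" by (fact eta xi)+
    show "\<eta> p (\<xi> p) = 1" if "p \<in> points M" for p by (rule eta_xi[OF that])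
    show "dform M \<eta> \<xi> X p = 0" if "openin (mtop M) W" "vfield M W X" "p \<in> W" for W X p by (rule reeb[OF that])
    have neg: "vfield M W (\<lambda>q. - f q (X q))" if "openin (mtop M) W" "vfield M W X" for W X
      using vfield_cmul[OF that(1) vfield_f[OF that], of "-1"] by simp
    then show "tensor11 M (\<lambda>p v. - f p v)" by (simp add: tensor11_def linear_compose_neg lin_f)
    show "- f p (- f p v) = v - \<eta> p v *\<^sub>R \<xi> p" if "p \<in> points M" for p v
      using ff[OF that] f_simps(4)[OF that] by simp
    show "nijenhuis M (\<lambda>p v. - f p v) X Y p = (2 * dform M \<eta> X Y p) *\<^sub>R \<xi> p"
      if W: "openin (mtop M) W" "vfield M W X" "vfield M W Y" "p \<in> W" for W X Y p
    proof -
      have p: "p \<in> points M" using open_in_points W by blast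
      note v = vfield_f[OF W(1,2)] vfield_f[OF W(1,3)]
      have "bracket M (\<lambda>q. - f q (X q)) Z p = - bracket M (\<lambda>q. f q (X q)) Z p" if "vfield M W Z" for Z
        using bracket_cmul_left[OF W(1,4) v(1) that, of "-1"] by simp
      moreover have "bracket M Z (\<lambda>q. - f q (Y q)) p = - bracket M Z (\<lambda>q. f q (Y q)) p" if "vfield M W Z" for Z
        using bracket_cmul_right[OF W(1,4) v(2) that, of "-1"] by simp
      ultimately have "nijenhuis M (\<lambda>p v. - f p v) X Y p = nijenhuis M f X Y p"
        using neg[OF W(1,2)] neg[OF W(1,3)] W(2,3) v by (simp add: nijenhuis_def f_simps[OF p])
      then show ?thesis using normal[OF W] by simp
    qed
  qed
qed

section \<open>Two anticommuting structure tensors\<close>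

lemma eq_minus_self:
  fixes v :: "'e::real_vector"
  assumes "v = - v" shows "v = 0"
proof -
  have "v + v = 0" using assms by (metis add.right_inverse)
  then have "2 *\<^sub>R v = 0" by (simp only: scaleR_2)
  then show ?thesis by simp
qed

locale normal_pair = smooth_mfd M + F: normal_structure M \<eta> \<xi> f + G: normal_structure M \<eta> \<xi> g
  for M :: "('a, 'e::euclidean_space) mfd" and \<eta> \<xi> f g +
  assumes anti: "\<And>p v. p \<in> points M \<Longrightarrow> f p (g p v) = - g p (f p v)"
begin

text \<open>The projections onto the eigendistributions of \<open>f\<close> for \<open>1\<close> and \<open>-1\<close>, which together with \<open>\<xi>\<close>
  decompose the tangent spaces.\<close>

definition P :: "'a \<Rightarrow> 'e \<Rightarrow> 'e" where "P p v = (1/2) *\<^sub>R (v - \<eta> p v *\<^sub>R \<xi> p + f p v)"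
definition Q :: "'a \<Rightarrow> 'e \<Rightarrow> 'e" where "Q p v = (1/2) *\<^sub>R (v - \<eta> p v *\<^sub>R \<xi> p - f p v)"

lemma decomp: "v = P p v + Q p v + \<eta> p v *\<^sub>R \<xi> p"
  by (simp add: P_def Q_def algebra_simps scaleR_left_distrib[symmetric])

lemma proj_simps:
  assumes p: "p \<in> points M"
  shows "f p (P p v) = P p v" "f p (Q p v) = - Q p v" "P p (f p v) = P p v" "Q p (f p v) = - Q p v"
    "P p (P p v) = P p v" "Q p (Q p v) = Q p v" "P p (Q p v) = 0" "Q p (P p v) = 0"
    "\<eta> p (P p v) = 0" "\<eta> p (Q p v) = 0" "P p (\<xi> p) = 0" "Q p (\<xi> p) = 0"
    "P p (g p v) = g p (Q p v)" "Q p (g p v) = g p (P p v)" "g p (g p (P p v)) = P p v" "g p (g p (Q p v)) = Q p v"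
proof -
  note s = F.f_simps[OF p] G.f_simps[OF p] F.eta_simps[OF p] F.ff[OF p] G.ff[OF p] F.f_xi[OF p] G.f_xi[OF p]
      F.eta_f[OF p] G.eta_f[OF p] F.eta_xi[OF p] anti[OF p] scaleR_right_distrib scaleR_diff_right
  show f: "f p (P p v) = P p v" "f p (Q p v) = - Q p v" for v by (simp_all add: P_def Q_def s)
  show e: "\<eta> p (P p v) = 0" "\<eta> p (Q p v) = 0" for v by (simp_all add: P_def Q_def s)
  show "P p (P p v) = P p v" "Q p (P p v) = 0" using f(1)[of v] e(1)[of v] by (simp_all add: P_def[of p "P p v"] Q_def[of p "P p v"])
  show "Q p (Q p v) = Q p v" "P p (Q p v) = 0" using f(2)[of v] e(2)[of v] by (simp_all add: P_def[of p "Q p v"] Q_def[of p "Q p v"])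
  show "P p (f p v) = P p v" "Q p (f p v) = - Q p v" "P p (\<xi> p) = 0" "Q p (\<xi> p) = 0"
    "P p (g p v) = g p (Q p v)" "Q p (g p v) = g p (P p v)" by (simp_all add: P_def Q_def s)
  show "g p (g p (P p v)) = P p v" "g p (g p (Q p v)) = Q p v" using e by (simp_all add: G.ff[OF p])
qed

lemma proj_linear:
  assumes p: "p \<in> points M"
  shows "linear (P p)" "linear (Q p)"
  unfolding P_def Q_def
  by (auto intro!: linearI simp: F.f_simps[OF p] F.eta_simps[OF p] algebra_simps add_divide_distrib)

lemma proj_lin_simps:
  assumes "p \<in> points M"
  shows "P p (v + w) = P p v + P p w" "P p (v - w) = P p v - P p w" "P p (r *\<^sub>R v) = r *\<^sub>R P p v"
    "P p (- v) = - P p v" "P p 0 = 0"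
    "Q p (v + w) = Q p v + Q p w" "Q p (v - w) = Q p v - Q p w" "Q p (r *\<^sub>R v) = r *\<^sub>R Q p v"
    "Q p (- v) = - Q p v" "Q p 0 = 0"
  using proj_linear[OF assms] by (simp_all add: linear_add linear_diff linear_cmul linear_neg linear_0)

lemma vfield_proj:
  assumes W: "openin (mtop M) W" and X: "vfield M W X"
  shows "vfield M W (\<lambda>q. P q (X q))" "vfield M W (\<lambda>q. Q q (X q))"
  unfolding P_def Q_def
  by (intro vfield_cmul[OF W] vfield_add[OF W] vfield_diff[OF W] vfield_scaleR[OF W] X F.smooth_eta[OF W] F.vfield_xi[OF W] F.vfield_f[OF W])+

lemma eigen_iff_P: "p \<in> points M \<Longrightarrow> f p v = v \<longleftrightarrow> P p v = v"
  and eigen_iff_Q: "p \<in> points M \<Longrightarrow> f p v = - v \<longleftrightarrow> Q p v = v"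
proof -
  assume p: "p \<in> points M"
  show "f p v = v \<longleftrightarrow> P p v = v"
  proof
    assume a: "f p v = v"
    then have "\<eta> p v = 0" using F.eta_f[OF p, of v] by simp
    then show "P p v = v" using a by (simp add: P_def)
  qed (metis proj_simps(1) p)
  show "f p v = - v \<longleftrightarrow> Q p v = v"
  proof
    assume a: "f p v = - v"
    then have "\<eta> p v = 0" using F.eta_f[OF p, of v] F.eta_simps(4)[OF p, of v] by simp
    then show "Q p v = v" using a by (simp add: Q_def)
  qed (metis proj_simps(2) p)
qed

lemma proj_bracket_eigen:
  assumes W: "openin (mtop M) W" "vfield M W X" "vfield M W Y" "p \<in> W"
  shows "P p (bracket M (\<lambda>q. P q (X q)) (\<lambda>q. P q (Y q)) p) = bracket M (\<lambda>q. P q (X q)) (\<lambda>q. P q (Y q)) p"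
    "Q p (bracket M (\<lambda>q. P q (X q)) (\<lambda>q. P q (Y q)) p) = 0"
    "Q p (bracket M (\<lambda>q. Q q (X q)) (\<lambda>q. Q q (Y q)) p) = bracket M (\<lambda>q. Q q (X q)) (\<lambda>q. Q q (Y q)) p"
    "P p (bracket M (\<lambda>q. Q q (X q)) (\<lambda>q. Q q (Y q)) p) = 0"
proof -
  note p = open_in_points[OF W(1)]
  have 1: "f p (bracket M (\<lambda>q. P q (X q)) (\<lambda>q. P q (Y q)) p) = bracket M (\<lambda>q. P q (X q)) (\<lambda>q. P q (Y q)) p"
    using F.eigen_bracket[OF W(1) vfield_proj(1)[OF W(1,2)] vfield_proj(1)[OF W(1,3)] W(4), of 1] proj_simps(1)[OF p] by simp
  have 2: "f p (bracket M (\<lambda>q. Q q (X q)) (\<lambda>q. Q q (Y q)) p) = - bracket M (\<lambda>q. Q q (X q)) (\<lambda>q. Q q (Y q)) p"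
    using F.eigen_bracket[OF W(1) vfield_proj(2)[OF W(1,2)] vfield_proj(2)[OF W(1,3)] W(4), of "-1"] proj_simps(2)[OF p] by simp
  show a: "P p (bracket M (\<lambda>q. P q (X q)) (\<lambda>q. P q (Y q)) p) = bracket M (\<lambda>q. P q (X q)) (\<lambda>q. P q (Y q)) p"
    using 1 eigen_iff_P[OF p[OF W(4)]] by blast
  show b: "Q p (bracket M (\<lambda>q. Q q (X q)) (\<lambda>q. Q q (Y q)) p) = bracket M (\<lambda>q. Q q (X q)) (\<lambda>q. Q q (Y q)) p"
    using 2 eigen_iff_Q[OF p[OF W(4)]] by blast
  show "Q p (bracket M (\<lambda>q. P q (X q)) (\<lambda>q. P q (Y q)) p) = 0"
    using proj_simps(8)[OF p[OF W(4)]] a by metis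
  show "P p (bracket M (\<lambda>q. Q q (X q)) (\<lambda>q. Q q (Y q)) p) = 0"
    using proj_simps(7)[OF p[OF W(4)]] b by metis
qed

lemma xi_bracket_P:
  assumes W: "openin (mtop M) W" "vfield M W X" "p \<in> W"
  shows "bracket M \<xi> (\<lambda>q. P q (X q)) p = P p (bracket M \<xi> X p)"
    and "bracket M \<xi> (\<lambda>q. Q q (X q)) p = Q p (bracket M \<xi> X p)"
proof -
  note v = W(2) F.vfield_xi[OF W(1)] F.vfield_f[OF W(1,2)] F.smooth_eta[OF W(1,2)]
  note ve = vfield_scaleR[OF W(1) v(4,2)]
  have p: "p \<in> points M" using open_in_points W by blast
  have xx: "bracket M \<xi> \<xi> p = 0" using bracket_antisym[of \<xi> \<xi> p] by (simp add: eq_neg_iff_add_eq_0 scaleR_2[symmetric])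
  have e: "bracket M \<xi> (\<lambda>q. \<eta> q (X q) *\<^sub>R \<xi> q) p = \<eta> p (bracket M \<xi> X p) *\<^sub>R \<xi> p"
    using bracket_scaleR_right[OF W(1,3) v(2,2,4)] xx F.eta_bracket_xi[OF W] by simp
  note s = bracket_cmul_right[OF W(1,3) _ v(2), of _ "1/2"]
    bracket_add_right[OF W(1,3) _ _ v(2)] bracket_diff_right[OF W(1,3) _ _ v(2)]
  note vv = vfield_diff[OF W(1) v(1) ve]
  show "bracket M \<xi> (\<lambda>q. P q (X q)) p = P p (bracket M \<xi> X p)"
    unfolding P_def using s(1)[OF vfield_add[OF W(1) vv v(3)]] s(2)[OF vv v(3)] s(3)[OF v(1) ve] e F.xi_bracket_f[OF W]
    by simp
  show "bracket M \<xi> (\<lambda>q. Q q (X q)) p = Q p (bracket M \<xi> X p)"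
    unfolding Q_def using s(1)[OF vfield_diff[OF W(1) vv v(3)]] s(3)[OF vv v(3)] s(3)[OF v(1) ve] e F.xi_bracket_f[OF W]
    by simp
qed

text \<open>Normality of \<open>g\<close> for two sections of the \<open>+1\<close> eigendistribution of \<open>f\<close>, projected back onto it.
  The term \<open>[g X, g Y]\<close> disappears because \<open>g\<close> maps into the other eigendistribution, which is
  involutive. This is where the two structures interact; it makes the connection below symmetric
  along the foliation.\<close>

lemma bracket_eigen_via_g:
  assumes W: "openin (mtop M) W" "vfield M W X" "vfield M W Y" "p \<in> W"
  shows "bracket M (\<lambda>q. P q (X q)) (\<lambda>q. P q (Y q)) p =
    g p (Q p (bracket M (\<lambda>q. P q (X q)) (\<lambda>q. Q q (g q (Y q))) p))
    - g p (Q p (bracket M (\<lambda>q. P q (Y q)) (\<lambda>q. Q q (g q (X q))) p))"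
proof -
  note q = open_in_points[OF W(1)]
  note p = q[OF W(4)]
  let ?X = "\<lambda>q. P q (X q)" and ?Y = "\<lambda>q. P q (Y q)"
  let ?B = "bracket M ?X ?Y p"
  note v = vfield_proj(1)[OF W(1,2)] vfield_proj(1)[OF W(1,3)]
  have gX: "g q (P q (Z q)) = Q q (g q (Z q))" if "q \<in> W" for q Z using proj_simps(14)[OF q[OF that]] by simp
  have d0: "dfun M (\<lambda>q. \<eta> q (P q (Z q))) p u = 0" for Z u
    by (rule dfun_zero_on[OF W(1,4)]) (use proj_simps(9)[OF q] in auto)
  have eB: "\<eta> p ?B = 0" using proj_simps(9)[OF p] proj_bracket_eigen(1)[OF W] by metis
  have N: "nijenhuis M g ?X ?Y p = 0"
    using G.normal[OF W(1) v W(4)] d0 eB by (simp add: two_dform)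
  have b1: "bracket M (\<lambda>q. g q (?X q)) (\<lambda>q. g q (?Y q)) p = bracket M (\<lambda>q. Q q (g q (X q))) (\<lambda>q. Q q (g q (Y q))) p"
    by (rule bracket_cong[OF W(1,4)]) (use gX in auto)
  have b2: "bracket M (\<lambda>q. g q (?X q)) ?Y p = - bracket M ?Y (\<lambda>q. Q q (g q (X q))) p"
  proof -
    have "bracket M (\<lambda>q. g q (?X q)) ?Y p = bracket M (\<lambda>q. Q q (g q (X q))) ?Y p"
      by (rule bracket_cong[OF W(1,4)]) (simp_all add: gX)
    then show ?thesis using bracket_antisym[of "\<lambda>q. Q q (g q (X q))" ?Y p] by simp
  qed
  have b3: "bracket M ?X (\<lambda>q. g q (?Y q)) p = bracket M ?X (\<lambda>q. Q q (g q (Y q))) p"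
    by (rule bracket_cong[OF W(1,4)]) (simp_all add: gX)
  have "P p (nijenhuis M g ?X ?Y p) = ?B + 0 + g p (Q p (bracket M ?Y (\<lambda>q. Q q (g q (X q))) p)) - g p (Q p (bracket M ?X (\<lambda>q. Q q (g q (Y q))) p))"
    unfolding nijenhuis_def b1 b2 b3 proj_lin_simps[OF p]
    using proj_bracket_eigen(4)[OF W(1) G.vfield_f[OF W(1,2)] G.vfield_f[OF W(1,3)] W(4)] proj_bracket_eigen(1)[OF W]
    by (simp add: proj_simps(13)[OF p] G.ff[OF p] eB proj_lin_simps[OF p] G.f_simps[OF p])
  then show ?thesis using N proj_lin_simps(5)[OF p] by (simp add: algebra_simps add_eq_0_iff)
qed

text \<open>Decompose both fields. The bracket of the two \<open>Q\<close> components and those of the \<open>Q\<close> components with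
  \<open>\<xi>\<close> remain in the \<open>-1\<close> eigendistribution and are killed by \<open>P\<close>.\<close>

lemma P_bracket:
  assumes W: "openin (mtop M) W" "vfield M W X" "vfield M W Y" "p \<in> W"
  shows "P p (bracket M X Y p) = bracket M (\<lambda>q. P q (X q)) (\<lambda>q. P q (Y q)) p
    + P p (bracket M (\<lambda>q. P q (X q)) (\<lambda>q. Q q (Y q)) p) + P p (bracket M (\<lambda>q. Q q (X q)) (\<lambda>q. P q (Y q)) p)
    + \<eta> p (X p) *\<^sub>R P p (bracket M \<xi> Y p) - \<eta> p (Y p) *\<^sub>R P p (bracket M \<xi> X p)"
proof -
  note p = open_in_points[OF W(1,4)]
  note xi = F.vfield_xi[OF W(1)]
  let ?B = "bracket M"
  let ?H = "\<lambda>X q. \<eta> q (X q) *\<^sub>R \<xi> q" and ?P = "\<lambda>X q. P q (X q)" and ?Q = "\<lambda>X q. Q q (X q)"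
  have H: "vfield M W (?H Z)" if "vfield M W Z" for Z using vfield_scaleR[OF W(1) F.smooth_eta[OF W(1) that] xi] .
  have D: "vfield M W (\<lambda>q. ?P Z q + ?Q Z q)" if "vfield M W Z" for Z by (intro vfield_add[OF W(1)] vfield_proj[OF W(1) that])
  have split: "?B Z X' p = ?B (?P Z) X' p + ?B (?Q Z) X' p + ?B (?H Z) X' p" if Z: "vfield M W Z" and X': "vfield M W X'" for Z X'
  proof -
    have "?B Z X' p = ?B (\<lambda>q. ?P Z q + ?Q Z q + ?H Z q) X' p"
      by (rule bracket_cong[OF W(1,4)]) (use decomp in auto)
    then show ?thesis
      using bracket_add_left[OF W(1,4) D[OF Z] H[OF Z] X'] bracket_add_left[OF W(1,4) vfield_proj(1)[OF W(1) Z] vfield_proj(2)[OF W(1) Z] X']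
      by simp
  qed
  have xiP: "P p (?B (?H Z) X' p) = \<eta> p (Z p) *\<^sub>R P p (?B \<xi> X' p)" if Z: "vfield M W Z" and X': "vfield M W X'" for Z X'
    using bracket_scaleR_left[OF W(1,4) xi X' F.smooth_eta[OF W(1) Z]] by (simp add: proj_lin_simps[OF p] proj_simps[OF p])
  have xiP': "P p (?B X' (?H Z) p) = - (\<eta> p (Z p) *\<^sub>R P p (?B \<xi> X' p))" if Z: "vfield M W Z" and X': "vfield M W X'" for Z X'
    using xiP[OF that] bracket_antisym[of X' "?H Z" p] by (simp add: proj_lin_simps[OF p])
  have split': "?B X' Z p = ?B X' (?P Z) p + ?B X' (?Q Z) p + ?B X' (?H Z) p" if Z: "vfield M W Z" and X': "vfield M W X'" for Z X'
    using split[OF that] bracket_antisym[of X' Z p] bracket_antisym[of X' "?P Z" p] bracket_antisym[of X' "?Q Z" p] bracket_antisym[of X' "?H Z" p]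
    by simp
  note XP = vfield_proj(1)[OF W(1,2)] and XQ = vfield_proj(2)[OF W(1,2)]
  have "P p (?B X Y p) = P p (?B (?P X) Y p) + P p (?B (?Q X) Y p) + \<eta> p (X p) *\<^sub>R P p (?B \<xi> Y p)"
    using split[OF W(2,3)] xiP[OF W(2,3)] by (simp add: proj_lin_simps[OF p])
  moreover have "P p (?B (?P X) Y p) = ?B (?P X) (?P Y) p + P p (?B (?P X) (?Q Y) p) - \<eta> p (Y p) *\<^sub>R P p (?B \<xi> X p)"
    using split'[OF W(3) XP] xiP'[OF W(3) XP] proj_bracket_eigen(1)[OF W] xi_bracket_P(1)[OF W(1,2,4)]
    by (simp add: proj_lin_simps[OF p] proj_simps[OF p])
  moreover have "P p (?B (?Q X) Y p) = P p (?B (?Q X) (?P Y) p)"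
    using split'[OF W(3) XQ] xiP'[OF W(3) XQ] proj_bracket_eigen(4)[OF W] xi_bracket_P(2)[OF W(1,2,4)]
    by (simp add: proj_lin_simps[OF p] proj_simps[OF p])
  ultimately show ?thesis by simp
qed

end

lemma normal_pair_minus:
  assumes "normal_pair M \<eta> \<xi> f g" shows "normal_pair M \<eta> \<xi> (\<lambda>p v. - f p v) g"
proof -
  interpret normal_pair M \<eta> \<xi> f g by fact
  interpret neg: normal_structure M \<eta> \<xi> "\<lambda>p v. - f p v" by (rule normal_structure_minus[OF F.normal_structure_axioms])
  show ?thesis by unfold_locales (simp add: anti G.f_simps)
qed

lemma normal_pair_swap:
  assumes "normal_pair M \<eta> \<xi> f g" shows "normal_pair M \<eta> \<xi> g f"
proof -
  interpret normal_pair M \<eta> \<xi> f g by fact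
  show ?thesis by unfold_locales (simp add: anti)
qed

context normal_pair
begin

text \<open>Statements about the second eigendistribution are obtained as instances for the pair \<open>(-f, g)\<close>.\<close>

lemma minus_proj:
  shows "normal_pair.P \<eta> \<xi> (\<lambda>p v. - f p v) = Q" "normal_pair.Q \<eta> \<xi> (\<lambda>p v. - f p v) = P"
proof -
  interpret neg: normal_pair M \<eta> \<xi> "\<lambda>p v. - f p v" g by (rule normal_pair_minus[OF normal_pair_axioms])
  show "neg.P = Q" "neg.Q = P" by (simp_all add: fun_eq_iff neg.P_def neg.Q_def P_def Q_def)
qed

lemmas bracket_coeigen_via_g = normal_pair.bracket_eigen_via_g[OF normal_pair_minus[OF normal_pair_axioms], unfolded minus_proj]
lemmas Q_bracket = normal_pair.P_bracket[OF normal_pair_minus[OF normal_pair_axioms], unfolded minus_proj]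

end

section \<open>Tensoriality\<close>

context smooth_mfd
begin

lemma coord_function_smooth:
  assumes W: "openin (mtop M) W" and X: "vfield M W X" and c: "c \<in> charts M" "W \<subseteq> fst c"
  shows "smooth_fun M W (\<lambda>q. tcoord M c q (X q) \<bullet> b)"
proof (rule smooth_fun_cong[OF W _ smooth_fun_in_chart[OF W c]])
  have "smooth_on (snd c ` W) (vf_rep M c X)"
    by (rule smooth_on_subset[OF vfieldD[OF X c(1)]]) (use c(2) in blast)
  moreover have "open (snd c ` W)" using chart_image_open[OF c(1) W] c(2) by (simp add: Int_absorb1)
  ultimately show "smooth_on (snd c ` W) (\<lambda>z. vf_rep M c X z \<bullet> b)"
    using smooth_on_bounded_linear[OF bounded_linear_inner_left] by blast
qed (use vf_rep_at[OF c(1)] c(2) in auto)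

lemma local_frame:
  assumes p: "p \<in> points M" and q: "q \<in> fst (chart_at M p)"
  shows "v = (\<Sum>b\<in>Basis. (tcoord M (chart_at M p) q v \<bullet> b) *\<^sub>R const_field M p b q)"
proof -
  let ?c = "chart_at M p"
  have c: "?c \<in> charts M" using chart_at[OF p] by blast
  interpret T: linear "tcoord M ?c q" by (rule tcoord_linear[OF c q])
  have "tcoord M ?c q (const_field M p b q) = b" for b
    using tcoord_chart_field[OF c q c q] tr_self[OF c q] by (simp add: const_field_eq)
  then have "tcoord M ?c q (\<Sum>b\<in>Basis. (tcoord M ?c q v \<bullet> b) *\<^sub>R const_field M p b q) = tcoord M ?c q v"
    by (simp add: T.sum T.scale euclidean_representation)
  then show ?thesis using tcoord_inj[OF c q] by metis
qed

text \<open>Expand the field in a coordinate frame near \<open>p\<close> and use linearity over functions.\<close>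

lemma tensorial_at:
  fixes K :: "('a \<Rightarrow> 'e) \<Rightarrow> 'b::real_vector"
  assumes add: "\<And>W X Y. openin (mtop M) W \<Longrightarrow> p \<in> W \<Longrightarrow> W \<subseteq> W0 \<Longrightarrow> vfield M W X \<Longrightarrow> vfield M W Y \<Longrightarrow>
      K (\<lambda>q. X q + Y q) = K X + K Y"
    and scale: "\<And>W X h. openin (mtop M) W \<Longrightarrow> p \<in> W \<Longrightarrow> W \<subseteq> W0 \<Longrightarrow> vfield M W X \<Longrightarrow> smooth_fun M W h \<Longrightarrow>
      K (\<lambda>q. h q *\<^sub>R X q) = h p *\<^sub>R K X"
    and cong: "\<And>W X Y. openin (mtop M) W \<Longrightarrow> p \<in> W \<Longrightarrow> W \<subseteq> W0 \<Longrightarrow> vfield M W X \<Longrightarrow> (\<And>q. q \<in> W \<Longrightarrow> X q = Y q) \<Longrightarrow> K X = K Y"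
    and W: "openin (mtop M) W0" "p \<in> W0" and X: "vfield M W0 X"
  shows "K X = (\<Sum>b\<in>Basis. (X p \<bullet> b) *\<^sub>R K (const_field M p b))"
proof -
  have p: "p \<in> points M" using open_in_points[OF W] .
  let ?c = "chart_at M p"
  have c: "?c \<in> charts M" "p \<in> fst ?c" using chart_at[OF p] by auto
  define W' where "W' = W0 \<inter> fst ?c"
  have W': "openin (mtop M) W'" "p \<in> W'" "W' \<subseteq> W0" "W' \<subseteq> fst ?c"
    using W c chart_dom[OF c(1)] by (auto simp: W'_def)
  have X': "vfield M W' X" using vfield_subset[OF X W'(3)] .
  let ?h = "\<lambda>b q. tcoord M ?c q (X q) \<bullet> b"
  have E: "vfield M W' (const_field M p b)" for b using vfield_subset[OF vfield_const_field[OF p] W'(4)] .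
  have h: "smooth_fun M W' (?h b)" for b using coord_function_smooth[OF W'(1) X' c(1) W'(4)] .
  have sum: "K (\<lambda>q. \<Sum>b\<in>B. ?h b q *\<^sub>R const_field M p b q) = (\<Sum>b\<in>B. ?h b p *\<^sub>R K (const_field M p b))"
    if "finite B" "B \<noteq> {}" for B
    using that
  proof (induction B rule: finite_ne_induct)
    case (singleton b)
    then show ?case using scale[OF W'(1-3) E h] by simp
  next
    case (insert b B)
    have hE: "vfield M W' (\<lambda>q. ?h b q *\<^sub>R const_field M p b q)" for b by (rule vfield_scaleR[OF W'(1) h E])
    have "vfield M W' (\<lambda>q. \<Sum>b\<in>B. ?h b q *\<^sub>R const_field M p b q)"
      by (rule vfield_sum[OF W'(1) hE insert.hyps(1,2)])
    from add[OF W'(1-3) hE[of b] this] scale[OF W'(1-3) E h] show ?case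
      using insert by simp
  qed
  have "K X = K (\<lambda>q. \<Sum>b\<in>Basis. ?h b q *\<^sub>R const_field M p b q)"
    by (rule cong[OF W'(1-3) X']) (use local_frame[OF p] W'(4) in blast)
  also have "\<dots> = (\<Sum>b\<in>Basis. ?h b p *\<^sub>R K (const_field M p b))" by (rule sum) auto
  finally show ?thesis using tcoord_at[OF p] by simp
qed

end

section \<open>Linear connections\<close>

lemma linear_connectionD:
  assumes "linear_connection M nab" "openin (mtop M) W" "vfield M W Y"
  shows "\<And>p. p \<in> W \<Longrightarrow> linear (nab Y p)"
    and "\<And>X. vfield M W X \<Longrightarrow> vfield M W (\<lambda>p. nab Y p (X p))"
    and "\<And>Z p v. vfield M W Z \<Longrightarrow> p \<in> W \<Longrightarrow> nab (\<lambda>q. Y q + Z q) p v = nab Y p v + nab Z p v"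
    and "\<And>f p v. smooth_fun M W f \<Longrightarrow> p \<in> W \<Longrightarrow>
      nab (\<lambda>q. f q *\<^sub>R Y q) p v = dfun M f p v *\<^sub>R Y p + f p *\<^sub>R nab Y p v"
    and "\<And>Z p. (\<And>q. q \<in> W \<Longrightarrow> Z q = Y q) \<Longrightarrow> p \<in> W \<Longrightarrow> nab Z p = nab Y p"
proof -
  note u = assms(1)[unfolded linear_connection_def, THEN conjunct1, THEN spec, THEN spec, THEN mp, OF conjI[OF assms(2,3)]]
  show "\<And>p. p \<in> W \<Longrightarrow> linear (nab Y p)"
    by (rule u[THEN conjunct1, rule_format])
  show "\<And>X. vfield M W X \<Longrightarrow> vfield M W (\<lambda>p. nab Y p (X p))"
    by (rule u[THEN conjunct2, THEN conjunct1, rule_format])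
  show "\<And>Z p v. vfield M W Z \<Longrightarrow> p \<in> W \<Longrightarrow> nab (\<lambda>q. Y q + Z q) p v = nab Y p v + nab Z p v"
    by (rule u[THEN conjunct2, THEN conjunct2, THEN conjunct1, rule_format])
  show "\<And>f p v. smooth_fun M W f \<Longrightarrow> p \<in> W \<Longrightarrow>
      nab (\<lambda>q. f q *\<^sub>R Y q) p v = dfun M f p v *\<^sub>R Y p + f p *\<^sub>R nab Y p v"
    by (rule u[THEN conjunct2, THEN conjunct2, THEN conjunct2, THEN conjunct1, rule_format])
  show "\<And>Z p. (\<And>q. q \<in> W \<Longrightarrow> Z q = Y q) \<Longrightarrow> p \<in> W \<Longrightarrow> nab Z p = nab Y p"
    by (rule u[THEN conjunct2, THEN conjunct2, THEN conjunct2, THEN conjunct2, rule_format])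
qed

lemma linear_connection_default:
  assumes "linear_connection M nab" "\<not> (\<exists>W. openin (mtop M) W \<and> p \<in> W \<and> vfield M W Y)"
  shows "nab Y p = (\<lambda>v. 0)"
  using assms(1)[unfolded linear_connection_def, THEN conjunct2] assms(2) by simp

lemma parallel11D:
  "parallel11 M nab \<phi> \<Longrightarrow> openin (mtop M) W \<Longrightarrow> vfield M W Y \<Longrightarrow> p \<in> W \<Longrightarrow>
    nab (\<lambda>q. \<phi> q (Y q)) p v = \<phi> p (nab Y p v)"
  by (simp add: parallel11_def)

lemma (in smooth_mfd) connection_diff:
  assumes nab: "linear_connection M nab" and W: "openin (mtop M) W" "vfield M W Y" "vfield M W Z" "p \<in> W"
  shows "nab (\<lambda>q. Y q - Z q) p v = nab Y p v - nab Z p v"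
proof -
  have Z: "nab (\<lambda>q. (-1) *\<^sub>R Z q) p v = - nab Z p v"
    using linear_connectionD(4)[OF nab W(1,3) smooth_fun_const[of _ "-1"] W(4)] by (simp add: dfun_const)
  show ?thesis
    using linear_connectionD(3)[OF nab W(1,2) vfield_cmul[OF W(1,3), of "-1"] W(4), of v] unfolding Z by simp
qed

lemma (in smooth_mfd) connection_cmul:
  assumes nab: "linear_connection M nab" and W: "openin (mtop M) W" "vfield M W Y" "p \<in> W"
  shows "nab (\<lambda>q. r *\<^sub>R Y q) p v = r *\<^sub>R nab Y p v"
  using linear_connectionD(4)[OF nab W(1,2) smooth_fun_const[of _ r] W(3)] by (simp add: dfun_const)

section \<open>The canonical connection\<close>

context normal_pair
begin

text \<open>The Bott connection of the foliation tangent to \<open>P\<close>, acting on sections of the complementary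
  eigendistribution, and its mirror image for the other foliation.\<close>

definition bott :: "('a \<Rightarrow> 'e) \<Rightarrow> ('a \<Rightarrow> 'e) \<Rightarrow> 'a \<Rightarrow> 'e" where
  "bott X Y p = Q p (bracket M (\<lambda>q. P q (X q)) (\<lambda>q. Q q (Y q)) p)"
definition bott' :: "('a \<Rightarrow> 'e) \<Rightarrow> ('a \<Rightarrow> 'e) \<Rightarrow> 'a \<Rightarrow> 'e" where
  "bott' X Y p = P p (bracket M (\<lambda>q. Q q (X q)) (\<lambda>q. P q (Y q)) p)"

lemma bott_scale_left:
  assumes W: "openin (mtop M) W" "p \<in> W" and X: "vfield M W X" "vfield M W Y" and h: "smooth_fun M W h"
  shows "bott (\<lambda>q. h q *\<^sub>R X q) Y p = h p *\<^sub>R bott X Y p"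
proof -
  note p = open_in_points[OF W]
  have "bracket M (\<lambda>q. P q (h q *\<^sub>R X q)) (\<lambda>q. Q q (Y q)) p = bracket M (\<lambda>q. h q *\<^sub>R P q (X q)) (\<lambda>q. Q q (Y q)) p"
    by (rule bracket_cong[OF W]) (simp_all add: proj_lin_simps[OF open_in_points[OF W(1)]])
  then show ?thesis
    unfolding bott_def using bracket_scaleR_left[OF W vfield_proj(1)[OF W(1) X(1)] vfield_proj(2)[OF W(1) X(2)] h]
    by (simp add: proj_lin_simps[OF p] proj_simps[OF p])
qed

lemma bott_scale_right:
  assumes W: "openin (mtop M) W" "p \<in> W" and X: "vfield M W X" "vfield M W Y" and h: "smooth_fun M W h"
  shows "bott X (\<lambda>q. h q *\<^sub>R Y q) p = h p *\<^sub>R bott X Y p + dfun M h p (P p (X p)) *\<^sub>R Q p (Y p)"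
proof -
  note p = open_in_points[OF W]
  have "bracket M (\<lambda>q. P q (X q)) (\<lambda>q. Q q (h q *\<^sub>R Y q)) p = bracket M (\<lambda>q. P q (X q)) (\<lambda>q. h q *\<^sub>R Q q (Y q)) p"
    by (rule bracket_cong[OF W]) (simp_all add: proj_lin_simps[OF open_in_points[OF W(1)]])
  then show ?thesis
    unfolding bott_def using bracket_scaleR_right[OF W vfield_proj(2)[OF W(1) X(2)] vfield_proj(1)[OF W(1) X(1)] h]
    by (simp add: proj_lin_simps[OF p] proj_simps[OF p])
qed

lemma bott_add_left:
  assumes W: "openin (mtop M) W" "p \<in> W" and X: "vfield M W X" "vfield M W X'" "vfield M W Y"
  shows "bott (\<lambda>q. X q + X' q) Y p = bott X Y p + bott X' Y p"
proof -
  have "bracket M (\<lambda>q. P q (X q + X' q)) (\<lambda>q. Q q (Y q)) p = bracket M (\<lambda>q. P q (X q) + P q (X' q)) (\<lambda>q. Q q (Y q)) p"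
    by (rule bracket_cong[OF W]) (simp_all add: proj_lin_simps[OF open_in_points[OF W(1)]])
  then show ?thesis
    unfolding bott_def using bracket_add_left[OF W vfield_proj(1)[OF W(1) X(1)] vfield_proj(1)[OF W(1) X(2)] vfield_proj(2)[OF W(1) X(3)]]
    by (simp add: proj_lin_simps[OF open_in_points[OF W]])
qed

lemma bott_add_right:
  assumes W: "openin (mtop M) W" "p \<in> W" and X: "vfield M W X" "vfield M W Y" "vfield M W Y'"
  shows "bott X (\<lambda>q. Y q + Y' q) p = bott X Y p + bott X Y' p"
proof -
  have "bracket M (\<lambda>q. P q (X q)) (\<lambda>q. Q q (Y q + Y' q)) p = bracket M (\<lambda>q. P q (X q)) (\<lambda>q. Q q (Y q) + Q q (Y' q)) p"
    by (rule bracket_cong[OF W]) (simp_all add: proj_lin_simps[OF open_in_points[OF W(1)]])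
  then show ?thesis
    unfolding bott_def using bracket_add_right[OF W vfield_proj(2)[OF W(1) X(2)] vfield_proj(2)[OF W(1) X(3)] vfield_proj(1)[OF W(1) X(1)]]
    by (simp add: proj_lin_simps[OF open_in_points[OF W]])
qed

lemma bott_cmul_right:
  assumes W: "openin (mtop M) W" "p \<in> W" and X: "vfield M W X" "vfield M W Y"
    and eq: "\<And>q. q \<in> W \<Longrightarrow> Q q (Y' q) = s *\<^sub>R Q q (Y q)"
  shows "bott X Y' p = s *\<^sub>R bott X Y p"
proof -
  have "bracket M (\<lambda>q. P q (X q)) (\<lambda>q. Q q (Y' q)) p = bracket M (\<lambda>q. P q (X q)) (\<lambda>q. s *\<^sub>R Q q (Y q)) p"
    by (rule bracket_cong[OF W]) (simp_all add: eq)
  then show ?thesis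
    unfolding bott_def using bracket_cmul_right[OF W vfield_proj(2)[OF W(1) X(2)] vfield_proj(1)[OF W(1) X(1)], of s]
    by (simp add: proj_lin_simps[OF open_in_points[OF W]])
qed

lemma bott_cong:
  assumes W: "openin (mtop M) W" "p \<in> W" and X: "\<And>q. q \<in> W \<Longrightarrow> X q = X' q" "\<And>q. q \<in> W \<Longrightarrow> Y q = Y' q"
  shows "bott X Y p = bott X' Y' p"
  unfolding bott_def by (rule arg_cong[of _ _ "Q p"], rule bracket_cong[OF W]) (simp_all add: X)

lemma minus_bott: "normal_pair.bott M \<eta> \<xi> (\<lambda>p v. - f p v) = bott'"
proof -
  interpret neg: normal_pair M \<eta> \<xi> "\<lambda>p v. - f p v" g by (rule normal_pair_minus[OF normal_pair_axioms])
  show "neg.bott = bott'" by (simp add: fun_eq_iff neg.bott_def bott'_def minus_proj)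
qed

lemmas bott'_scale_left = normal_pair.bott_scale_left[OF normal_pair_minus[OF normal_pair_axioms], unfolded minus_bott]
lemmas bott'_scale_right =
  normal_pair.bott_scale_right[OF normal_pair_minus[OF normal_pair_axioms], unfolded minus_bott minus_proj]
lemmas bott'_add_left = normal_pair.bott_add_left[OF normal_pair_minus[OF normal_pair_axioms], unfolded minus_bott]
lemmas bott'_add_right = normal_pair.bott_add_right[OF normal_pair_minus[OF normal_pair_axioms], unfolded minus_bott]
lemmas bott'_cmul_right =
  normal_pair.bott_cmul_right[OF normal_pair_minus[OF normal_pair_axioms], unfolded minus_bott minus_proj]
lemmas bott'_cong = normal_pair.bott_cong[OF normal_pair_minus[OF normal_pair_axioms], unfolded minus_bott]

text \<open>The covariant derivative along a field \<open>X\<close>: the two Bott connections, their conjugates by \<open>g\<close>,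
  which exchanges the two eigendistributions, and what parallelism of the Reeb field and the
  prescribed torsion impose in the Reeb direction.\<close>

definition cov :: "('a \<Rightarrow> 'e) \<Rightarrow> ('a \<Rightarrow> 'e) \<Rightarrow> 'a \<Rightarrow> 'e" where
  "cov X Y p =
     bott X Y p + g p (bott X (\<lambda>q. g q (Y q)) p) + bott' X Y p + g p (bott' X (\<lambda>q. g q (Y q)) p)
   + \<eta> p (X p) *\<^sub>R (bracket M \<xi> Y p - \<eta> p (bracket M \<xi> Y p) *\<^sub>R \<xi> p)
   + dfun M (\<lambda>q. \<eta> q (Y q)) p (X p) *\<^sub>R \<xi> p"

lemma cov_scale_left:
  assumes W: "openin (mtop M) W" "p \<in> W" and X: "vfield M W X" "vfield M W Y" and h: "smooth_fun M W h"
  shows "cov (\<lambda>q. h q *\<^sub>R X q) Y p = h p *\<^sub>R cov X Y p"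
proof -
  note p = open_in_points[OF W] and gY = G.vfield_f[OF W(1) X(2)]
  show ?thesis
    unfolding cov_def bott_scale_left[OF W X h] bott_scale_left[OF W X(1) gY h]
      bott'_scale_left[OF W X h] bott'_scale_left[OF W X(1) gY h]
    using linear_cmul[OF dfun_linear[OF F.smooth_eta[OF W(1) X(2)] W(2) p]]
    by (simp add: G.f_simps[OF p] F.eta_simps[OF p] scaleR_right_distrib)
qed

lemma cov_add_left:
  assumes W: "openin (mtop M) W" "p \<in> W" and X: "vfield M W X" "vfield M W X'" "vfield M W Y"
  shows "cov (\<lambda>q. X q + X' q) Y p = cov X Y p + cov X' Y p"
proof -
  note p = open_in_points[OF W] and gY = G.vfield_f[OF W(1) X(3)]
  show ?thesis
    unfolding cov_def bott_add_left[OF W X] bott_add_left[OF W X(1,2) gY] bott'_add_left[OF W X] bott'_add_left[OF W X(1,2) gY]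
    using linear_add[OF dfun_linear[OF F.smooth_eta[OF W(1) X(3)] W(2) p]]
    by (simp add: G.f_simps[OF p] F.eta_simps[OF p] scaleR_left_distrib)
qed

lemma cov_cong:
  assumes W: "openin (mtop M) W" "p \<in> W" and X: "\<And>q. q \<in> W \<Longrightarrow> X q = X' q" "\<And>q. q \<in> W \<Longrightarrow> Y q = Y' q"
  shows "cov X Y p = cov X' Y' p"
proof -
  have d: "dfun M (\<lambda>q. \<eta> q (Y q)) p = dfun M (\<lambda>q. \<eta> q (Y' q)) p" by (rule dfun_cong[OF W]) (simp add: X)
  have x: "bracket M \<xi> Y p = bracket M \<xi> Y' p" by (rule bracket_cong[OF W]) (simp_all add: X)
  have b: "bott X Y p = bott X' Y' p" "bott X (\<lambda>q. g q (Y q)) p = bott X' (\<lambda>q. g q (Y' q)) p"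
    "bott' X Y p = bott' X' Y' p" "bott' X (\<lambda>q. g q (Y q)) p = bott' X' (\<lambda>q. g q (Y' q)) p"
    by (rule bott_cong[OF W] bott'_cong[OF W]; simp add: X)+
  show ?thesis unfolding cov_def d x b X(1)[OF W(2)] ..
qed

lemma cov_add_right:
  assumes W: "openin (mtop M) W" "p \<in> W" and X: "vfield M W X" "vfield M W Y" "vfield M W Y'"
  shows "cov X (\<lambda>q. Y q + Y' q) p = cov X Y p + cov X Y' p"
proof -
  note p = open_in_points[OF W] and gY = G.vfield_f[OF W(1) X(2)] G.vfield_f[OF W(1) X(3)]
  have d: "dfun M (\<lambda>q. \<eta> q (Y q + Y' q)) p v = dfun M (\<lambda>q. \<eta> q (Y q)) p v + dfun M (\<lambda>q. \<eta> q (Y' q)) p v" for v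
  proof -
    have "dfun M (\<lambda>q. \<eta> q (Y q + Y' q)) p = dfun M (\<lambda>q. \<eta> q (Y q) + \<eta> q (Y' q)) p"
      by (rule dfun_cong[OF W]) (simp add: F.eta_simps open_in_points[OF W(1)])
    then show ?thesis using dfun_add[OF F.smooth_eta[OF W(1) X(2)] F.smooth_eta[OF W(1) X(3)] W(2) p] by simp
  qed
  have g: "bott X (\<lambda>q. g q (Y q + Y' q)) p = bott X (\<lambda>q. g q (Y q) + g q (Y' q)) p"
    "bott' X (\<lambda>q. g q (Y q + Y' q)) p = bott' X (\<lambda>q. g q (Y q) + g q (Y' q)) p"
    by (rule bott_cong[OF W] bott'_cong[OF W]; simp add: G.f_simps open_in_points[OF W(1)])+
  show ?thesis
    unfolding cov_def d g bott_add_right[OF W X] bott_add_right[OF W X(1) gY] bott'_add_right[OF W X] bott'_add_right[OF W X(1) gY]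
      bracket_add_right[OF W X(2,3) F.vfield_xi[OF W(1)]]
    by (simp add: G.f_simps[OF p] F.eta_simps[OF p] scaleR_left_distrib scaleR_right_distrib scaleR_diff_right)
qed

lemma cov_scale_right:
  assumes W: "openin (mtop M) W" "p \<in> W" and X: "vfield M W X" "vfield M W Y" and h: "smooth_fun M W h"
  shows "cov X (\<lambda>q. h q *\<^sub>R Y q) p = dfun M h p (X p) *\<^sub>R Y p + h p *\<^sub>R cov X Y p"
proof -
  note p = open_in_points[OF W] and gY = G.vfield_f[OF W(1) X(2)]
  let ?d = "dfun M h p"
  have d: "dfun M (\<lambda>q. \<eta> q (h q *\<^sub>R Y q)) p v = ?d v * \<eta> p (Y p) + h p * dfun M (\<lambda>q. \<eta> q (Y q)) p v" for v
  proof -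
    have "dfun M (\<lambda>q. \<eta> q (h q *\<^sub>R Y q)) p = dfun M (\<lambda>q. h q * \<eta> q (Y q)) p"
      by (rule dfun_cong[OF W]) (simp add: F.eta_simps open_in_points[OF W(1)])
    then show ?thesis using dfun_mult[OF h F.smooth_eta[OF W(1) X(2)] W(2) p] by simp
  qed
  have g: "bott X (\<lambda>q. g q (h q *\<^sub>R Y q)) p = bott X (\<lambda>q. h q *\<^sub>R g q (Y q)) p"
    "bott' X (\<lambda>q. g q (h q *\<^sub>R Y q)) p = bott' X (\<lambda>q. h q *\<^sub>R g q (Y q)) p"
    by (rule bott_cong[OF W] bott'_cong[OF W]; simp add: G.f_simps open_in_points[OF W(1)])+
  have dX: "?d (X p) = ?d (P p (X p)) + ?d (Q p (X p)) + \<eta> p (X p) * ?d (\<xi> p)"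
  proof -
    note lin = dfun_linear[OF h W(2) p]
    show ?thesis by (subst decomp[of "X p" p]) (simp add: linear_add[OF lin] linear_cmul[OF lin])
  qed
  have Y: "Y p = P p (Y p) + Q p (Y p) + \<eta> p (Y p) *\<^sub>R \<xi> p" by (rule decomp)
  let ?y = "P p (Y p) + Q p (Y p)"
  \<comment> \<open>Each Bott term contributes the derivative of \<open>h\<close> along its own component of \<open>X\<close>; together they make up \<open>X(h)\<close>.\<close>
  have "cov X (\<lambda>q. h q *\<^sub>R Y q) p - h p *\<^sub>R cov X Y p
    = ?d (P p (X p)) *\<^sub>R ?y + ?d (Q p (X p)) *\<^sub>R ?y
      + (\<eta> p (X p) * ?d (\<xi> p)) *\<^sub>R (Y p - \<eta> p (Y p) *\<^sub>R \<xi> p) + (?d (X p) * \<eta> p (Y p)) *\<^sub>R \<xi> p"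
    unfolding cov_def d g bott_scale_right[OF W X h] bott_scale_right[OF W X(1) gY h]
      bott'_scale_right[OF W X h] bott'_scale_right[OF W X(1) gY h] bracket_scaleR_right[OF W X(2) F.vfield_xi[OF W(1)] h]
    by (simp add: proj_simps[OF p] G.f_simps[OF p] F.eta_simps[OF p] algebra_simps)
  also have "Y p - \<eta> p (Y p) *\<^sub>R \<xi> p = ?y" using Y by (metis add_diff_cancel_right')
  also have "?d (P p (X p)) *\<^sub>R ?y + ?d (Q p (X p)) *\<^sub>R ?y + (\<eta> p (X p) * ?d (\<xi> p)) *\<^sub>R ?y + (?d (X p) * \<eta> p (Y p)) *\<^sub>R \<xi> p
     = ?d (X p) *\<^sub>R (?y + \<eta> p (Y p) *\<^sub>R \<xi> p)"
    unfolding dX by (simp add: algebra_simps)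
  also have "\<dots> = ?d (X p) *\<^sub>R Y p" using Y by simp
  finally show ?thesis by (simp add: algebra_simps)
qed

lemma vfield_cov:
  assumes W: "openin (mtop M) W" and X: "vfield M W X" "vfield M W Y"
  shows "vfield M W (cov X Y)"
proof -
  note gY = G.vfield_f[OF W X(2)]
  have br: "vfield M W (\<lambda>q. bracket M Z Z' q)" if "vfield M W Z" "vfield M W Z'" for Z Z'
    using vfield_bracket[OF W that] .
  note xi = F.vfield_xi[OF W]
  note xY = vfield_bracket[OF W xi X(2)]
  show ?thesis
    unfolding cov_def[abs_def] bott_def bott'_def
    by (intro vfield_add[OF W] vfield_scaleR[OF W] vfield_diff[OF W] vfield_proj[OF W] G.vfield_f[OF W] br F.smooth_eta[OF W] smooth_fun_dfun[OF W] xi xY X gY)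
qed

text \<open>The defining properties of the canonical connection, for the two tensors only: a connection
  that preserves \<open>f\<close> and \<open>g\<close> preserves their product.\<close>

definition canonical :: "(('a \<Rightarrow> 'e) \<Rightarrow> 'a \<Rightarrow> 'e \<Rightarrow> 'e) \<Rightarrow> bool" where
  "canonical nab \<longleftrightarrow> linear_connection M nab \<and> (\<forall>p\<in>points M. \<forall>v. nab \<xi> p v = 0) \<and>
     parallel11 M nab f \<and> parallel11 M nab g \<and>
     (\<forall>W X Y. openin (mtop M) W \<and> vfield M W X \<and> vfield M W Y \<longrightarrow>
        (\<forall>p\<in>W. torsion M nab X Y p = (2 * dform M \<eta> X Y p) *\<^sub>R \<xi> p))"

text \<open>A tangent vector is extended by constant coordinates; the choice is immaterial since the
  derivative is tensorial in its direction.\<close>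

definition cov_conn :: "('a \<Rightarrow> 'e) \<Rightarrow> 'a \<Rightarrow> 'e \<Rightarrow> 'e" where
  "cov_conn Y p v = (if \<exists>W. openin (mtop M) W \<and> p \<in> W \<and> vfield M W Y then cov (const_field M p v) Y p else 0)"

lemma cov_tensorial:
  assumes W: "openin (mtop M) W" "p \<in> W" and X: "vfield M W X" "vfield M W Y"
  shows "cov X Y p = (\<Sum>b\<in>Basis. (X p \<bullet> b) *\<^sub>R cov (const_field M p b) Y p)"
proof (rule tensorial_at[where K = "\<lambda>X. cov X Y p", OF _ _ _ W X(1)])
  fix W' X X' and h :: "'a \<Rightarrow> real" assume W': "openin (mtop M) W'" "p \<in> W'" "W' \<subseteq> W" "vfield M W' X"
  note Y = vfield_subset[OF X(2) W'(3)]
  show "cov (\<lambda>q. X q + X' q) Y p = cov X Y p + cov X' Y p" if "vfield M W' X'"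
    by (rule cov_add_left[OF W'(1,2,4) that Y])
  show "cov (\<lambda>q. h q *\<^sub>R X q) Y p = h p *\<^sub>R cov X Y p" if "smooth_fun M W' h"
    by (rule cov_scale_left[OF W'(1,2,4) Y that])
  show "cov X Y p = cov X' Y p" if "\<And>q. q \<in> W' \<Longrightarrow> X q = X' q"
    by (rule cov_cong[OF W'(1,2)]) (simp_all add: that)
qed

lemma cov_conn_expand:
  assumes W: "openin (mtop M) W" "p \<in> W" and Y: "vfield M W Y"
  shows "cov_conn Y p v = (\<Sum>b\<in>Basis. (v \<bullet> b) *\<^sub>R cov (const_field M p b) Y p)"
proof -
  have p: "p \<in> points M" using open_in_points[OF W] .
  let ?W = "W \<inter> fst (chart_at M p)"
  have W': "openin (mtop M) ?W" "p \<in> ?W" using chart_nbhd[OF W] .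
  have "cov_conn Y p v = cov (const_field M p v) Y p" using W Y by (auto simp: cov_conn_def)
  also have "\<dots> = (\<Sum>b\<in>Basis. (const_field M p v p \<bullet> b) *\<^sub>R cov (const_field M p b) Y p)"
    by (rule cov_tensorial[OF W' vfield_subset[OF vfield_const_field[OF p]] vfield_subset[OF Y]]) auto
  finally show ?thesis by (simp add: const_field_at[OF p])
qed

lemma cov_conn_eq:
  assumes W: "openin (mtop M) W" "p \<in> W" and X: "vfield M W X" "vfield M W Y"
  shows "cov_conn Y p (X p) = cov X Y p"
  using cov_conn_expand[OF W X(2)] cov_tensorial[OF W X] by simp

lemma cov_conn_via_field:
  assumes W: "openin (mtop M) W" "p \<in> W"
  shows "\<exists>W' X. openin (mtop M) W' \<and> p \<in> W' \<and> W' \<subseteq> W \<and> vfield M W' X \<and> X p = v \<and>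
    (\<forall>Y. vfield M W' Y \<longrightarrow> cov_conn Y p v = cov X Y p)"
proof (intro exI conjI allI impI)
  have p: "p \<in> points M" using open_in_points[OF W] .
  let ?W = "W \<inter> fst (chart_at M p)"
  show W': "openin (mtop M) ?W" "p \<in> ?W" "?W \<subseteq> W" using chart_nbhd[OF W] by auto
  show X: "vfield M ?W (const_field M p v)" by (rule vfield_subset[OF vfield_const_field[OF p]]) auto
  show "const_field M p v p = v" by (rule const_field_at[OF p])
  show "cov_conn Y p v = cov (const_field M p v) Y p" if "vfield M ?W Y" for Y
    using cov_conn_eq[OF W'(1,2) X that] const_field_at[OF p] by simp
qed

lemma linear_connection_cov_conn: "linear_connection M cov_conn"
  unfolding linear_connection_def
proof (intro conjI allI impI ballI; (elim conjE)?)
  fix W Y assume W: "openin (mtop M) W" and Y: "vfield M W Y"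
  show "linear (cov_conn Y p)" if "p \<in> W" for p
    unfolding cov_conn_expand[OF W that Y, abs_def]
    by (intro linear_compose_sum ballI linear_compose_scale_right linearI)
      (simp_all add: inner_add_left scaleR_left_distrib)
  show "vfield M W (\<lambda>p. cov_conn Y p (X p))" if X: "vfield M W X" for X
    by (rule vfield_cong[OF W _ vfield_cov[OF W X Y]]) (simp add: cov_conn_eq[OF W _ X Y])
  show "cov_conn (\<lambda>q. Y q + Z q) p v = cov_conn Y p v + cov_conn Z p v"
    if Z: "vfield M W Z" and p: "p \<in> W" for Z p v
  proof -
    obtain W' X where X: "openin (mtop M) W'" "p \<in> W'" "W' \<subseteq> W" "vfield M W' X" "X p = v"
      "\<And>Y. vfield M W' Y \<Longrightarrow> cov_conn Y p v = cov X Y p" using cov_conn_via_field[OF W p, of v] by blast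
    note v = vfield_subset[OF Y X(3)] vfield_subset[OF Z X(3)]
    show ?thesis using X(6)[OF vfield_add[OF X(1) v]] X(6)[OF v(1)] X(6)[OF v(2)] cov_add_right[OF X(1,2,4) v] by simp
  qed
  show "cov_conn (\<lambda>q. h q *\<^sub>R Y q) p v = dfun M h p v *\<^sub>R Y p + h p *\<^sub>R cov_conn Y p v"
    if h: "smooth_fun M W h" and p: "p \<in> W" for h p v
  proof -
    obtain W' X where X: "openin (mtop M) W'" "p \<in> W'" "W' \<subseteq> W" "vfield M W' X" "X p = v"
      "\<And>Y. vfield M W' Y \<Longrightarrow> cov_conn Y p v = cov X Y p" using cov_conn_via_field[OF W p, of v] by blast
    note v = vfield_subset[OF Y X(3)] and h' = smooth_fun_subset[OF h X(3)]
    show ?thesis using X(6)[OF vfield_scaleR[OF X(1) h' v]] X(6)[OF v] cov_scale_right[OF X(1,2,4) v h'] X(5) by simp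
  qed
  show "cov_conn Z p = cov_conn Y p" if eq: "\<forall>q\<in>W. Z q = Y q" and p: "p \<in> W" for Z p
  proof
    fix v
    have Z: "vfield M W Z" using vfield_cong[OF W _ Y, of Z] eq by simp
    obtain W' X where X: "openin (mtop M) W'" "p \<in> W'" "W' \<subseteq> W" "vfield M W' X" "X p = v"
      "\<And>Y. vfield M W' Y \<Longrightarrow> cov_conn Y p v = cov X Y p" using cov_conn_via_field[OF W p, of v] by blast
    show "cov_conn Z p v = cov_conn Y p v"
      using X(6)[OF vfield_subset[OF Y X(3)]] X(6)[OF vfield_subset[OF Z X(3)]] cov_cong[OF X(1,2), of X X Z Y] eq X(3) by auto
  qed
next
  fix Y p assume "\<not> (\<exists>W. openin (mtop M) W \<and> p \<in> W \<and> vfield M W Y)"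
  then show "cov_conn Y p = (\<lambda>v. 0)" by (auto simp: cov_conn_def fun_eq_iff)
qed

lemma cov_f:
  assumes W: "openin (mtop M) W" "p \<in> W" and X: "vfield M W X" "vfield M W Y"
  shows "cov X (\<lambda>q. f q (Y q)) p = f p (cov X Y p)"
proof -
  note p = open_in_points[OF W] and q = open_in_points[OF W(1)]
  note gY = G.vfield_f[OF W(1) X(2)]
  have b: "bott X (\<lambda>q. f q (Y q)) p = (-1) *\<^sub>R bott X Y p" "bott' X (\<lambda>q. f q (Y q)) p = 1 *\<^sub>R bott' X Y p"
    by (rule bott_cmul_right[OF W X] bott'_cmul_right[OF W X]; simp add: proj_simps[OF q])+
  have b': "bott X (\<lambda>q. g q (f q (Y q))) p = 1 *\<^sub>R bott X (\<lambda>q. g q (Y q)) p"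
    "bott' X (\<lambda>q. g q (f q (Y q))) p = (-1) *\<^sub>R bott' X (\<lambda>q. g q (Y q)) p"
    by (rule bott_cmul_right[OF W X(1) gY] bott'_cmul_right[OF W X(1) gY]; simp add: proj_simps[OF q] G.f_simps[OF q])+
  have d: "dfun M (\<lambda>q. \<eta> q (f q (Y q))) p v = 0" for v
    by (rule dfun_zero_on[OF W]) (simp add: F.eta_f[OF q])
  have fg: "f p (g p (Q p w)) = g p (Q p w)" "f p (g p (P p w)) = - g p (P p w)" for w
    using proj_simps(1)[OF p, of "g p w"] proj_simps(2)[OF p, of "g p w"] by (simp_all add: proj_simps[OF p])
  show ?thesis
    unfolding cov_def b b' d F.xi_bracket_f[OF W(1) X(2) W(2)]
    by (simp add: bott_def bott'_def proj_simps[OF p] F.f_simps[OF p] G.f_simps[OF p] F.eta_f[OF p] F.f_xi[OF p] fg)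
qed

lemma cov_g:
  assumes W: "openin (mtop M) W" "p \<in> W" and X: "vfield M W X" "vfield M W Y"
  shows "cov X (\<lambda>q. g q (Y q)) p = g p (cov X Y p)"
proof -
  note p = open_in_points[OF W] and q = open_in_points[OF W(1)]
  have b: "bott X (\<lambda>q. g q (g q (Y q))) p = 1 *\<^sub>R bott X Y p" "bott' X (\<lambda>q. g q (g q (Y q))) p = 1 *\<^sub>R bott' X Y p"
    by (rule bott_cmul_right[OF W X] bott'_cmul_right[OF W X];
        simp add: G.ff[OF q] proj_simps[OF q] proj_lin_simps[OF q])+
  have d: "dfun M (\<lambda>q. \<eta> q (g q (Y q))) p v = 0" for v
    by (rule dfun_zero_on[OF W]) (simp add: G.eta_f[OF q])
  show ?thesis
    unfolding cov_def b d G.xi_bracket_f[OF W(1) X(2) W(2)]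
    by (simp add: bott_def bott'_def proj_simps[OF p] G.f_simps[OF p] G.eta_f[OF p] G.f_xi[OF p])
qed

lemma cov_xi:
  assumes W: "openin (mtop M) W" "p \<in> W" and X: "vfield M W X"
  shows "cov X \<xi> p = 0"
proof -
  note p = open_in_points[OF W] and q = open_in_points[OF W(1)]
  have xx: "bracket M \<xi> \<xi> p = 0" by (simp add: bracket_def)
  have d: "dfun M (\<lambda>q. \<eta> q (\<xi> q)) p v = 0" for v
    by (rule dfun_zero_on[OF W]) (simp add: F.eta_xi[OF q])
  have b: "bott X \<xi> p = 0 *\<^sub>R bott X X p" "bott X (\<lambda>q. g q (\<xi> q)) p = 0 *\<^sub>R bott X X p"
    "bott' X \<xi> p = 0 *\<^sub>R bott' X X p" "bott' X (\<lambda>q. g q (\<xi> q)) p = 0 *\<^sub>R bott' X X p"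
    by (rule bott_cmul_right[OF W X X] bott'_cmul_right[OF W X X]; simp add: proj_simps[OF q] proj_lin_simps[OF q] G.f_xi[OF q])+
  show ?thesis
    unfolding cov_def b d xx by (simp add: G.f_simps[OF p] F.eta_simps[OF p])
qed

text \<open>Both sides are compared after applying \<open>P\<close>, \<open>Q\<close> and \<open>\<eta>\<close>; the \<open>Q\<close> part is the \<open>P\<close> part of
  the pair \<open>(-f, g)\<close>.\<close>

lemma cov_torsion:
  assumes W: "openin (mtop M) W" "p \<in> W" and X: "vfield M W X" "vfield M W Y"
  shows "cov X Y p - cov Y X p - bracket M X Y p = (2 * dform M \<eta> X Y p) *\<^sub>R \<xi> p"
proof -
  note p = open_in_points[OF W]
  let ?B = "bracket M"
  let ?t = "cov X Y p - cov Y X p - ?B X Y p"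
  have PB: "?B (\<lambda>q. P q (Z q)) (\<lambda>q. Q q (Z' q)) p = - ?B (\<lambda>q. Q q (Z' q)) (\<lambda>q. P q (Z q)) p" for Z Z'
    by (rule bracket_antisym)
  have Pcov: "P p (cov X Y p) = g p (Q p (?B (\<lambda>q. P q (X q)) (\<lambda>q. Q q (g q (Y q))) p))
      + P p (?B (\<lambda>q. Q q (X q)) (\<lambda>q. P q (Y q)) p) + \<eta> p (X p) *\<^sub>R P p (?B \<xi> Y p)"
    and Qcov: "Q p (cov X Y p) = g p (P p (?B (\<lambda>q. Q q (X q)) (\<lambda>q. P q (g q (Y q))) p))
      + Q p (?B (\<lambda>q. P q (X q)) (\<lambda>q. Q q (Y q)) p) + \<eta> p (X p) *\<^sub>R Q p (?B \<xi> Y p)"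
    and Ecov: "\<eta> p (cov X Y p) = dfun M (\<lambda>q. \<eta> q (Y q)) p (X p)" for X Y
    unfolding cov_def bott_def bott'_def by (simp_all add: proj_lin_simps[OF p] proj_simps[OF p] F.eta_simps[OF p] G.eta_f[OF p] F.eta_xi[OF p] G.f_simps[OF p])
  have "P p ?t = 0"
    unfolding proj_lin_simps[OF p] Pcov P_bracket[OF W(1) X W(2)] bracket_eigen_via_g[OF W(1) X W(2)]
    using PB[of X Y] proj_lin_simps(4)[OF p] by simp
  moreover have "Q p ?t = 0"
    unfolding proj_lin_simps[OF p] Qcov Q_bracket[OF W(1) X W(2)] bracket_coeigen_via_g[OF W(1) X W(2)]
    using PB[of Y X] proj_lin_simps(9)[OF p] by simp
  moreover have "\<eta> p ?t = 2 * dform M \<eta> X Y p"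
    unfolding F.eta_simps[OF p] Ecov by (simp add: two_dform)
  ultimately show ?thesis using decomp[of ?t p] by simp
qed

lemma canonical_cov_conn: "canonical cov_conn"
proof -
  have 1: "cov_conn \<xi> p v = 0" if p: "p \<in> points M" for p v
  proof -
    obtain W' X where "openin (mtop M) W'" "p \<in> W'" "vfield M W' X" "\<And>Y. vfield M W' Y \<Longrightarrow> cov_conn Y p v = cov X Y p"
      using cov_conn_via_field[OF open_points p, of v] by blast
    then show ?thesis using cov_xi F.vfield_xi by simp
  qed
  have 2: "cov_conn (\<lambda>q. f q (Y q)) p v = f p (cov_conn Y p v)"
    and 3: "cov_conn (\<lambda>q. g q (Y q)) p v = g p (cov_conn Y p v)"
    if W: "openin (mtop M) W" "vfield M W Y" "p \<in> W" for W Y p v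
  proof -
    obtain W' X where X: "openin (mtop M) W'" "p \<in> W'" "W' \<subseteq> W" "vfield M W' X"
      "\<And>Y. vfield M W' Y \<Longrightarrow> cov_conn Y p v = cov X Y p" using cov_conn_via_field[OF W(1,3), of v] by blast
    note Y = vfield_subset[OF W(2) X(3)]
    show "cov_conn (\<lambda>q. f q (Y q)) p v = f p (cov_conn Y p v)"
      using X(5)[OF Y] X(5)[OF F.vfield_f[OF X(1) Y]] cov_f[OF X(1,2,4) Y] by simp
    show "cov_conn (\<lambda>q. g q (Y q)) p v = g p (cov_conn Y p v)"
      using X(5)[OF Y] X(5)[OF G.vfield_f[OF X(1) Y]] cov_g[OF X(1,2,4) Y] by simp
  qed
  have 4: "torsion M cov_conn X Y p = (2 * dform M \<eta> X Y p) *\<^sub>R \<xi> p"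
    if W: "openin (mtop M) W" "vfield M W X" "vfield M W Y" "p \<in> W" for W X Y p
    unfolding torsion_def cov_conn_eq[OF W(1,4,2,3)] cov_conn_eq[OF W(1,4,3,2)] by (rule cov_torsion[OF W(1,4,2,3)])
  have 5: "parallel11 M cov_conn f" "parallel11 M cov_conn g"
    unfolding parallel11_def using 2 3 by auto
  show ?thesis unfolding canonical_def using linear_connection_cov_conn 1 4 5 by blast
qed

text \<open>The difference \<open>A\<close> of two such connections is symmetric, since the torsions agree, and commutes
  with \<open>f\<close> and \<open>g\<close> in either argument. Hence \<open>A(fX, gY)\<close> equals both \<open>fg A(X,Y)\<close> and
  \<open>gf A(X,Y)\<close>, and anticommutation kills it up to a multiple of the Reeb field. That multiple
  vanishes too: both derivatives of \<open>\<xi>\<close> are zero, so \<open>Y\<close> may be replaced by \<open>f (f Y)\<close>, and \<open>f\<close> kills \<open>\<xi>\<close>.\<close>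

lemma canonical_unique:
  assumes n: "canonical nab" "canonical nab'" shows "nab = nab'"
proof (intro ext)
  fix Y p v
  note c = n[unfolded canonical_def]
  note l = c(1)[THEN conjunct1] c(2)[THEN conjunct1]
  show "nab Y p v = nab' Y p v"
  proof (cases "\<exists>W. openin (mtop M) W \<and> p \<in> W \<and> vfield M W Y")
    case False
    then show ?thesis using linear_connection_default[OF l(1)] linear_connection_default[OF l(2)] by simp
  next
    case True
    then obtain W0 where W0: "openin (mtop M) W0" "p \<in> W0" "vfield M W0 Y" by blast
    have p: "p \<in> points M" using open_in_points[OF W0(1,2)] .
    define W where "W = W0 \<inter> fst (chart_at M p)"
    have W: "openin (mtop M) W" "p \<in> W" unfolding W_def using chart_nbhd[OF W0(1,2)] .
    have Y: "vfield M W Y" by (rule vfield_subset[OF W0(3)]) (simp add: W_def)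
    define X where "X = const_field M p v"
    have X: "vfield M W X" "X p = v"
      unfolding X_def using const_field_at[OF p] by (auto simp: W_def intro: vfield_subset[OF vfield_const_field[OF p]])
    define A where "A X Y = nab Y p (X p) - nab' Y p (X p)" for X Y
    have par: "parallel11 M nab f" "parallel11 M nab g" "parallel11 M nab' f" "parallel11 M nab' g" using c by blast+
    have tor: "torsion M nab Z Z' p = torsion M nab' Z Z' p" if "vfield M W Z" "vfield M W Z'" for Z Z'
      using c W that by simp
    have sym: "A Z Z' = A Z' Z" if "vfield M W Z" "vfield M W Z'" for Z Z'
    proof -
      have "(nab Z' p (Z p) - nab' Z' p (Z p)) - (nab Z p (Z' p) - nab' Z p (Z' p)) = 0"
        using tor[OF that] by (simp add: torsion_def algebra_simps)
      then show ?thesis by (simp add: A_def)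
    qed
    have Af: "A Z (\<lambda>q. f q (Z' q)) = f p (A Z Z')" and Ag: "A Z (\<lambda>q. g q (Z' q)) = g p (A Z Z')"
      if "vfield M W Z'" for Z Z'
      using parallel11D[OF par(1) W(1) that W(2)] parallel11D[OF par(2) W(1) that W(2)]
        parallel11D[OF par(3) W(1) that W(2)] parallel11D[OF par(4) W(1) that W(2)]
      by (simp_all add: A_def F.f_simps[OF p] G.f_simps[OF p])
    let ?a = "A X Y"
    note fX = F.vfield_f[OF W(1) X(1)] and gY = G.vfield_f[OF W(1) Y]
    have "A (\<lambda>q. f q (X q)) (\<lambda>q. g q (Y q)) = g p (f p ?a)"
      using Ag[OF Y, of "\<lambda>q. f q (X q)"] sym[OF fX Y] Af[OF X(1), of Y] sym[OF X(1) Y] by simp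
    moreover have "A (\<lambda>q. f q (X q)) (\<lambda>q. g q (Y q)) = f p (g p ?a)"
      using sym[OF fX gY] Af[OF X(1), of "\<lambda>q. g q (Y q)"] sym[OF X(1) gY] Ag[OF Y, of X] by simp
    ultimately have "f p (g p ?a) = - f p (g p ?a)" using anti[OF p, of ?a] by simp
    then have "f p (g p ?a) = 0" by (rule eq_minus_self)
    then have "g p ?a = 0" using F.ff[OF p, of "g p ?a"] F.f_simps(5)[OF p] G.eta_f[OF p] by simp
    then have "?a = \<eta> p ?a *\<^sub>R \<xi> p" by (rule G.f_kernel[OF p])
    then have ffa: "f p (f p ?a) = 0" using F.ff[OF p, of ?a] by simp
    have red: "m Y p v = m (\<lambda>q. f q (f q (Y q))) p v + dfun M (\<lambda>q. \<eta> q (Y q)) p v *\<^sub>R \<xi> p"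
      if m: "canonical m" for m
    proof -
      note ml = m[unfolded canonical_def, THEN conjunct1]
      have xi0: "m \<xi> p v = 0" using m p unfolding canonical_def by blast
      note ffY = F.vfield_f[OF W(1) F.vfield_f[OF W(1) Y]] and xi = F.vfield_xi[OF W(1)] and eY = F.smooth_eta[OF W(1) Y]
      have "m Y p = m (\<lambda>q. f q (f q (Y q)) + \<eta> q (Y q) *\<^sub>R \<xi> q) p"
        by (rule linear_connectionD(5)[OF ml W(1) vfield_add[OF W(1) ffY vfield_scaleR[OF W(1) eY xi]] _ W(2)])
          (simp add: F.ff open_in_points[OF W(1)])
      then show ?thesis
        using linear_connectionD(3)[OF ml W(1) ffY vfield_scaleR[OF W(1) eY xi] W(2)]
          linear_connectionD(4)[OF ml W(1) xi eY W(2)] xi0 by simp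
    qed
    have "?a = A X (\<lambda>q. f q (f q (Y q)))" using red[OF n(1)] red[OF n(2)] X(2) by (simp add: A_def)
    also have "\<dots> = f p (f p ?a)" using Af[OF F.vfield_f[OF W(1) Y]] Af[OF Y] by simp
    finally show ?thesis using ffa X(2) by (simp add: A_def)
  qed
qed

end

section \<open>Extending fields from an immersed submanifold\<close>

locale immersion = smooth_incl L M
  for L :: "('a, 'l::euclidean_space) mfd" and M :: "('a, 'e::euclidean_space) mfd" +
  assumes inj_push: "\<And>q. q \<in> points L \<Longrightarrow> inj (push q)"
begin

text \<open>In charts \<open>d\<close> of \<open>L\<close> and \<open>c\<close> of \<open>M\<close> around \<open>p\<close>, a smooth map \<open>r\<close> defined on an open set of \<open>M\<close> that
  inverts the inclusion. Only a piece \<open>P\<close> of \<open>L\<close> around \<open>p\<close> is seen, not the other sheets of \<open>L\<close> that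
  may return close to \<open>p\<close>.\<close>

lemma local_retraction:
  assumes P0: "openin (mtop L) P0" "p \<in> P0" and dd: "d = chart_at L p" and cc: "c = chart_at M p"
  obtains P W r where "openin (mtop L) P" "p \<in> P" "P \<subseteq> P0" "P \<subseteq> fst d"
     "openin (mtop M) W" "W \<subseteq> fst c" "P \<subseteq> W"
     "smooth_on (snd c ` W) r" "r ` snd c ` W \<subseteq> snd d ` P" "\<And>q. q \<in> P \<Longrightarrow> r (snd c q) = snd d q"
proof -
  have pp: "p \<in> points L" "p \<in> points M" using P0 openin_subset sub by blast+
  have d: "d \<in> charts L" "p \<in> fst d" using L.chart_at[OF pp(1)] dd by simp_all
  have c: "c \<in> charts M" "p \<in> fst c" using M.chart_at[OF pp(2)] cc by simp_all
  let ?U = "snd d ` (fst d \<inter> (P0 \<inter> fst c))"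
  have o: "open ?U" using L.chart_image_open[OF d(1) open_inter[OF P0(1) M.chart_dom[OF c(1)]]] .
  have j: "smooth_on ?U (tr d c)" by (rule smooth_on_subset[OF smooth_tr[OF d(1) c(1)]]) blast
  have inj: "inj (fd (tr d c) (snd d p))" using inj_push[OF pp(1)] by (simp add: push_eq dd cc coord_at_def)
  have pU: "snd d p \<in> ?U" using d c P0 by blast
  obtain U' V r where r: "open U'" "snd d p \<in> U'" "U' \<subseteq> ?U" "open V" "smooth_on V r"
    "tr d c ` U' \<subseteq> V" "r ` V \<subseteq> U'" "\<And>x. x \<in> U' \<Longrightarrow> r (tr d c x) = x"
    using immersion_smooth_left_inverse[OF o pU j inj] by blast
  define P where "P = {q \<in> fst d. snd d q \<in> U'}"
  define W where "W = {q \<in> fst c. snd c q \<in> V}"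
  have PP: "q \<in> P0 \<and> q \<in> fst c" if "q \<in> P" for q
  proof -
    have "snd d q \<in> ?U" using that r(3) unfolding P_def by blast
    then obtain q' where q': "snd d q = snd d q'" "q' \<in> fst d \<inter> (P0 \<inter> fst c)" by (rule imageE)
    moreover have "q \<in> fst d" using that by (simp add: P_def)
    ultimately have "q = q'" using inj_onD[OF L.chart_inj[OF d(1)]] by blast
    then show ?thesis using q'(2) by blast
  qed
  have trq: "tr d c (snd d q) = snd c q" if "q \<in> P" for q using that d(1) by (simp add: P_def)
  have UP: "U' = snd d ` P" using r(3) unfolding P_def by blast
  have VW: "snd c ` W \<subseteq> V" unfolding W_def by blast
  have PW: "P \<subseteq> W"
  proof
    fix q assume q: "q \<in> P"
    then have "tr d c (snd d q) \<in> V" using r(6) unfolding P_def by blast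
    then show "q \<in> W" using PP[OF q] trq[OF q] by (simp add: W_def)
  qed
  show ?thesis
  proof (rule that)
    show "openin (mtop L) P" unfolding P_def by (rule L.chart_vimage_open[OF d(1) r(1)])
    show "openin (mtop M) W" unfolding W_def by (rule M.chart_vimage_open[OF c(1) r(4)])
    show "p \<in> P" using d r(2) by (simp add: P_def)
    show "smooth_on (snd c ` W) r" by (rule smooth_on_subset[OF r(5) VW])
    show "r ` snd c ` W \<subseteq> snd d ` P" using r(7) VW UP by blast
    show "r (snd c q) = snd d q" if "q \<in> P" for q
      using r(8)[of "snd d q"] trq[OF that] that by (simp add: P_def)
    show "P \<subseteq> P0" using PP by blast
    show "P \<subseteq> fst d" "W \<subseteq> fst c" unfolding P_def W_def by blast+
  qed (rule PW)
qed

definition extends :: "'a set \<Rightarrow> 'a set \<Rightarrow> ('a \<Rightarrow> 'l) \<Rightarrow> ('a \<Rightarrow> 'e) \<Rightarrow> bool" where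
  "extends P W Y Yh \<longleftrightarrow> openin (mtop L) P \<and> openin (mtop M) W \<and> P \<subseteq> W \<and> vfield M W Yh \<and>
     (\<forall>q\<in>P. Yh q = push q (Y q))"

lemma extendsD:
  assumes "extends P W Y Yh"
  shows "openin (mtop L) P" "openin (mtop M) W" "P \<subseteq> W" "vfield M W Yh" "\<And>q. q \<in> P \<Longrightarrow> Yh q = push q (Y q)"
  using assms by (auto simp: extends_def)

lemma extends_restrict:
  assumes "extends P W Y Yh" "openin (mtop L) P'" "openin (mtop M) W'" "P' \<subseteq> P" "P' \<subseteq> W'" "W' \<subseteq> W"
  shows "extends P' W' Y Yh"
  using assms M.vfield_subset unfolding extends_def by blast

text \<open>In the charts of a retraction \<open>r\<close>, with \<open>j\<close> the expression of the inclusion, the field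
  \<open>z \<mapsto> Dj (Y (r z))\<close>, with \<open>Dj\<close> taken at \<open>r z\<close>, is an extension.\<close>

lemma field_extension:
  assumes P0: "openin (mtop L) P0" "p \<in> P0" and Y: "vfield L P0 Y"
  shows "\<exists>P W Yh. p \<in> P \<and> P \<subseteq> P0 \<and> extends P W Y Yh"
proof -
  have pp: "p \<in> points L" "p \<in> points M" using P0 openin_subset sub by blast+
  define d where "d = chart_at L p"
  define c where "c = chart_at M p"
  have d: "d \<in> charts L" using L.chart_at[OF pp(1)] by (simp add: d_def)
  have c: "c \<in> charts M" using M.chart_at[OF pp(2)] by (simp add: c_def)
  obtain P W r where r: "openin (mtop L) P" "p \<in> P" "P \<subseteq> P0" "P \<subseteq> fst d"
     "openin (mtop M) W" "W \<subseteq> fst c" "P \<subseteq> W"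
     "smooth_on (snd c ` W) r" "r ` snd c ` W \<subseteq> snd d ` P" "\<And>q. q \<in> P \<Longrightarrow> r (snd c q) = snd d q"
    by (rule local_retraction[OF P0 d_def c_def]) blast
  have oP: "open (snd d ` P)" using L.chart_image_open[OF d r(1)] r(4) by (simp add: Int_absorb1)
  have oW: "open (snd c ` W)" using M.chart_image_open[OF c r(5)] r(6) by (simp add: Int_absorb1)
  have j: "smooth_on (snd d ` P) (tr d c)"
    by (rule smooth_on_subset[OF smooth_tr[OF d c]]) (use r(4,6,7) in blast)
  have y: "smooth_on (snd d ` P) (vf_rep L d Y)"
    by (rule smooth_on_subset[OF L.vfieldD[OF Y d]]) (use r(3,4) in blast)
  let ?y = "\<lambda>z. fd (tr d c) (r z) (vf_rep L d Y (r z))"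
  have sy: "smooth_on (snd c ` W) ?y"
    by (rule smooth_on_compose[OF oW oP r(9) smooth_on_fd_field[OF oP j y] r(8)])
  have "extends P W Y (M.chart_field c ?y)"
    unfolding extends_def
  proof (intro conjI ballI)
    show "vfield M W (M.chart_field c ?y)" by (rule M.vfield_chart_field[OF c r(5,6) sy])
    fix q assume q: "q \<in> P"
    then have qd: "q \<in> fst d" "q \<in> fst c" using r(4,6,7) by blast+
    have "tcoord M c q (M.chart_field c ?y q) = ?y (snd c q)"
      using M.vf_rep_chart_field[OF c qd(2), of ?y] M.vf_rep_at[OF c qd(2)] by simp
    also have "\<dots> = tcoord M c q (push q (Y q))"
      using r(10)[OF q] fd_tr_push[OF d qd(1) c qd(2)] L.vf_rep_at[OF d qd(1)] by simp
    finally show "M.chart_field c ?y q = push q (Y q)" by (rule M.tcoord_inj[OF c qd(2)])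
  qed (fact r)+
  then show ?thesis using r(2,3) by blast
qed

lemma function_extension:
  assumes P0: "openin (mtop L) P0" "p \<in> P0" and h: "smooth_fun L P0 h"
  shows "\<exists>P W hh. p \<in> P \<and> P \<subseteq> P0 \<and> openin (mtop L) P \<and> openin (mtop M) W \<and> P \<subseteq> W \<and>
    smooth_fun M W hh \<and> (\<forall>q\<in>P. hh q = h q)"
proof -
  have pp: "p \<in> points L" "p \<in> points M" using P0 openin_subset sub by blast+
  define d where "d = chart_at L p"
  define c where "c = chart_at M p"
  have d: "d \<in> charts L" using L.chart_at[OF pp(1)] by (simp add: d_def)
  have c: "c \<in> charts M" using M.chart_at[OF pp(2)] by (simp add: c_def)
  obtain P W r where r: "openin (mtop L) P" "p \<in> P" "P \<subseteq> P0" "P \<subseteq> fst d"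
     "openin (mtop M) W" "W \<subseteq> fst c" "P \<subseteq> W"
     "smooth_on (snd c ` W) r" "r ` snd c ` W \<subseteq> snd d ` P" "\<And>q. q \<in> P \<Longrightarrow> r (snd c q) = snd d q"
    by (rule local_retraction[OF P0 d_def c_def]) blast
  have oP: "open (snd d ` P)" using L.chart_image_open[OF d r(1)] r(4) by (simp add: Int_absorb1)
  have oW: "open (snd c ` W)" using M.chart_image_open[OF c r(5)] r(6) by (simp add: Int_absorb1)
  have h0: "smooth_on (snd d ` (fst d \<inter> P0)) (h \<circ> chart_inv d)" using h d by (simp add: smooth_fun_def)
  have h': "smooth_on (snd d ` P) (h \<circ> chart_inv d)"
    by (rule smooth_on_subset[OF h0]) (use r(3,4) in blast)
  have "smooth_on (snd c ` W) (\<lambda>z. (h \<circ> chart_inv d) (r z))"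
    by (rule smooth_on_compose[OF oW oP r(9) h' r(8)])
  from M.smooth_fun_in_chart[OF r(5) c r(6) this]
  have "smooth_fun M W (\<lambda>q. (h \<circ> chart_inv d) (r (snd c q)))" .
  moreover have "(h \<circ> chart_inv d) (r (snd c q)) = h q" if "q \<in> P" for q
    using r(10)[OF that] r(4) that L.chart_inv[OF d, of q] by (simp add: subset_iff)
  ultimately show ?thesis using r(1-3,5,7) by blast
qed

text \<open>In the charts of a retraction \<open>r\<close>, the field is recovered from its extension as \<open>Dr Xh\<close>.\<close>

lemma vfield_of_extension:
  assumes E: "extends P W X Xh" shows "vfield L P X"
proof (rule L.vfield_local)
  note e = extendsD[OF E]
  fix p assume p: "p \<in> P"
  have pp: "p \<in> points L" "p \<in> points M" using p e(1) openin_subset sub by blast+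
  define d where "d = chart_at L p"
  define c where "c = chart_at M p"
  have d: "d \<in> charts L" using L.chart_at[OF pp(1)] by (simp add: d_def)
  have c: "c \<in> charts M" using M.chart_at[OF pp(2)] by (simp add: c_def)
  obtain P' W' r where r: "openin (mtop L) P'" "p \<in> P'" "P' \<subseteq> P" "P' \<subseteq> fst d"
     "openin (mtop M) W'" "W' \<subseteq> fst c" "P' \<subseteq> W'"
     "smooth_on (snd c ` W') r" "r ` snd c ` W' \<subseteq> snd d ` P'" "\<And>q. q \<in> P' \<Longrightarrow> r (snd c q) = snd d q"
    by (rule local_retraction[OF e(1) p d_def c_def]) blast
  let ?V = "snd c ` (fst c \<inter> (W \<inter> W'))"
  have oV: "open ?V" using M.chart_image_open[OF c openin_Int[OF e(2) r(5)]] .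
  have oP: "open (snd d ` P')" using L.chart_image_open[OF d r(1)] r(4) by (simp add: Int_absorb1)
  have j: "smooth_on (snd d ` P') (tr d c)"
    by (rule smooth_on_subset[OF smooth_tr[OF d c]]) (use r(4,6,7) in blast)
  have trq: "tr d c (snd d q) = snd c q" if "q \<in> P'" for q using that L.chart_inv[OF d, of q] r(4) by (simp add: subset_iff)
  have im: "tr d c ` snd d ` P' \<subseteq> ?V"
  proof -
    have "snd c q \<in> ?V" if "q \<in> P'" for q using that r(3,6,7) e(3) by blast
    then show ?thesis using trq by (intro subsetI) (elim imageE, simp)
  qed
  have sr: "smooth_on ?V r" by (rule smooth_on_subset[OF r(8)]) blast
  have sX: "smooth_on ?V (vf_rep M c Xh)" by (rule smooth_on_subset[OF M.vfieldD[OF e(4) c]]) blast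
  have "smooth_on (snd d ` P') (\<lambda>x. fd r (tr d c x) (vf_rep M c Xh (tr d c x)))"
    by (rule smooth_on_compose[OF oP oV im smooth_on_fd_field[OF oV sr sX] j])
  then have "smooth_on (snd d ` P') (vf_rep L d X)"
  proof (rule smooth_on_cong[OF oP, rotated])
    fix x assume x: "x \<in> snd d ` P'"
    then obtain q where q: "q \<in> P'" "x = snd d q" by blast
    have qd: "q \<in> fst d" "q \<in> fst c" "q \<in> P" using q r(3,4,6,7) by blast+
    have Xr: "vf_rep M c Xh (tr d c x) = fd (tr d c) x (vf_rep L d X x)"
      using trq[OF q(1)] q(2) M.vf_rep_at[OF c qd(2)] L.vf_rep_at[OF d qd(1)] e(5)[OF qd(3)]
        fd_tr_push[OF d qd(1) c qd(2)] by simp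
    have "r differentiable (at (tr d c x))" using smooth_onD[OF sr] im x by blast
    then have ch: "fd (\<lambda>x. r (tr d c x)) x v = fd r (tr d c x) (fd (tr d c) x v)" for v
      by (rule fd_chain[OF _ smooth_onD[OF j x]])
    have rj: "fd (\<lambda>x. r (tr d c x)) x = fd (\<lambda>x. x) x"
    proof (rule fd_cong_open[OF oP x])
      fix y assume "y \<in> snd d ` P'"
      then obtain q' where q': "q' \<in> P'" "y = snd d q'" by blast
      show "r (tr d c y) = y" using trq[OF q'(1)] r(10)[OF q'(1)] q'(2) by simp
    qed
    show "fd r (tr d c x) (vf_rep M c Xh (tr d c x)) = vf_rep L d X x"
      unfolding Xr ch[symmetric] rj by simp
  qed
  then show "\<exists>W'. openin (mtop L) W' \<and> p \<in> W' \<and> vfield L W' X"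
    using L.vfield_in_chart[OF r(1) d r(4)] r(1,2) by blast
qed

end

section \<open>Connections along a submanifold\<close>

text \<open>In a coordinate frame, the coefficients of a field vanishing along \<open>L\<close> vanish along \<open>L\<close>, and so do
  their derivatives in directions tangent to \<open>L\<close>; the Leibniz rule leaves nothing.\<close>

lemma (in smooth_incl) connection_zero_along:
  assumes nab: "linear_connection M nab" and W: "openin (mtop M) W" "vfield M W Z"
    and P: "openin (mtop L) P" "P \<subseteq> W" "\<And>q. q \<in> P \<Longrightarrow> Z q = 0" and p: "p \<in> P"
  shows "nab Z p (push p u) = 0"
proof -
  have pM: "p \<in> points M" and pW: "p \<in> W" using p P openin_subset sub by blast+
  define c where "c = chart_at M p"
  have c: "c \<in> charts M" "p \<in> fst c" using M.chart_at[OF pM] by (auto simp: c_def)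
  define W' where "W' = W \<inter> fst c"
  have W': "openin (mtop M) W'" "p \<in> W'" "W' \<subseteq> fst c" "W' \<subseteq> W"
    using M.chart_nbhd[OF W(1) pW] by (auto simp: W'_def c_def)
  have Z: "vfield M W' Z" using M.vfield_subset[OF W(2) W'(4)] .
  let ?h = "\<lambda>b q. tcoord M c q (Z q) \<bullet> b" and ?E = "const_field M p"
  have E: "vfield M W' (?E b)" for b using M.vfield_subset[OF M.vfield_const_field[OF pM]] W'(3) by (simp add: c_def)
  have h: "smooth_fun M W' (?h b)" for b by (rule M.coord_function_smooth[OF W'(1) Z c(1) W'(3)])
  have hE: "vfield M W' (\<lambda>q. ?h b q *\<^sub>R ?E b q)" for b by (rule M.vfield_scaleR[OF W'(1) h E])
  have P': "openin (mtop L) (P \<inter> fst c)" "P \<inter> fst c \<subseteq> W'" "p \<in> P \<inter> fst c"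
    using open_inter[OF P(1) M.chart_dom[OF c(1)]] P(2) p c by (auto simp: W'_def)
  have hz: "?h b q = 0" if "q \<in> P \<inter> fst c" for b q
    using that P(3) linear_0[OF M.tcoord_linear[OF c(1)]] by simp
  have dh: "dfun M (?h b) p (push p u) = 0" for b
    using dfun_push[OF W'(1) h P'(1,2) hz[symmetric] P'(3), of u] by (simp add: L.dfun_const)
  have trm: "nab (\<lambda>q. ?h b q *\<^sub>R ?E b q) p (push p u) = 0" for b
    using linear_connectionD(4)[OF nab W'(1) E h W'(2)] dh hz[OF P'(3)] by simp
  have sum: "nab (\<lambda>q. \<Sum>b\<in>B. ?h b q *\<^sub>R ?E b q) p (push p u) = 0" if "finite B" "B \<noteq> {}" for B
    using that
  proof (induction B rule: finite_ne_induct)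
    case (singleton b)
    then show ?case using trm by simp
  next
    case (insert b B)
    have "vfield M W' (\<lambda>q. \<Sum>b\<in>B. ?h b q *\<^sub>R ?E b q)"
      by (rule M.vfield_sum[OF W'(1) hE insert.hyps(1,2)])
    from linear_connectionD(3)[OF nab W'(1) hE this W'(2), of b] trm insert show ?case by simp
  qed
  have "vfield M W' (\<lambda>q. \<Sum>b\<in>Basis. ?h b q *\<^sub>R ?E b q)"
    by (rule M.vfield_sum[OF W'(1) hE]) auto
  then have "nab Z p = nab (\<lambda>q. \<Sum>b\<in>Basis. ?h b q *\<^sub>R ?E b q) p"
    by (rule linear_connectionD(5)[OF nab W'(1)])
      (use M.local_frame[OF pM] W'(2,3) in \<open>auto simp: c_def\<close>)
  then show ?thesis using sum[of Basis] by simp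
qed

section \<open>Flatness along the eigendistribution\<close>

context normal_pair
begin

lemma canonicalD:
  assumes "canonical nab"
  shows "linear_connection M nab" "parallel11 M nab f" "parallel11 M nab g"
    "\<And>p v. p \<in> points M \<Longrightarrow> nab \<xi> p v = 0"
    "\<And>W X Y p. openin (mtop M) W \<Longrightarrow> vfield M W X \<Longrightarrow> vfield M W Y \<Longrightarrow> p \<in> W \<Longrightarrow>
      torsion M nab X Y p = (2 * dform M \<eta> X Y p) *\<^sub>R \<xi> p"
  using assms unfolding canonical_def by simp_all

lemma parallel_eigen:
  assumes nab: "canonical nab" and W: "openin (mtop M) W" "vfield M W Y" "p \<in> W"
    and eY: "\<And>q. q \<in> W \<Longrightarrow> f q (Y q) = s *\<^sub>R Y q"
  shows "f p (nab Y p v) = s *\<^sub>R nab Y p v"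
proof -
  note n = canonicalD[OF nab]
  have "f p (nab Y p v) = nab (\<lambda>q. f q (Y q)) p v" using parallel11D[OF n(2) W] by simp
  also have "nab (\<lambda>q. f q (Y q)) p = nab (\<lambda>q. s *\<^sub>R Y q) p"
    by (rule linear_connectionD(5)[OF n(1) W(1) vfield_cmul[OF W(1,2)] eY W(3)])
  finally show ?thesis using connection_cmul[OF n(1) W] by simp
qed

lemma eta_eigen: "p \<in> points M \<Longrightarrow> f p v = v \<Longrightarrow> \<eta> p v = 0"
  using F.eta_f[of p v] by simp

text \<open>On sections of the eigendistribution the canonical connection is the Bott connection of the
  foliation by the distribution spanned with the Reeb field, transported by \<open>g\<close>.\<close>

lemma connection_on_eigen:
  assumes nab: "canonical nab" and W: "openin (mtop M) W" "vfield M W X" "vfield M W Y" "p \<in> W"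
    and eX: "\<And>q. q \<in> W \<Longrightarrow> f q (X q) = X q" and eY: "\<And>q. q \<in> W \<Longrightarrow> f q (Y q) = Y q"
  shows "nab Y p (X p) = g p (Q p (bracket M X (\<lambda>q. g q (Y q)) p))"
proof -
  note n = canonicalD[OF nab] and p = open_in_points[OF W(1,4)] and q = open_in_points[OF W(1)]
  note gY = G.vfield_f[OF W(1,3)]
  have 1: "P p (nab Y p v) = nab Y p v" "P p (nab X p v) = nab X p v" for v
    using parallel_eigen[OF nab W(1,3,4), of 1 v] parallel_eigen[OF nab W(1,2,4), of 1 v] eX eY eigen_iff_P[OF p] by simp_all
  have "nab (\<lambda>q. g q (Y q)) p (X p) - nab X p (g p (Y p)) - bracket M X (\<lambda>q. g q (Y q)) p
      = (2 * dform M \<eta> X (\<lambda>q. g q (Y q)) p) *\<^sub>R \<xi> p"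
    using n(5)[OF W(1,2) gY W(4)] by (simp add: torsion_def)
  then have "Q p (nab (\<lambda>q. g q (Y q)) p (X p)) - Q p (nab X p (g p (Y p))) - Q p (bracket M X (\<lambda>q. g q (Y q)) p) = 0"
    using proj_lin_simps(7,8)[OF p] proj_simps(12)[OF p] by (metis scaleR_zero_right)
  moreover have "Q p (nab X p (g p (Y p))) = 0" using 1(2) proj_simps(8)[OF p] by metis
  moreover have "Q p (nab (\<lambda>q. g q (Y q)) p (X p)) = g p (nab Y p (X p))"
    using parallel11D[OF n(3) W(1,3,4)] proj_simps(14)[OF p] 1(1) by simp
  ultimately have "g p (nab Y p (X p)) = Q p (bracket M X (\<lambda>q. g q (Y q)) p)" by simp
  then have "g p (Q p (bracket M X (\<lambda>q. g q (Y q)) p)) = g p (g p (P p (nab Y p (X p))))" using 1(1) by simp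
  then show ?thesis using proj_simps(15)[OF p, of "nab Y p (X p)"] 1(1)[of "X p"] by simp
qed

text \<open>The eigendistribution and \<open>\<xi>\<close> together span an involutive distribution, which is the kernel of
  \<open>Q\<close>; so the components of \<open>U\<close> in that kernel do not contribute.\<close>

lemma Q_bracket_Q:
  assumes W: "openin (mtop M) W" "vfield M W X" "vfield M W U" "p \<in> W"
    and eX: "\<And>q. q \<in> W \<Longrightarrow> f q (X q) = X q"
  shows "Q p (bracket M X (\<lambda>q. Q q (U q)) p) = Q p (bracket M X U p)"
proof -
  note p = open_in_points[OF W(1,4)] and q = open_in_points[OF W(1)]
  note v = vfield_proj[OF W(1,3)] and xi = F.vfield_xi[OF W(1)]
  have H: "vfield M W (\<lambda>q. \<eta> q (U q) *\<^sub>R \<xi> q)" by (rule vfield_scaleR[OF W(1) F.smooth_eta[OF W(1,3)] xi])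
  have "bracket M X U p = bracket M X (\<lambda>q. P q (U q) + Q q (U q) + \<eta> q (U q) *\<^sub>R \<xi> q) p"
    by (rule bracket_cong[OF W(1,4)]) (use decomp in auto)
  also have "\<dots> = bracket M X (\<lambda>q. P q (U q)) p + bracket M X (\<lambda>q. Q q (U q)) p + bracket M X (\<lambda>q. \<eta> q (U q) *\<^sub>R \<xi> q) p"
    using bracket_add_right[OF W(1,4) vfield_add[OF W(1) v] H W(2)] bracket_add_right[OF W(1,4) v W(2)] by simp
  finally have 1: "Q p (bracket M X U p) = Q p (bracket M X (\<lambda>q. P q (U q)) p) + Q p (bracket M X (\<lambda>q. Q q (U q)) p)
      + Q p (bracket M X (\<lambda>q. \<eta> q (U q) *\<^sub>R \<xi> q) p)" by (simp add: proj_lin_simps[OF p])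
  have "f p (bracket M X (\<lambda>q. P q (U q)) p) = bracket M X (\<lambda>q. P q (U q)) p"
    using F.eigen_bracket[OF W(1,2) v(1) W(4), of 1] eX proj_simps(1)[OF q] by simp
  then have 2: "Q p (bracket M X (\<lambda>q. P q (U q)) p) = 0" using eigen_iff_P[OF p] proj_simps(8)[OF p] by metis
  have "bracket M \<xi> (\<lambda>q. f q (X q)) p = bracket M \<xi> X p" by (rule bracket_cong[OF W(1,4)]) (simp_all add: eX)
  then have "f p (bracket M \<xi> X p) = bracket M \<xi> X p" using F.xi_bracket_f[OF W(1,2,4)] by simp
  then have "Q p (bracket M \<xi> X p) = 0" using eigen_iff_P[OF p] proj_simps(8)[OF p] by metis
  then have "Q p (bracket M X \<xi> p) = 0" using bracket_antisym[of X \<xi> p] proj_lin_simps(9)[OF p] by simp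
  then have 3: "Q p (bracket M X (\<lambda>q. \<eta> q (U q) *\<^sub>R \<xi> q) p) = 0"
    using bracket_scaleR_right[OF W(1,4) xi W(2) F.smooth_eta[OF W(1,3)]]
    by (simp add: proj_lin_simps[OF p] proj_simps[OF p])
  show ?thesis using 1 2 3 by simp
qed

text \<open>The torsion is a multiple of \<open>d\<eta>\<close>, and \<open>\<eta>\<close> vanishes on the two sections and on their bracket.\<close>

lemma torsion_on_eigen:
  assumes nab: "canonical nab" and W: "openin (mtop M) W" "vfield M W X" "vfield M W Y" "p \<in> W"
    and eX: "\<And>q. q \<in> W \<Longrightarrow> f q (X q) = X q" and eY: "\<And>q. q \<in> W \<Longrightarrow> f q (Y q) = Y q"
  shows "torsion M nab X Y p = 0"
proof -
  note q = open_in_points[OF W(1)]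
  have "f p (bracket M X Y p) = bracket M X Y p"
    using F.eigen_bracket[OF W, of 1] eX eY by simp
  then have "\<eta> p (bracket M X Y p) = 0" using eta_eigen[OF q[OF W(4)]] by simp
  moreover have "dfun M (\<lambda>q. \<eta> q (X q)) p v = 0" "dfun M (\<lambda>q. \<eta> q (Y q)) p v = 0" for v
    by (rule dfun_zero_on[OF W(1,4)]; rule eta_eigen[OF q]; simp add: eX eY)+
  ultimately show ?thesis using canonicalD(5)[OF nab W] by (simp add: two_dform)
qed

text \<open>Iterating \<open>\<nabla>\<^sub>Y Z = g Q [Y, g Z]\<close>, the inner projection may be dropped, and the curvature becomes
  \<open>g Q\<close> applied to the Jacobi identity for \<open>X\<close>, \<open>Y\<close> and \<open>g Z\<close>.\<close>

lemma curvature_on_eigen: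
  assumes nab: "canonical nab" and W: "openin (mtop M) W" "vfield M W X" "vfield M W Y" "vfield M W Z" "p \<in> W"
    and e: "\<And>q. q \<in> W \<Longrightarrow> f q (X q) = X q" "\<And>q. q \<in> W \<Longrightarrow> f q (Y q) = Y q" "\<And>q. q \<in> W \<Longrightarrow> f q (Z q) = Z q"
  shows "curvature M nab X Y Z p = 0"
proof -
  note p = open_in_points[OF W(1,5)] and q = open_in_points[OF W(1)]
  note n = canonicalD[OF nab]
  note gZ = G.vfield_f[OF W(1,4)]
  let ?U = "\<lambda>q. g q (Z q)" and ?B = "bracket M"
  have iter: "nab (\<lambda>q. nab Z q (Y q)) p (X p) = g p (Q p (?B X (?B Y ?U) p))"
    if X: "vfield M W X" "\<And>q. q \<in> W \<Longrightarrow> f q (X q) = X q" and Y: "vfield M W Y" "\<And>q. q \<in> W \<Longrightarrow> f q (Y q) = Y q" for X Y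
  proof -
    have v: "vfield M W (\<lambda>q. nab Z q (Y q))" using linear_connectionD(2)[OF n(1) W(1,4) Y(1)] .
    have ev: "f q (nab Z q (Y q)) = nab Z q (Y q)" if "q \<in> W" for q
      using parallel_eigen[OF nab W(1,4) that, of 1] e(3) by simp
    have gv: "g q (nab Z q (Y q)) = Q q (?B Y ?U q)" if "q \<in> W" for q
      using connection_on_eigen[OF nab W(1) Y(1) W(4) that Y(2) e(3)] proj_simps(16)[OF q[OF that]] by simp
    have "nab (\<lambda>q. nab Z q (Y q)) p (X p) = g p (Q p (?B X (\<lambda>q. g q (nab Z q (Y q))) p))"
      by (rule connection_on_eigen[OF nab W(1) X(1) v W(5) X(2) ev])
    also have "?B X (\<lambda>q. g q (nab Z q (Y q))) p = ?B X (\<lambda>q. Q q (?B Y ?U q)) p"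
      by (rule bracket_cong[OF W(1,5)]) (simp_all add: gv)
    also have "Q p \<dots> = Q p (?B X (?B Y ?U) p)"
      by (rule Q_bracket_Q[OF W(1) X(1) vfield_bracket[OF W(1) Y(1) gZ] W(5) X(2)])
    finally show ?thesis .
  qed
  have eB: "f q (?B X Y q) = ?B X Y q" if "q \<in> W" for q
    using F.eigen_bracket[OF W(1-3) that, of 1] e by simp
  have 3: "nab Z p (?B X Y p) = g p (Q p (?B (?B X Y) ?U p))"
    by (rule connection_on_eigen[OF nab W(1) vfield_bracket[OF W(1-3)] W(4,5) eB e(3)])
  have 1: "nab (\<lambda>q. nab Z q (Y q)) p (X p) = g p (Q p (?B X (?B Y ?U) p))"
    by (rule iter[OF W(2) _ W(3)]) (simp_all add: e)
  have 2: "nab (\<lambda>q. nab Z q (X q)) p (Y p) = g p (Q p (?B Y (?B X ?U) p))"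
    by (rule iter[OF W(3) _ W(2)]) (simp_all add: e)
  show ?thesis
    unfolding curvature_def 1 2 3 bracket_jacobi[OF W(1,5,2,3) gZ] proj_lin_simps[OF p] G.f_simps[OF p] by simp
qed

end

section \<open>The induced connection on an integral manifold\<close>

locale integral_leaf = normal_pair M \<eta> \<xi> f g + I: immersion L M
  for M :: "('a, 'e::euclidean_space) mfd" and \<eta> \<xi> f g and L :: "('a, 'l::euclidean_space) mfd" +
  fixes nab
  assumes canon: "canonical nab"
    and tangent: "\<And>q. q \<in> points L \<Longrightarrow> range (I.push q) = {v. f q v = v}"
begin

lemma push_eigen: "q \<in> points L \<Longrightarrow> f q (I.push q u) = I.push q u"
  using tangent by blast

lemma conn: "linear_connection M nab"
  by (rule canonicalD(1)[OF canon])

text \<open>The field \<open>f Y - Y\<close> vanishes along \<open>L\<close>, hence so does its derivative in tangent directions, and the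
  connection commutes with \<open>f\<close>.\<close>

lemma covariant_tangent:
  assumes W: "openin (mtop M) W" "vfield M W Y" and N: "openin (mtop L) N" "N \<subseteq> W"
    and eY: "\<And>q. q \<in> N \<Longrightarrow> f q (Y q) = Y q" and q: "q \<in> N"
  shows "f q (nab Y q (I.push q u)) = nab Y q (I.push q u)"
proof -
  note fY = F.vfield_f[OF W]
  have qW: "q \<in> W" using q N by blast
  have "nab (\<lambda>q. f q (Y q) - Y q) q (I.push q u) = 0"
    by (rule I.connection_zero_along[OF conn W(1) vfield_diff[OF W(1) fY W(2)] N _ q]) (simp add: eY)
  then show ?thesis
    using connection_diff[OF conn W(1) fY W(2) qW] parallel11D[OF canonicalD(2)[OF canon] W qW] by simp
qed

lemma leaf_totally_geodesic: "totally_geodesic M nab L"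
  unfolding totally_geodesic_def tangent_space_def
proof (intro allI impI ballI, elim conjE)
  fix W N X Y q
  assume a: "openin (mtop M) W" "openin (mtop L) N" "N \<subseteq> W" "vfield M W Y"
    "\<forall>q\<in>N. X q \<in> range (mdiff L M (\<lambda>x. x) q) \<and> Y q \<in> range (mdiff L M (\<lambda>x. x) q)" and q: "q \<in> N"
  have L: "q \<in> points L" if "q \<in> N" for q using that a(2) openin_subset by blast
  obtain u where u: "X q = I.push q u" using a(5) q by blast
  have "f q (Y q) = Y q" if "q \<in> N" for q using a(5) that tangent[OF L[OF that]] by blast
  then show "nab Y q (X q) \<in> range (mdiff L M (\<lambda>x. x) q)"
    using covariant_tangent[OF a(1,4,2,3) _ q, of u] tangent[OF L[OF q]] u by auto
qed

text \<open>The induced derivative of a field of \<open>L\<close> is computed with any local extension of it to \<open>M\<close>.\<close>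

definition leaf_conn :: "('a \<Rightarrow> 'l) \<Rightarrow> 'a \<Rightarrow> 'l \<Rightarrow> 'l" where
  "leaf_conn Y p v = (if \<exists>W. openin (mtop L) W \<and> p \<in> W \<and> vfield L W Y
     then inv (I.push p) (nab (SOME Yh. \<exists>N W. p \<in> N \<and> I.extends N W Y Yh) p (I.push p v)) else 0)"

lemma connection_extension_unique:
  assumes E: "I.extends N W Y Yh" "p \<in> N" "I.extends N' W' Y Yh'" "p \<in> N'"
  shows "nab Yh p (I.push p v) = nab Yh' p (I.push p v)"
proof -
  note e = I.extendsD[OF E(1)] and e' = I.extendsD[OF E(3)]
  let ?W = "W \<inter> W'" and ?N = "N \<inter> N'"
  have W: "openin (mtop M) ?W" and N: "openin (mtop L) ?N" "?N \<subseteq> ?W" "p \<in> ?N" using e e' E(2,4) by auto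
  have v: "vfield M ?W Yh" "vfield M ?W Yh'"
    by (rule vfield_subset[OF e(4)], blast) (rule vfield_subset[OF e'(4)], blast)
  have "nab (\<lambda>q. Yh q - Yh' q) p (I.push p v) = 0"
    by (rule I.connection_zero_along[OF conn W vfield_diff[OF W v] N(1,2) _ N(3)]) (simp add: e(5) e'(5))
  moreover have "p \<in> ?W" using N(2,3) by blast
  ultimately show ?thesis using connection_diff[OF conn W v] by simp
qed

lemma push_leaf_conn:
  assumes E: "I.extends N W Y Yh" and p: "p \<in> N"
  shows "I.push p (leaf_conn Y p v) = nab Yh p (I.push p v)"
proof -
  note e = I.extendsD[OF E]
  have pL: "p \<in> points L" using p e(1) openin_subset by blast
  have ex: "\<exists>W. openin (mtop L) W \<and> p \<in> W \<and> vfield L W Y" using I.vfield_of_extension[OF E] e(1) p by blast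
  let ?Y = "SOME Yh. \<exists>N W. p \<in> N \<and> I.extends N W Y Yh"
  have "\<exists>N W. p \<in> N \<and> I.extends N W Y ?Y"
    by (rule someI[of "\<lambda>Yh. \<exists>N W. p \<in> N \<and> I.extends N W Y Yh"]) (use E p in blast)
  then obtain N' W' where E': "p \<in> N'" "I.extends N' W' Y ?Y" by blast
  have eq: "nab ?Y p (I.push p v) = nab Yh p (I.push p v)"
    by (rule connection_extension_unique[OF E'(2,1) E p])
  have L: "q \<in> points L" if "q \<in> N" for q using that e(1) openin_subset by blast
  have "f p (nab Yh p (I.push p v)) = nab Yh p (I.push p v)"
    by (rule covariant_tangent[OF e(2,4,1,3) _ p]) (simp add: e(5) push_eigen L)
  then have "nab Yh p (I.push p v) \<in> range (I.push p)" using tangent[OF pL] by blast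
  then have "I.push p (inv (I.push p) (nab Yh p (I.push p v))) = nab Yh p (I.push p v)" by (rule f_inv_into_f)
  then show ?thesis using ex eq unfolding leaf_conn_def by (simp only: if_True)
qed

lemma push_inject: "p \<in> points L \<Longrightarrow> I.push p a = I.push p b \<Longrightarrow> a = b"
  using I.inj_push injD by metis

text \<open>Projecting an arbitrary extension with \<open>P\<close> does not change it along \<open>L\<close>. An extension tangent to
  the eigendistribution on an open set of \<open>M\<close>, not only along \<open>L\<close>, is what the torsion and curvature
  formulas require.\<close>

lemma eigen_extension:
  assumes P0: "openin (mtop L) P0" "p \<in> P0" and Y: "vfield L P0 Y"
  shows "\<exists>N W Yh. p \<in> N \<and> N \<subseteq> P0 \<and> I.extends N W Y Yh \<and> (\<forall>q\<in>W. f q (Yh q) = Yh q)"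
proof -
  obtain N' W Yh where E: "p \<in> N'" "N' \<subseteq> P0" "I.extends N' W Y Yh" using I.field_extension[OF P0 Y] by blast
  note e = I.extendsD[OF E(3)]
  have "P q (Yh q) = I.push q (Y q)" if "q \<in> N'" for q
  proof -
    have "q \<in> points L" "q \<in> points M" using that e(1) I.sub openin_subset by blast+
    then show ?thesis using e(5)[OF that] push_eigen[of q "Y q"] eigen_iff_P[of q] by simp
  qed
  then have "I.extends N' W Y (\<lambda>q. P q (Yh q))"
    using e vfield_proj(1)[OF e(2,4)] by (simp add: I.extends_def)
  moreover have "f q (P q (Yh q)) = P q (Yh q)" if "q \<in> W" for q using proj_simps(1)[OF open_in_points[OF e(2) that]] .
  ultimately show ?thesis using E(1,2) by blast
qed

lemma common_extension:
  assumes P0: "openin (mtop L) P0" "p \<in> P0" and v: "vfield L P0 X" "vfield L P0 Y" "vfield L P0 Z"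
  obtains N W Xh Yh Zh where "p \<in> N" "N \<subseteq> P0" "I.extends N W X Xh" "I.extends N W Y Yh" "I.extends N W Z Zh"
    "\<And>q. q \<in> W \<Longrightarrow> f q (Xh q) = Xh q" "\<And>q. q \<in> W \<Longrightarrow> f q (Yh q) = Yh q" "\<And>q. q \<in> W \<Longrightarrow> f q (Zh q) = Zh q"
proof -
  obtain P1 W1 Xh where 1: "p \<in> P1" "P1 \<subseteq> P0" "I.extends P1 W1 X Xh" "\<forall>q\<in>W1. f q (Xh q) = Xh q"
    using eigen_extension[OF P0 v(1)] by blast
  obtain P2 W2 Yh where 2: "p \<in> P2" "P2 \<subseteq> P0" "I.extends P2 W2 Y Yh" "\<forall>q\<in>W2. f q (Yh q) = Yh q"
    using eigen_extension[OF P0 v(2)] by blast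
  obtain P3 W3 Zh where 3: "p \<in> P3" "P3 \<subseteq> P0" "I.extends P3 W3 Z Zh" "\<forall>q\<in>W3. f q (Zh q) = Zh q"
    using eigen_extension[OF P0 v(3)] by blast
  note e1 = I.extendsD[OF 1(3)] and e2 = I.extendsD[OF 2(3)] and e3 = I.extendsD[OF 3(3)]
  let ?N = "P1 \<inter> P2 \<inter> P3" and ?W = "W1 \<inter> W2 \<inter> W3"
  have o: "openin (mtop L) ?N" "openin (mtop M) ?W" using e1 e2 e3 by auto
  have s: "?N \<subseteq> ?W" using e1(3) e2(3) e3(3) by blast
  show ?thesis
  proof (rule that[of ?N ?W Xh Yh Zh])
    show "I.extends ?N ?W X Xh" by (rule I.extends_restrict[OF 1(3) o _ s]) blast+
    show "I.extends ?N ?W Y Yh" by (rule I.extends_restrict[OF 2(3) o _ s]) blast+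
    show "I.extends ?N ?W Z Zh" by (rule I.extends_restrict[OF 3(3) o _ s]) blast+
  qed (use 1 2 3 in auto)
qed

lemma extends_connection:
  assumes X: "I.extends N W X Xh" and Y: "I.extends N W Y Yh"
  shows "I.extends N W (\<lambda>q. leaf_conn Y q (X q)) (\<lambda>q. nab Yh q (Xh q))"
proof -
  note e = I.extendsD[OF Y] and ex = I.extendsD[OF X]
  have "vfield M W (\<lambda>q. nab Yh q (Xh q))" by (rule linear_connectionD(2)[OF conn e(2,4) ex(4)])
  then show ?thesis using e ex push_leaf_conn[OF Y] by (simp add: I.extends_def)
qed

text \<open>Each law is checked after pushing forward, where it is a law of \<open>nab\<close> for extensions: sums,
  multiples and covariant derivatives of extensions extend the corresponding fields of \<open>L\<close>.\<close>

lemma leaf_conn_linear_connection: "linear_connection L leaf_conn"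
  unfolding linear_connection_def
proof (intro conjI allI impI ballI; (elim conjE)?)
  fix W Y assume W: "openin (mtop L) W" and Y: "vfield L W Y"
  have L: "p \<in> points L" if "p \<in> W" for p using that W openin_subset by blast
  show "linear (leaf_conn Y p)" if p: "p \<in> W" for p
  proof -
    obtain N W' Yh where E: "p \<in> N" "I.extends N W' Y Yh" using I.field_extension[OF W p Y] by blast
    note e = I.extendsD[OF E(2)]
    have pW: "p \<in> W'" using E(1) e(3) by blast
    note l = linear_connectionD(1)[OF conn e(2,4) pW] and l' = I.push_linear[OF L[OF p]]
    note k = push_leaf_conn[OF E(2,1)]
    show ?thesis
      by (rule linearI; rule push_inject[OF L[OF p]])
        (simp_all only: k linear_add[OF l'] linear_add[OF l] linear_cmul[OF l'] linear_cmul[OF l])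
  qed
  show "vfield L W (\<lambda>p. leaf_conn Y p (X p))" if X: "vfield L W X" for X
  proof (rule I.L.vfield_local)
    fix p assume p: "p \<in> W"
    obtain N W' Xh Yh Zh where E: "p \<in> N" "N \<subseteq> W" "I.extends N W' X Xh" "I.extends N W' Y Yh"
      using common_extension[OF W p X Y Y] by metis
    show "\<exists>W'. openin (mtop L) W' \<and> p \<in> W' \<and> vfield L W' (\<lambda>p. leaf_conn Y p (X p))"
      using I.vfield_of_extension[OF extends_connection[OF E(3,4)]] I.extendsD(1)[OF E(3)] E(1) by blast
  qed
  show "leaf_conn (\<lambda>q. Y q + Z q) p v = leaf_conn Y p v + leaf_conn Z p v"
    if Z: "vfield L W Z" and p: "p \<in> W" for Z p v
  proof -
    obtain N W' Yh Zh where E: "p \<in> N" "N \<subseteq> W" "I.extends N W' Y Yh" "I.extends N W' Z Zh"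
      using common_extension[OF W p Y Z Z] by metis
    note e = I.extendsD[OF E(3)] and e' = I.extendsD[OF E(4)]
    have pW: "p \<in> W'" using E(1) e(3) by blast
    have lin: "I.push q (u + w) = I.push q u + I.push q w" if "q \<in> N" for q u w
      using linear_add[OF I.push_linear[OF L]] that E(2) by blast
    have S: "I.extends N W' (\<lambda>q. Y q + Z q) (\<lambda>q. Yh q + Zh q)"
      using e e' vfield_add[OF e(2,4) e'(4)] lin by (simp add: I.extends_def)
    show ?thesis
      by (rule push_inject[OF L[OF p]])
        (simp only: lin[OF E(1)] push_leaf_conn[OF S E(1)] push_leaf_conn[OF E(3,1)] push_leaf_conn[OF E(4,1)]
          linear_connectionD(3)[OF conn e(2,4) e'(4) pW])
  qed
  show "leaf_conn (\<lambda>q. h q *\<^sub>R Y q) p v = dfun L h p v *\<^sub>R Y p + h p *\<^sub>R leaf_conn Y p v"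
    if h: "smooth_fun L W h" and p: "p \<in> W" for h p v
  proof -
    obtain P1 W1 Yh where E: "p \<in> P1" "P1 \<subseteq> W" "I.extends P1 W1 Y Yh" using I.field_extension[OF W p Y] by blast
    obtain P2 W2 hh where H: "p \<in> P2" "P2 \<subseteq> W" "openin (mtop L) P2" "openin (mtop M) W2" "P2 \<subseteq> W2"
      "smooth_fun M W2 hh" "\<forall>q\<in>P2. hh q = h q" using I.function_extension[OF W p h] by blast
    let ?N = "P1 \<inter> P2" and ?W = "W1 \<inter> W2"
    note e1 = I.extendsD[OF E(3)]
    have o: "openin (mtop L) ?N" "openin (mtop M) ?W" using e1 H by auto
    have s: "?N \<subseteq> ?W" "p \<in> ?N" "p \<in> ?W" using e1 H E by auto
    have Y': "I.extends ?N ?W Y Yh" by (rule I.extends_restrict[OF E(3) o _ s(1)]) blast+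
    note e = I.extendsD[OF Y']
    have h': "smooth_fun M ?W hh" by (rule smooth_fun_subset[OF H(6)]) blast
    have lin: "I.push q (u + w) = I.push q u + I.push q w" "I.push q (r *\<^sub>R u) = r *\<^sub>R I.push q u" if "q \<in> ?N" for q u w r
      using linear_add[OF I.push_linear[OF L]] linear_cmul[OF I.push_linear[OF L]] that E(2) by blast+
    have S: "I.extends ?N ?W (\<lambda>q. h q *\<^sub>R Y q) (\<lambda>q. hh q *\<^sub>R Yh q)"
      using e vfield_scaleR[OF e(2) h' e(4)] lin H(7) by (simp add: I.extends_def)
    have d: "dfun L h p v = dfun M hh p (I.push p v)"
      by (rule I.dfun_push[OF o(2) h' o(1) s(1) _ s(2)]) (use H(7) in simp)
    have v: "hh p = h p" "Yh p = I.push p (Y p)" using H(1,7) e(5)[OF s(2)] by auto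
    show ?thesis
      by (rule push_inject[OF L[OF p]])
        (simp only: lin[OF s(2)] push_leaf_conn[OF S s(2)] push_leaf_conn[OF Y' s(2)]
          linear_connectionD(4)[OF conn e(2,4) h' s(3)] d v)
  qed
  show "leaf_conn Z p = leaf_conn Y p" if eq: "\<forall>q\<in>W. Z q = Y q" and p: "p \<in> W" for Z p
  proof
    fix v
    obtain N W' Yh where E: "p \<in> N" "N \<subseteq> W" "I.extends N W' Y Yh" using I.field_extension[OF W p Y] by blast
    have Z: "I.extends N W' Z Yh" using E(2,3) eq by (auto simp: I.extends_def)
    show "leaf_conn Z p v = leaf_conn Y p v"
      by (rule push_inject[OF L[OF p]]) (simp only: push_leaf_conn[OF Z E(1)] push_leaf_conn[OF E(3,1)])
  qed
next
  fix Y p assume "\<not> (\<exists>W. openin (mtop L) W \<and> p \<in> W \<and> vfield L W Y)"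
  then show "leaf_conn Y p = (\<lambda>v. 0)" unfolding leaf_conn_def by (simp only: if_False)
qed

lemma extends_bracket:
  assumes X: "I.extends N W X Xh" and Y: "I.extends N W Y Yh"
  shows "I.extends N W (bracket L X Y) (bracket M Xh Yh)"
proof -
  note e = I.extendsD[OF X] and e' = I.extendsD[OF Y]
  have "I.push q (bracket L X Y q) = bracket M Xh Yh q" if "q \<in> N" for q
    by (rule I.bracket_push[OF e(1,3,2) I.vfield_of_extension[OF X] e(4,5) I.vfield_of_extension[OF Y] e'(4,5) that])
  then show ?thesis using e vfield_bracket[OF e(2,4) e'(4)] by (simp add: I.extends_def)
qed

text \<open>Torsion and curvature of the induced connection push forward to those of \<open>nab\<close> on extensions
  tangent to the eigendistribution, where both vanish.\<close>

lemma leaf_affine: "affine_structure L leaf_conn"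
  unfolding affine_structure_def
proof (intro conjI allI impI ballI; (elim conjE)?)
  show "linear_connection L leaf_conn" by (rule leaf_conn_linear_connection)
next
  fix W X Y p assume W: "openin (mtop L) W" "vfield L W X" "vfield L W Y" "p \<in> W"
  have L: "p \<in> points L" using W openin_subset by blast
  obtain N W' Xh Yh where E: "p \<in> N" "N \<subseteq> W" "I.extends N W' X Xh" "I.extends N W' Y Yh"
    "\<And>q. q \<in> W' \<Longrightarrow> f q (Xh q) = Xh q" "\<And>q. q \<in> W' \<Longrightarrow> f q (Yh q) = Yh q"
    using common_extension[OF W(1,4,2,3,3)] by metis
  note e = I.extendsD[OF E(3)] and e' = I.extendsD[OF E(4)]
  have pW: "p \<in> W'" using E(1) e(3) by blast
  note l = linear_diff[OF I.push_linear[OF L]] linear_0[OF I.push_linear[OF L]]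
  have "I.push p (torsion L leaf_conn X Y p) = torsion M nab Xh Yh p"
    unfolding torsion_def l push_leaf_conn[OF E(4,1)] push_leaf_conn[OF E(3,1)]
    using e(5)[OF E(1)] e'(5)[OF E(1)] I.extendsD(5)[OF extends_bracket[OF E(3,4)] E(1)] by simp
  also have "\<dots> = I.push p 0" using torsion_on_eigen[OF canon e(2,4) e'(4) pW E(5,6)] l(2) by simp
  finally show "torsion L leaf_conn X Y p = 0" by (rule push_inject[OF L])
next
  fix W X Y Z p assume W: "openin (mtop L) W" "vfield L W X" "vfield L W Y" "vfield L W Z" "p \<in> W"
  have L: "p \<in> points L" using W openin_subset by blast
  obtain N W' Xh Yh Zh where E: "p \<in> N" "N \<subseteq> W" "I.extends N W' X Xh" "I.extends N W' Y Yh" "I.extends N W' Z Zh"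
    "\<And>q. q \<in> W' \<Longrightarrow> f q (Xh q) = Xh q" "\<And>q. q \<in> W' \<Longrightarrow> f q (Yh q) = Yh q" "\<And>q. q \<in> W' \<Longrightarrow> f q (Zh q) = Zh q"
    using common_extension[OF W(1,5,2,3,4)] by metis
  note e = I.extendsD[OF E(3)] and e' = I.extendsD[OF E(4)] and e'' = I.extendsD[OF E(5)]
  have pW: "p \<in> W'" using E(1) e(3) by blast
  note l = linear_diff[OF I.push_linear[OF L]] linear_0[OF I.push_linear[OF L]]
  have "I.push p (curvature L leaf_conn X Y Z p) = curvature M nab Xh Yh Zh p"
    unfolding curvature_def l push_leaf_conn[OF E(5,1)]
      push_leaf_conn[OF extends_connection[OF E(4,5)] E(1)] push_leaf_conn[OF extends_connection[OF E(3,5)] E(1)]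
    using e(5)[OF E(1)] e'(5)[OF E(1)] I.extendsD(5)[OF extends_bracket[OF E(3,4)] E(1)] by simp
  also have "\<dots> = I.push p 0" using curvature_on_eigen[OF canon e(2,4) e'(4) e''(4) pW E(6,7,8)] l(2) by simp
  finally show "curvature L leaf_conn X Y Z p = 0" by (rule push_inject[OF L])
qed

end

section \<open>The Legendre foliations\<close>

context normal_pair
begin

definition eigen :: "'a \<Rightarrow> 'e set" where "eigen p = {v. f p v = v}"

lemma subspace_eigen: "p \<in> points M \<Longrightarrow> subspace (eigen p)"
  by (auto simp: eigen_def subspace_def F.f_simps)

lemma eigen_legendre: "p \<in> points M \<Longrightarrow> eigen p \<subseteq> contact_distribution \<eta> p"
  by (auto simp: eigen_def contact_distribution_def eta_eigen)

lemma subspace_contact: "p \<in> points M \<Longrightarrow> subspace (contact_distribution \<eta> p)"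
  by (auto simp: contact_distribution_def subspace_def F.eta_simps)

lemma dim_contact:
  assumes p: "p \<in> points M" and dim: "DIM('e) = 2 * n + 1"
  shows "dim (contact_distribution \<eta> p) = 2 * n"
proof -
  let ?D = "contact_distribution \<eta> p" and ?X = "span {\<xi> p}"
  have xi0: "\<xi> p \<noteq> 0" using F.eta_xi[OF p] F.eta_simps(5)[OF p] by auto
  have sum: "{x + y |x y. x \<in> ?D \<and> y \<in> ?X} = UNIV"
  proof -
    have "v \<in> {x + y |x y. x \<in> ?D \<and> y \<in> ?X}" for v
    proof -
      have "v - \<eta> p v *\<^sub>R \<xi> p \<in> ?D" by (simp add: contact_distribution_def F.eta_simps[OF p] F.eta_xi[OF p])
      moreover have "\<eta> p v *\<^sub>R \<xi> p \<in> ?X" by (simp add: span_base span_scale)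
      moreover have "v = (v - \<eta> p v *\<^sub>R \<xi> p) + \<eta> p v *\<^sub>R \<xi> p" by simp
      ultimately show ?thesis by blast
    qed
    then show ?thesis by blast
  qed
  have int: "?D \<inter> ?X = {0}"
    using F.eta_xi[OF p] by (auto simp: contact_distribution_def span_singleton F.eta_simps[OF p])
  have "dim ?X = 1" using xi0 by (simp add: dim_eq_card_independent)
  then show ?thesis
    using dim_sums_Int[OF subspace_contact[OF p] subspace_span, of "{\<xi> p}"] dim unfolding sum int by simp
qed

text \<open>\<open>g\<close> exchanges the two eigendistributions of \<open>f\<close>, which span the contact distribution, so both
  have half its dimension.\<close>

lemma dim_eigen:
  assumes p: "p \<in> points M" and dim: "DIM('e) = 2 * n + 1"
  shows "dim (eigen p) = n"
proof -
  let ?N = "{v. f p v = - v}"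
  have sN: "subspace ?N" by (auto simp: subspace_def F.f_simps[OF p])
  have gg: "g p (g p v) = v" if "f p v = v \<or> f p v = - v" for v
  proof -
    have "\<eta> p (f p v) = 0" by (rule F.eta_f[OF p])
    then have "\<eta> p v = 0" using that by (auto simp: F.eta_simps[OF p])
    then show ?thesis using G.ff[OF p] by simp
  qed
  have lin: "linear (g p)" by (rule G.lin_f[OF p])
  have im: "g p ` eigen p = ?N"
  proof (intro subset_antisym image_subsetI subsetI)
    fix v assume "v \<in> eigen p" then show "g p v \<in> ?N" by (simp add: eigen_def anti[OF p])
  next
    fix v assume v: "v \<in> ?N"
    then have "g p v \<in> eigen p" by (simp add: eigen_def anti[OF p] G.f_simps[OF p])
    moreover have "v = g p (g p v)" using gg v by simp
    ultimately show "v \<in> g p ` eigen p" by (rule rev_image_eqI)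
  qed
  have inj: "inj_on (g p) (eigen p)"
    by (rule inj_on_inverseI[of _ "g p"]) (simp add: gg eigen_def)
  have sp: "span (eigen p) = eigen p" using subspace_eigen[OF p] by (simp add: span_eq_iff)
  have "dim ?N = dim (eigen p)" using dim_image_eq[OF lin, of "eigen p"] inj im sp by simp
  moreover have "{x + y |x y. x \<in> eigen p \<and> y \<in> ?N} = contact_distribution \<eta> p"
  proof (intro subset_antisym subsetI)
    fix v assume "v \<in> {x + y |x y. x \<in> eigen p \<and> y \<in> ?N}"
    then obtain x y where xy: "v = x + y" "f p x = x" "f p y = - y" by (auto simp: eigen_def)
    have "\<eta> p y = 0" using F.eta_f[OF p, of y] xy(3) by (simp add: F.eta_simps[OF p])
    then show "v \<in> contact_distribution \<eta> p" using xy eta_eigen[OF p xy(2)] by (simp add: contact_distribution_def F.eta_simps[OF p])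
  next
    fix v assume "v \<in> contact_distribution \<eta> p"
    then have "v = P p v + Q p v" using decomp[of v p] by (simp add: contact_distribution_def)
    moreover have "P p v \<in> eigen p" "Q p v \<in> ?N" by (simp_all add: eigen_def proj_simps[OF p])
    ultimately show "v \<in> {x + y |x y. x \<in> eigen p \<and> y \<in> ?N}" by blast
  qed
  moreover have "eigen p \<inter> ?N = {0}"
  proof -
    have "v = 0" if "f p v = v" "f p v = - v" for v using that eq_minus_self[of v] by simp
    then show ?thesis by (auto simp: eigen_def F.f_simps[OF p])
  qed
  ultimately show ?thesis
    using dim_sums_Int[OF subspace_eigen[OF p] sN] dim_contact[OF p dim] by simp
qed

text \<open>A local frame near \<open>p\<close>: project a constant extension of a basis at \<open>p\<close>. The projected fields
  stay independent near \<open>p\<close>, hence span for reasons of dimension.\<close>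

lemma subbundle_eigen:
  assumes dim: "DIM('e) = 2 * n + 1"
  shows "subbundle M n eigen"
  unfolding subbundle_def
proof
  fix p assume p: "p \<in> points M"
  define c where "c = chart_at M p"
  have c: "c \<in> charts M" "p \<in> fst c" using chart_at[OF p] by (simp_all add: c_def)
  let ?E = "\<lambda>w q. P q (const_field M p w q)"
  have vE: "vfield M (fst c) (?E w)" for w
    unfolding c_def using vfield_const_field[OF p] chart_dom chart_at[OF p] by (intro vfield_proj(1)) blast
  have linE: "linear (\<lambda>w. ?E w q)" if q: "q \<in> fst c" for q
  proof -
    have qM: "q \<in> points M" using dom_points[OF c(1) q] .
    have "linear (\<lambda>w. const_field M p w q)"
      unfolding const_field_eq chart_field_def c_def[symmetric]
      using self.diff_tr[OF c(1) _ q] chart_at[OF qM] by (intro linear_frechet_derivative) blast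
    from linear_compose[OF this proj_linear(1)[OF qM]] show ?thesis by (simp add: o_def)
  qed
  let ?A = "\<lambda>z w. vf_rep M c (?E w) z"
  let ?S = "snd c ` fst c"
  have S: "open ?S" "snd c p \<in> ?S" using chart_image_open[OF c(1) chart_dom[OF c(1)]] c by auto
  have Aq: "?A (snd c q) w = tcoord M c q (?E w q)" if "q \<in> fst c" for q w using vf_rep_at[OF c(1) that] .
  have linA: "linear (?A z)" if "z \<in> ?S" for z
  proof -
    obtain q where q: "q \<in> fst c" "z = snd c q" using \<open>z \<in> ?S\<close> by blast
    show ?thesis using linear_compose[OF linE[OF q(1)] tcoord_linear[OF c(1) q(1)]] Aq[OF q(1)] q(2) by (simp add: o_def)
  qed
  have contA: "continuous_on ?S (\<lambda>z. ?A z w)" for w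
    using smooth_on_continuous[OF vfieldD[OF vE c(1)]] by simp
  have A0: "?A (snd c p) w = w" if "w \<in> eigen p" for w
    using that Aq[OF c(2)] tcoord_at[OF p] const_field_at[OF p] eigen_iff_P[OF p] by (simp add: c_def eigen_def)
  have "\<exists>k U. k > 0 \<and> open U \<and> snd c p \<in> U \<and> U \<subseteq> ?S \<and> (\<forall>z\<in>U. \<forall>w\<in>eigen p. k * norm w \<le> norm (?A z w))"
    by (rule linear_inj_bounded_below_near[OF linA S contA subspace_eigen[OF p]]) (use A0 in auto)
  then obtain k U where U: "k > 0" "open U" "snd c p \<in> U" "U \<subseteq> ?S"
    "\<And>z w. z \<in> U \<Longrightarrow> w \<in> eigen p \<Longrightarrow> k * norm w \<le> norm (?A z w)" by blast
  define W where "W = {q \<in> fst c. snd c q \<in> U}"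
  have W: "openin (mtop M) W" "p \<in> W" unfolding W_def using chart_vimage_open[OF c(1) U(2)] c U(3) by simp_all
  obtain B where B: "B \<subseteq> eigen p" "independent B" "eigen p \<subseteq> span B" "card B = dim (eigen p)"
    using basis_exists by blast
  have spB: "span B = eigen p" using B(1,3) span_minimal[OF B(1) subspace_eigen[OF p]] by blast
  have "finite B" using independent_imp_finite[OF B(2)] .
  then obtain h where "bij_betw h {0..<card B} B" using ex_bij_betw_nat_finite by blast
  then have h: "h ` {..<n} = B" using B(4) dim_eigen[OF p dim] by (simp add: bij_betw_def atLeast0LessThan)
  have frame: "eigen q = span ((\<lambda>i. ?E (h i) q) ` {..<n})" if q: "q \<in> W" for q
  proof -
    have qc: "q \<in> fst c" and qU: "snd c q \<in> U" using q by (auto simp: W_def)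
    have qM: "q \<in> points M" using dom_points[OF c(1) qc] .
    let ?L = "\<lambda>w. ?E w q"
    interpret T: linear "tcoord M c q" by (rule tcoord_linear[OF c(1) qc])
    have z: "w = 0" if "w \<in> eigen p" "?L w = 0" for w
    proof -
      have "?A (snd c q) w = 0" using Aq[OF qc] that(2) T.zero by simp
      then have "k * norm w \<le> 0" using U(5)[OF qU that(1)] by simp
      then show ?thesis using U(1) by (simp add: mult_le_0_iff)
    qed
    have inj: "inj_on ?L (span (eigen p))"
    proof (rule inj_onI)
      fix v w assume "v \<in> span (eigen p)" "w \<in> span (eigen p)" and eq: "?L v = ?L w"
      then have vw: "v \<in> eigen p" "w \<in> eigen p" using subspace_eigen[OF p] by (simp_all add: span_eq_iff[THEN iffD2])
      have "v - w = 0"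
        by (rule z) (use vw subspace_diff[OF subspace_eigen[OF p]] eq linear_diff[OF linE[OF qc]] in auto)
      then show "v = w" by simp
    qed
    have sub: "?L ` eigen p \<subseteq> eigen q" using proj_simps(1)[OF qM] by (auto simp: eigen_def)
    have dL: "dim (?L ` eigen p) = n" using dim_image_eq[OF linE[OF qc] inj] dim_eigen[OF p dim] by simp
    have "?L ` eigen p = eigen q"
      by (rule subspace_dim_equal[OF linear_subspace_image[OF linE[OF qc] subspace_eigen[OF p]] subspace_eigen[OF qM] sub])
        (simp add: dL dim_eigen[OF qM dim])
    moreover have "span ((\<lambda>i. ?E (h i) q) ` {..<n}) = ?L ` span B"
      using linear_span_image[OF linE[OF qc], of B] by (simp add: h[symmetric] image_image)
    ultimately show ?thesis using spB by simp
  qed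
  show "\<exists>W E. openin (mtop M) W \<and> p \<in> W \<and> (\<forall>i<n. vfield M W (E i)) \<and>
     (\<forall>q\<in>W. eigen q = span ((\<lambda>i. E i q) ` {..<n}) \<and> dim (eigen q) = n)"
  proof (intro exI conjI allI impI ballI)
    show "openin (mtop M) W" "p \<in> W" by (fact W)+
    show "vfield M W (?E (h i))" for i by (rule vfield_subset[OF vE]) (simp add: W_def)
    show "eigen q = span ((\<lambda>i. ?E (h i) q) ` {..<n})" if "q \<in> W" for q by (rule frame[OF that])
    show "dim (eigen q) = n" if "q \<in> W" for q using dim_eigen[OF open_in_points[OF W(1) that] dim] .
  qed
qed

lemma legendre_eigen:
  assumes dim: "DIM('e) = 2 * n + 1" shows "legendre_foliation M n \<eta> eigen"
  unfolding legendre_foliation_def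
proof (intro conjI ballI subbundle_eigen[OF dim] eigen_legendre)
  show "involutive M eigen"
    unfolding involutive_def
  proof (intro allI impI ballI, elim conjE)
    fix W X Y q assume a: "openin (mtop M) W" "vfield M W X" "vfield M W Y" "\<forall>q\<in>W. X q \<in> eigen q \<and> Y q \<in> eigen q" "q \<in> W"
    show "bracket M X Y q \<in> eigen q"
      using F.eigen_bracket[OF a(1,2,3,5), of 1] a(4) by (simp add: eigen_def)
  qed
qed

end

lemma complementary_halves:
  fixes S T D :: "'e::euclidean_space set"
  assumes "subspace S" "subspace T" "subspace D" "S \<subseteq> D" "T \<subseteq> D" "S \<inter> T = {0}"
    and "dim S = n" "dim T = n" "dim D = 2 * n"
  shows "{v + w |v w. v \<in> S \<and> w \<in> T} = D"
proof (rule subspace_dim_equal)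
  show "subspace {v + w |v w. v \<in> S \<and> w \<in> T}" by (rule subspace_sums[OF assms(1,2)])
  show "{v + w |v w. v \<in> S \<and> w \<in> T} \<subseteq> D" using assms(4,5) subspace_add[OF assms(3)] by blast
  show "dim {v + w |v w. v \<in> S \<and> w \<in> T} \<ge> dim D"
    using dim_sums_Int[OF assms(1,2)] assms(6-9) by simp
qed (rule assms)

lemma normal_pair_of_bi_paracontact:
  assumes "contact_manifold M n \<eta>" "reeb_field M \<eta> \<xi>" "normal_bi_paracontact M \<eta> \<xi> \<phi>1 \<phi>2 \<phi>3"
  shows "normal_pair M \<eta> \<xi> \<phi>1 \<phi>2"
proof -
  have c: "smooth_manifold M" "one_form M \<eta>" using assms(1) by (simp_all add: contact_manifold_def)
  have r: "vfield M (points M) \<xi>" "\<forall>p\<in>points M. \<eta> p (\<xi> p) = 1"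
    "\<forall>W X. openin (mtop M) W \<and> vfield M W X \<longrightarrow> (\<forall>p\<in>W. dform M \<eta> \<xi> X p = 0)"
    using assms(2) by (simp_all add: reeb_field_def)
  note s = assms(3)[unfolded normal_bi_paracontact_def almost_bi_paracontact_def]
  show ?thesis
  proof
    show "smooth_manifold M" "one_form M \<eta>" "vfield M (points M) \<xi>" by (fact c r)+
    show "tensor11 M \<phi>1" "tensor11 M \<phi>2" using s by blast+
    show "\<eta> p (\<xi> p) = 1" if "p \<in> points M" for p using r that by blast
    show "dform M \<eta> \<xi> X p = 0" if "openin (mtop M) W" "vfield M W X" "p \<in> W" for W X p using r(3) that by blast
    show "\<phi>1 p (\<phi>1 p v) = v - \<eta> p v *\<^sub>R \<xi> p" "\<phi>2 p (\<phi>2 p v) = v - \<eta> p v *\<^sub>R \<xi> p"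
      "\<phi>1 p (\<phi>2 p v) = - \<phi>2 p (\<phi>1 p v)" if "p \<in> points M" for p v
      using s that by blast+
    show "nijenhuis M \<phi>1 X Y p = (2 * dform M \<eta> X Y p) *\<^sub>R \<xi> p" "nijenhuis M \<phi>2 X Y p = (2 * dform M \<eta> X Y p) *\<^sub>R \<xi> p"
      if "openin (mtop M) W" "vfield M W X" "vfield M W Y" "p \<in> W" for W X Y p
      using s that by (metis right_minus_eq)+
  qed
qed

text \<open>The definite description picks the constructed connection; parallelism of \<open>\<phi>\<^sub>3 = \<phi>\<^sub>1 \<phi>\<^sub>2\<close> follows
  from that of the factors.\<close>

lemma canonical_connection_canonical:
  assumes "normal_pair M \<eta> \<xi> \<phi>1 \<phi>2" and "almost_bi_paracontact M \<eta> \<xi> \<phi>1 \<phi>2 \<phi>3"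
  shows "normal_pair.canonical M \<eta> \<xi> \<phi>1 \<phi>2 (canonical_connection M \<eta> \<xi> \<phi>1 \<phi>2 \<phi>3)"
proof -
  interpret normal_pair M \<eta> \<xi> \<phi>1 \<phi>2 by fact
  have prod: "parallel11 M nab \<phi>3" if "canonical nab" for nab
    unfolding parallel11_def
  proof (intro allI impI ballI, elim conjE)
    fix W Y p v assume W: "openin (mtop M) W" "vfield M W Y" "p \<in> W"
    note n = canonicalD[OF that]
    have phi3: "\<phi>3 q u = \<phi>1 q (\<phi>2 q u)" if "q \<in> W" for q u
      using assms(2) open_in_points[OF W(1) that] unfolding almost_bi_paracontact_def by blast
    note v2 = G.vfield_f[OF W(1,2)]
    have "nab (\<lambda>q. \<phi>3 q (Y q)) p = nab (\<lambda>q. \<phi>1 q (\<phi>2 q (Y q))) p"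
      by (rule linear_connectionD(5)[OF n(1) W(1) F.vfield_f[OF W(1) v2] _ W(3)]) (simp add: phi3)
    then show "nab (\<lambda>q. \<phi>3 q (Y q)) p v - \<phi>3 p (nab Y p v) = 0"
      using parallel11D[OF n(2) W(1) v2 W(3)] parallel11D[OF n(3) W] phi3[OF W(3)] by simp
  qed
  have "canonical_connection M \<eta> \<xi> \<phi>1 \<phi>2 \<phi>3 = (THE nab. canonical nab \<and> parallel11 M nab \<phi>3)"
    unfolding canonical_connection_def canonical_def by (rule arg_cong[of _ _ The]) (auto simp: fun_eq_iff)
  also have "\<dots> = cov_conn"
    by (rule the_equality) (use canonical_cov_conn prod canonical_unique in blast)+
  finally show ?thesis using canonical_cov_conn by simp
qed

lemma canonical_minus:
  assumes "normal_pair M \<eta> \<xi> f g" "normal_pair.canonical M \<eta> \<xi> f g nab"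
  shows "normal_pair.canonical M \<eta> \<xi> (\<lambda>p v. - f p v) g nab"
proof -
  interpret normal_pair M \<eta> \<xi> f g by fact
  interpret neg: normal_pair M \<eta> \<xi> "\<lambda>p v. - f p v" g by (rule normal_pair_minus[OF assms(1)])
  note n = canonicalD[OF assms(2)]
  have "parallel11 M nab (\<lambda>p v. - f p v)"
    unfolding parallel11_def
  proof (intro allI impI ballI, elim conjE)
    fix W Y p v assume W: "openin (mtop M) W" "vfield M W Y" "p \<in> W"
    show "nab (\<lambda>q. - f q (Y q)) p v - - f p (nab Y p v) = 0"
      using connection_cmul[OF n(1) W(1) F.vfield_f[OF W(1,2)] W(3), of "-1" v] parallel11D[OF n(2) W] by simp
  qed
  then show ?thesis using assms(2) unfolding canonical_def neg.canonical_def by blast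
qed

lemma canonical_swap:
  assumes "normal_pair M \<eta> \<xi> f g" "normal_pair.canonical M \<eta> \<xi> f g nab"
  shows "normal_pair.canonical M \<eta> \<xi> g f nab"
proof -
  interpret normal_pair M \<eta> \<xi> f g by fact
  interpret swap: normal_pair M \<eta> \<xi> g f by (rule normal_pair_swap[OF assms(1)])
  show ?thesis using assms(2) unfolding canonical_def swap.canonical_def by blast
qed

lemma leaf_of_eigen:
  fixes L :: "('a, 'l::euclidean_space) mfd"
  assumes "normal_pair M \<eta> \<xi> f g" "normal_pair.canonical M \<eta> \<xi> f g nab"
    and leaf: "leaf M (normal_pair.eigen f) L"
  shows "totally_geodesic M nab L" "\<exists>nab. affine_structure L nab"
proof -
  interpret normal_pair M \<eta> \<xi> f g by fact
  have i: "smooth_manifold L" "points L \<subseteq> points M" "smooth_map L M (\<lambda>x. x)"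
    "\<And>p. p \<in> points L \<Longrightarrow> inj (mdiff L M (\<lambda>x. x) p)"
    "\<And>p. p \<in> points L \<Longrightarrow> range (mdiff L M (\<lambda>x. x) p) = eigen p"
    using leaf unfolding leaf_def integral_manifold_def immersed_submanifold_def tangent_space_def by simp_all
  interpret I: smooth_incl L M
    by unfold_locales (use i mfd in auto)
  interpret integral_leaf M \<eta> \<xi> f g L nab
    by unfold_locales (use i assms(2) in \<open>auto simp: eigen_def\<close>)
  show "totally_geodesic M nab L" by (rule leaf_totally_geodesic)
  show "\<exists>nab. affine_structure L nab" using leaf_affine by blast
qed

theorem corollary4p6:
  fixes M :: "('a, 'm::euclidean_space) mfd"
    and n :: nat
    and \<eta> :: "'a \<Rightarrow> 'm \<Rightarrow> real"
    and \<xi> :: "'a \<Rightarrow> 'm"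
    and \<phi>1 \<phi>2 \<phi>3 :: "'a \<Rightarrow> 'm \<Rightarrow> 'm"
  assumes "DIM('l::euclidean_space) = n"
    and "contact_manifold M n \<eta>"
    and "reeb_field M \<eta> \<xi>"
    and "normal_bi_paracontact M \<eta> \<xi> \<phi>1 \<phi>2 \<phi>3"
  shows "\<exists>F :: nat \<Rightarrow> 'a \<Rightarrow> 'm set.
     (\<forall>i<4. legendre_foliation M n \<eta> (F i)) \<and>
     (\<forall>i<4. \<forall>j<4. i \<noteq> j \<longrightarrow> transverse M \<eta> (F i) (F j)) \<and>
     (\<forall>i<4. \<forall>L :: ('a, 'l) mfd. leaf M (F i) L \<longrightarrow>
        totally_geodesic M (canonical_connection M \<eta> \<xi> \<phi>1 \<phi>2 \<phi>3) L \<and>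
        (\<exists>nab. affine_structure L nab))"
proof -
  let ?nab = "canonical_connection M \<eta> \<xi> \<phi>1 \<phi>2 \<phi>3"
  have dim: "DIM('m) = 2 * n + 1" using assms(2) by (simp add: contact_manifold_def)
  have ts12: "normal_pair M \<eta> \<xi> \<phi>1 \<phi>2" by (rule normal_pair_of_bi_paracontact[OF assms(2-4)])
  have can12: "normal_pair.canonical M \<eta> \<xi> \<phi>1 \<phi>2 ?nab"
    using canonical_connection_canonical[OF ts12] assms(4) by (simp add: normal_bi_paracontact_def)
  note ts21 = normal_pair_swap[OF ts12] and can21 = canonical_swap[OF ts12 can12]
  \<comment> \<open>The foliations are the \<open>+1\<close> eigendistributions of \<open>\<psi> i\<close>; \<open>\<kappa> i\<close> is the partner that completes the pair.\<close>
  define \<psi> where "\<psi> = (\<lambda>i::nat. if i = 0 then \<phi>1 else if i = 1 then (\<lambda>p v. - \<phi>1 p v)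
    else if i = 2 then \<phi>2 else (\<lambda>p v. - \<phi>2 p v))"
  define \<kappa> where "\<kappa> = (\<lambda>i::nat. if i < 2 then \<phi>2 else \<phi>1)"
  have four: "i = 0 \<or> i = 1 \<or> i = 2 \<or> i = 3" if "i < 4" for i :: nat using that by auto
  have ts: "normal_pair M \<eta> \<xi> (\<psi> i) (\<kappa> i)" and can: "normal_pair.canonical M \<eta> \<xi> (\<psi> i) (\<kappa> i) ?nab" if "i < 4" for i
    using four[OF that] ts12 ts21 can12 can21 normal_pair_minus[OF ts12] normal_pair_minus[OF ts21]
      canonical_minus[OF ts12 can12] canonical_minus[OF ts21 can21]
    by (auto simp: \<psi>_def \<kappa>_def)
  interpret S: normal_pair M \<eta> \<xi> \<phi>1 \<phi>2 by (rule ts12)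
  \<comment> \<open>If \<open>\<phi>\<^sub>1 v = s v\<close> and \<open>\<phi>\<^sub>2 v = t v\<close>, anticommutation gives \<open>s t v = - s t v\<close>.\<close>
  have zero: "v = 0" if p: "p \<in> points M" and ij: "i < 4" "j < 4" "i \<noteq> j" and v: "\<psi> i p v = v" "\<psi> j p v = v" for i j p v
  proof -
    have neg: "x = - y" if "- x = y" for x y :: 'm using that by auto
    have sgn: "(k < 2 \<and> \<phi>1 p v = (if k = 0 then 1 else - 1) *\<^sub>R v) \<or>
        (2 \<le> k \<and> \<phi>2 p v = (if k = 2 then 1 else - 1) *\<^sub>R v)" if "k < 4" "\<psi> k p v = v" for k
      using four[OF that(1)] that(2) by (elim disjE) (simp_all add: \<psi>_def neg)
    have same: "v = 0" if "w = s *\<^sub>R v" "w = t *\<^sub>R v" "s = - t" "t \<noteq> 0" for w and s t :: real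
    proof -
      have "t *\<^sub>R v = - (t *\<^sub>R v)" using that(1-3) by simp
      then have "t *\<^sub>R v = 0" by (rule eq_minus_self)
      then show ?thesis using that(4) by simp
    qed
    have mixed: "v = 0" if "\<phi>1 p v = s *\<^sub>R v" "\<phi>2 p v = t *\<^sub>R v" "s * t \<noteq> 0" for s t :: real
    proof -
      have "(s * t) *\<^sub>R v = - ((s * t) *\<^sub>R v)"
        using S.anti[OF p, of v] that(1,2) by (simp add: S.F.f_simps[OF p] S.G.f_simps[OF p] mult.commute)
      then have "(s * t) *\<^sub>R v = 0" by (rule eq_minus_self)
      then show ?thesis using that(3) by simp
    qed
    have sg: "(if b then 1 else - 1 :: real) \<noteq> 0" for b by simp
    consider "i < 2" "j < 2" | "2 \<le> i" "2 \<le> j" | "i < 2" "2 \<le> j" | "2 \<le> i" "j < 2" by linarith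
    then show ?thesis
    proof cases
      case 1
      have "(if i = 0 then 1 else - 1 :: real) = - (if j = 0 then 1 else - 1)" using 1 ij(3) by auto
      moreover have "\<phi>1 p v = (if i = 0 then 1 else - 1) *\<^sub>R v" "\<phi>1 p v = (if j = 0 then 1 else - 1) *\<^sub>R v"
        using sgn[OF ij(1) v(1)] sgn[OF ij(2) v(2)] 1 by linarith+
      ultimately show ?thesis using same sg by blast
    next
      case 2
      have "(if i = 2 then 1 else - 1 :: real) = - (if j = 2 then 1 else - 1)" using 2 ij by auto
      moreover have "\<phi>2 p v = (if i = 2 then 1 else - 1) *\<^sub>R v" "\<phi>2 p v = (if j = 2 then 1 else - 1) *\<^sub>R v"
        using sgn[OF ij(1) v(1)] sgn[OF ij(2) v(2)] 2 by linarith+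
      ultimately show ?thesis using same sg by blast
    next
      case 3
      then show ?thesis using mixed[of "if i = 0 then 1 else - 1" "if j = 2 then 1 else - 1"]
          sgn[OF ij(1) v(1)] sgn[OF ij(2) v(2)] by simp
    next
      case 4
      then show ?thesis using mixed[of "if j = 0 then 1 else - 1" "if i = 2 then 1 else - 1"]
          sgn[OF ij(1) v(1)] sgn[OF ij(2) v(2)] by simp
    qed
  qed
  define F where "F i = normal_pair.eigen (\<psi> i)" for i
  have leg: "legendre_foliation M n \<eta> (F i)" if "i < 4" for i
    unfolding F_def by (rule normal_pair.legendre_eigen[OF ts[OF that] dim])
  moreover have "transverse M \<eta> (F i) (F j)" if ij: "i < 4" "j < 4" "i \<noteq> j" for i j
    unfolding transverse_def
  proof (intro ballI conjI)
    fix p assume p: "p \<in> points M"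
    interpret A: normal_pair M \<eta> \<xi> "\<psi> i" "\<kappa> i" by (rule ts[OF ij(1)])
    interpret B: normal_pair M \<eta> \<xi> "\<psi> j" "\<kappa> j" by (rule ts[OF ij(2)])
    show int: "F i p \<inter> F j p = {0}"
      using zero[OF p ij] A.subspace_eigen[OF p] B.subspace_eigen[OF p] subspace_0
      unfolding F_def A.eigen_def B.eigen_def by blast
    show "{v + w |v w. v \<in> F i p \<and> w \<in> F j p} = contact_distribution \<eta> p"
      using int unfolding F_def
      by (intro complementary_halves[OF A.subspace_eigen[OF p] B.subspace_eigen[OF p] A.subspace_contact[OF p]
          A.eigen_legendre[OF p] B.eigen_legendre[OF p] _ A.dim_eigen[OF p dim] B.dim_eigen[OF p dim] A.dim_contact[OF p dim]])
  qed
  moreover have "totally_geodesic M ?nab L \<and> (\<exists>nab. affine_structure L nab)"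
    if "i < 4" "leaf M (F i) L" for i and L :: "('a, 'l) mfd"
    using leaf_of_eigen[OF ts[OF that(1)] can[OF that(1)]] that(2) unfolding F_def by blast
  ultimately show ?thesis by blast
qed

end
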